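(* Let $T>0$ and $\alpha,\beta,\mu\in\mathbb{R}$ with $0\le\alpha<2$, $\alpha+\beta>1$ and $\mu<\mu(\alpha+\beta)$, where $\mu(\alpha+\beta)=\frac{(\alpha+\beta-1)^2}{4}$. Let $\kappa_\alpha:=\frac{2-\alpha}{2}$, $\nu:=\sqrt{\mu(\alpha+\beta)-\mu}\,/\kappa_\alpha$ and $\gamma:=-\frac{1+\alpha+\beta}{2}-\sqrt{\mu(\alpha+\beta)-\mu}$. Let $f\in L^2(0,T)$ and $u_0\in\mathcal{H}^{-s}$ with $s>\nu$. Then the formula $$\langle u(\tau),z^\tau\rangle_{\mathcal{H}^{-s},\mathcal{H}^s}=-\int_0^\tau f(t)\,\mathcal{O}_{\alpha+\beta+\gamma}(S(\tau-t)z^\tau)\,dt+\langle u_0,S(\tau)z^\tau\rangle_{\mathcal{H}^{-s},\mathcal{H}^s}\quad\text{for all }z^\tau\in\mathcal{H}^s\qquad( * )$$ defines for each $\tau\in[0,T]$ a unique element $u(\tau)\in\mathcal{H}^{-s}$ that can be written as $$u(\tau)=S(\tau)u_0-B(\tau)f,\quad\tau\in(0,T],$$ where $B(\tau)$ is the strongly continuous family of bounded operators $B(\tau):L^2(0,T)\to\mathcal{H}^{-s}$ given by $$\langle B(\tau)f,z^\tau\rangle_{\mathcal{H}^{-s},\mathcal{H}^s}=\int_0^\tau f(t)\,\mathcal{O}_{\alpha+\beta+\gamma}(S(\tau-t)z^\tau)\,dt\quad\text{for all }z^\tau\in\mathcal{H}^s.$$ Furthermore, the unique weak solution $u$ on $[0,T]$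 (in the sense of $( * )$) of the system $$\left\{\begin{aligned} &u_t-(x^\alpha u_x)_x-\beta x^{\alpha-1}u_x-\frac{\mu}{x^{2-\alpha}}u=0 &&\text{in }(0,1)\times(0,T),\\ &(x^{-\gamma}u_x)(0,t)=f(t),\quad u(1,t)=0 &&\text{on }(0,T),\\ &u(x,0)=u_0(x)&&\text{in }(0,1),\end{aligned}\right.$$ belongs to $C^0([0,T];\mathcal{H}^{-s})$ and fulfills, with a constant $C>0$ not depending on $u_0$ and $f$, $$\|u\|_{L^\infty([0,T];\mathcal{H}^{-s})}\le C\left(\|u_0\|_{\mathcal{H}^{-s}}+\|f\|_{L^2(0,T)}\right).$$
   Context: $J_\nu$ is the Bessel function of the first kind of order $\nu$, with positive zeros $0<j_{\nu,1}<j_{\nu,2}<\dots$. $L^2_\beta(0,1):=L^2((0,1);x^\beta dx)$ with inner product $\langle f,g\rangle_\beta=\int_0^1fg\,x^\beta dx$. For $k\ge1$ let $$\Phi_k(x)=\frac{(2\kappa_\alpha)^{1/2}}{|J_\nu'(j_{\nu,k})|}x^{(1-\alpha-\beta)/2}J_\nu(j_{\nu,k}x^{\kappa_\alpha}),\qquad\lambda_k=\kappa_\alpha^2j_{\nu,k}^2;$$ $(\Phi_k)_{k\ge1}$ is an orthonormal basis of $L^2_\beta(0,1)$. For $s\ge0$, $\mathcal{H}^s=\{u=\sum_ka_k\Phi_k:\ \|u\|_{\mathcal{H}^s}^2=\sum_k|a_k|^2\lambda_k^s<\infty\}$, and $\mathcal{H}^{-s}$ is its dual with respect to the pivot space $L^2_\beta(0,1)$,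 i.e. the completion of $L^2_\beta(0,1)$ for the norm $\|u\|_{-s}^2=\sum_k\lambda_k^{-s}|\langle u,\Phi_k\rangle_\beta|^2$. The semigroup $S(t)\sum_ka_k\Phi_k=\sum_ke^{-\lambda_kt}a_k\Phi_k$, $t\ge0$, acts on $\mathcal{H}^s$ for every $s\in\mathbb{R}$. For $\delta\in\mathbb{R}$ and $z:(0,1)\to\mathbb{R}$, $\mathcal{O}_\delta(z):=\lim_{x\to0^+}x^\delta z(x)$. A weak solution of the system is a function $u\in C^0([0,T];\mathcal{H}^{-s})$ satisfying $( * )$ for every $\tau\in(0,T]$ and every $z^\tau\in\mathcal{H}^s$. Strong continuity of $B(\tau)$ means that $\tau\mapsto B(\tau)f\in\mathcal{H}^{-s}$ is continuous for each $f\in L^2(0,T)$. *)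

theory Defs
  imports "HOL-Analysis.Analysis" "HOL-Probability.Essential_Supremum"
begin

section \<open>Bessel functions of the first kind and their positive zeros\<close>

text \<open>
  The usual power series, for real order; only arguments \<open>x > 0\<close> are meaningful,
  because of \<open>powr\<close>. Recall that \<open>rGamma\<close> is the reciprocal of the Gamma function.
\<close>

definition bessel_J :: "real \<Rightarrow> real \<Rightarrow> real" where
  "bessel_J \<nu> x =
     (\<Sum>m. (-1) ^ m / fact m * rGamma (\<nu> + real m + 1) * (x / 2) powr (2 * real m + \<nu>))"

text \<open>
  The increasing enumeration of the positive zeros, indexed from 0:
  \<open>bessel_zero \<nu> k\<close> is the zero usually written \<open>j\<close> with indices \<open>\<nu>, k + 1\<close>.
  The same shift by one applies to \<open>Phi\<close> and \<open>lam\<close> below.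
\<close>

definition bessel_zero :: "real \<Rightarrow> nat \<Rightarrow> real" where
  "bessel_zero \<nu> = (THE j. strict_mono j \<and> range j = {x. 0 < x \<and> bessel_J \<nu> x = 0})"


section \<open>Square-integrable functions\<close>

text \<open>
  Elements of \<open>L\<^sup>2\<close> are represented by functions, not by classes modulo null sets.
\<close>

definition L2_space :: "'a measure \<Rightarrow> ('a \<Rightarrow> real) set" where
  "L2_space M = {f \<in> borel_measurable M. integrable M (\<lambda>x. (f x)\<^sup>2)}"

definition L2_inner :: "'a measure \<Rightarrow> ('a \<Rightarrow> real) \<Rightarrow> ('a \<Rightarrow> real) \<Rightarrow> real" where
  "L2_inner M f g = (LINT x|M. f x * g x)"

definition L2_space_norm :: "'a measure \<Rightarrow> ('a \<Rightarrow> real) \<Rightarrow> real" where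
  "L2_space_norm M f = sqrt (L2_inner M f f)"

definition weighted_measure :: "real \<Rightarrow> real measure" where
  "weighted_measure \<beta> = density (lebesgue_on {0<..<1}) (\<lambda>x. ennreal (x powr \<beta>))"


section \<open>The parameters, the eigenfunctions and the eigenvalues\<close>

definition mu_crit :: "real \<Rightarrow> real" where
  "mu_crit \<delta> = (\<delta> - 1)\<^sup>2 / 4"

definition kappa :: "real \<Rightarrow> real" where
  "kappa \<alpha> = (2 - \<alpha>) / 2"

context
  fixes \<alpha> \<beta> \<mu> :: real
begin

definition nu :: real where
  "nu = sqrt (mu_crit (\<alpha> + \<beta>) - \<mu>) / kappa \<alpha>"

definition gam :: real where
  "gam = - (1 + \<alpha> + \<beta>) / 2 - sqrt (mu_crit (\<alpha> + \<beta>) - \<mu>)"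

definition Phi :: "nat \<Rightarrow> real \<Rightarrow> real" where
  "Phi k x = sqrt (2 * kappa \<alpha>) / \<bar>deriv (bessel_J nu) (bessel_zero nu k)\<bar>
     * x powr ((1 - \<alpha> - \<beta>) / 2) * bessel_J nu (bessel_zero nu k * x powr kappa \<alpha>)"

definition lam :: "nat \<Rightarrow> real" where
  "lam k = (kappa \<alpha>)\<^sup>2 * (bessel_zero nu k)\<^sup>2"

text \<open>The coefficient \<open>a\<^sub>k\<close> of \<open>u\<close> in the orthonormal basis \<open>Phi\<close>.\<close>

definition coef :: "(real \<Rightarrow> real) \<Rightarrow> nat \<Rightarrow> real" where
  "coef u k = L2_inner (weighted_measure \<beta>) u (Phi k)"


section \<open>The scale of spaces\<close>

definition Hs :: "real \<Rightarrow> (real \<Rightarrow> real) set" where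
  "Hs s = {u \<in> L2_space (weighted_measure \<beta>). \<exists>a.
      ((\<lambda>n. L2_space_norm (weighted_measure \<beta>) (\<lambda>x. u x - (\<Sum>k<n. a k * Phi k x))) \<longlonglongrightarrow> 0)
      \<and> summable (\<lambda>k. \<bar>a k\<bar>\<^sup>2 * lam k powr s)}"

definition Hs_norm :: "real \<Rightarrow> (real \<Rightarrow> real) \<Rightarrow> real" where
  "Hs_norm s u = sqrt (\<Sum>k. \<bar>coef u k\<bar>\<^sup>2 * lam k powr s)"

text \<open>
  The dual of \<open>Hs s\<close>: bounded linear functionals, normalised to be 0 outside \<open>Hs s\<close>, so that
  equality of functionals is equality on \<open>Hs s\<close>. The duality pairing is application.
  Functions that agree almost everywhere on (0,1) have difference of norm 0, hence are
  not separated by a bounded linear functional.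
  With \<open>L\<^sup>2\<close> as pivot space, \<open>u\<close> in the weighted \<open>L\<^sup>2\<close> is the functional
  \<open>\<lambda>z. L2_inner (weighted_measure \<beta>) u z\<close>, whose value at \<open>Phi k\<close> is \<open>coef u k\<close>. The norm is
  therefore the one for which the dual is the completion of \<open>L\<^sup>2\<close>.
\<close>

definition Hs_dual :: "real \<Rightarrow> ((real \<Rightarrow> real) \<Rightarrow> real) set" where
  "Hs_dual s = {\<phi>.
      (\<forall>z\<in>Hs s. \<forall>w\<in>Hs s. \<forall>a b. \<phi> (\<lambda>x. a * z x + b * w x) = a * \<phi> z + b * \<phi> w)
      \<and> (\<exists>K. \<forall>z\<in>Hs s. \<bar>\<phi> z\<bar> \<le> K * Hs_norm s z)
      \<and> (\<forall>z. z \<notin> Hs s \<longrightarrow> \<phi> z = 0)}"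

definition Hs_dual_norm :: "real \<Rightarrow> ((real \<Rightarrow> real) \<Rightarrow> real) \<Rightarrow> real" where
  "Hs_dual_norm s \<phi> = sqrt (\<Sum>k. lam k powr (- s) * \<bar>\<phi> (Phi k)\<bar>\<^sup>2)"

definition C0_dual :: "real \<Rightarrow> real \<Rightarrow> (real \<Rightarrow> (real \<Rightarrow> real) \<Rightarrow> real) set" where
  "C0_dual s T = {u. \<forall>t\<in>{0..T}. u t \<in> Hs_dual s
      \<and> ((\<lambda>r. Hs_dual_norm s (\<lambda>z. u r z - u t z)) \<longlongrightarrow> 0) (at t within {0..T})}"


section \<open>The semigroup\<close>

text \<open>
  On functions, the representative of the semigroup at positive times is the pointwise sum of
  the series; this is the representative whose behaviour at the origin is considered.
  At time 0 the series need only converge in \<open>L\<^sup>2\<close>, and its sum is \<open>z\<close>.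
\<close>

definition semigroup_fun :: "real \<Rightarrow> (real \<Rightarrow> real) \<Rightarrow> real \<Rightarrow> real" where
  "semigroup_fun t z =
     (if t = 0 then z else (\<lambda>x. \<Sum>k. exp (- lam k * t) * coef z k * Phi k x))"

text \<open>
  On the dual space, the coefficients of \<open>\<phi>\<close> are \<open>\<phi> (Phi k)\<close>, and \<open>Phi k\<close> as an element of the
  dual is the functional \<open>\<lambda>z. L2_inner (weighted_measure \<beta>) (Phi k) z\<close>, i.e. \<open>\<lambda>z. coef z k\<close>.
\<close>

definition semigroup_dual :: "real \<Rightarrow> real \<Rightarrow> ((real \<Rightarrow> real) \<Rightarrow> real) \<Rightarrow> (real \<Rightarrow> real) \<Rightarrow> real" where
  "semigroup_dual s t \<phi> z =
     (if z \<in> Hs s then \<Sum>k. exp (- lam k * t) * \<phi> (Phi k) * coef z k else 0)"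

end


section \<open>Boundary value, transposition formula and weak solutions\<close>

definition bdry_exists :: "real \<Rightarrow> (real \<Rightarrow> real) \<Rightarrow> bool" where
  "bdry_exists \<delta> z \<longleftrightarrow> (\<exists>l. ((\<lambda>x. x powr \<delta> * z x) \<longlongrightarrow> l) (at_right 0))"

definition bdry :: "real \<Rightarrow> (real \<Rightarrow> real) \<Rightarrow> real" where
  "bdry \<delta> z = Lim (at_right 0) (\<lambda>x. x powr \<delta> * z x)"

context
  fixes \<alpha> \<beta> \<mu> :: real
begin

definition bdry_semigroup :: "real \<Rightarrow> (real \<Rightarrow> real) \<Rightarrow> real" where
  "bdry_semigroup t z = bdry (\<alpha> + \<beta> + gam \<alpha> \<beta> \<mu>) (semigroup_fun \<alpha> \<beta> \<mu> t z)"

definition control_op :: "real \<Rightarrow> real \<Rightarrow> (real \<Rightarrow> real) \<Rightarrow> (real \<Rightarrow> real) \<Rightarrow> real" where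
  "control_op s \<tau> f z =
     (if z \<in> Hs \<alpha> \<beta> \<mu> s then LINT t:{0<..<\<tau>}|lebesgue. f t * bdry_semigroup (\<tau> - t) z else 0)"

definition transposition ::
    "real \<Rightarrow> ((real \<Rightarrow> real) \<Rightarrow> real) \<Rightarrow> (real \<Rightarrow> real) \<Rightarrow> real \<Rightarrow> ((real \<Rightarrow> real) \<Rightarrow> real) \<Rightarrow> bool" where
  "transposition s u0 f \<tau> v \<longleftrightarrow> (\<forall>z\<in>Hs \<alpha> \<beta> \<mu> s.
      v z = - (LINT t:{0<..<\<tau>}|lebesgue. f t * bdry_semigroup (\<tau> - t) z)
            + u0 (semigroup_fun \<alpha> \<beta> \<mu> \<tau> z))"

text \<open>
  Weak solutions, in the sense of transposition, on the time interval \<open>[0, T]\<close> of the problem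
  \<^item> \<open>u\<^sub>t - (x\<^sup>\<alpha> u\<^sub>x)\<^sub>x - \<beta> x\<^bsup>\<alpha> - 1\<^esup> u\<^sub>x - \<mu> / x\<^bsup>2 - \<alpha>\<^esup> u = 0\<close> in \<open>(0, 1) \<times> (0, T)\<close>,
  \<^item> \<open>(x\<^bsup>- \<gamma>\<^esup> u\<^sub>x) (0, t) = f t\<close> and \<open>u (1, t) = 0\<close> for \<open>t\<close> in \<open>(0, T)\<close>,
  \<^item> \<open>u (x, 0) = u0 x\<close> for \<open>x\<close> in \<open>(0, 1)\<close>,

  where \<open>\<gamma>\<close> is \<open>gam \<alpha> \<beta> \<mu>\<close>.
\<close>

definition weak_solution ::
    "real \<Rightarrow> real \<Rightarrow> ((real \<Rightarrow> real) \<Rightarrow> real) \<Rightarrow> (real \<Rightarrow> real) \<Rightarrow> (real \<Rightarrow> (real \<Rightarrow> real) \<Rightarrow> real) \<Rightarrow> bool" where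
  "weak_solution s T u0 f u \<longleftrightarrow>
     u \<in> C0_dual \<alpha> \<beta> \<mu> s T \<and> (\<forall>\<tau>\<in>{0<..T}. transposition s u0 f \<tau> (u \<tau>))"

end

end

theory Submission
  imports Defs "HOL-Real_Asymp.Real_Asymp"
begin

text \<open>
  Everything is diagonal in the basis \<open>\<Phi>\<^sub>k\<close>. An element of the dual of \<open>\<H>\<^sup>s\<close> is the same
  thing as its sequence of values \<open>q\<^sub>k\<close> at the \<open>\<Phi>\<^sub>k\<close>, subject to
  \<open>\<Sum> \<lambda>\<^sub>k\<^bsup>-s\<^esup> q\<^sub>k\<^sup>2 < \<infinity>\<close> (\<open>dual_of_in_dual\<close>, \<open>dual_of_coefs\<close>). The semigroup multiplies
  \<open>q\<^sub>k\<close> by \<open>exp (- \<lambda>\<^sub>k \<tau>)\<close>, and the control operator applied to \<open>f\<close> has the coefficients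
  \<open>o\<^sub>k \<integral> f(t) exp (- \<lambda>\<^sub>k (\<tau> - t)) dt\<close> with \<open>o\<^sub>k\<close> the boundary value of \<open>\<Phi>\<^sub>k\<close> at the origin
  (\<open>control_op_eq\<close>). So the right-hand side of the transposition formula is the functional with
  coefficients \<open>solution_coef\<close>, which gives existence, uniqueness and the formula for the solution
  at once (\<open>transposition_iff\<close>).

  The condition \<open>s > \<nu>\<close> enters in one place, \<open>gain_in_dual_seq\<close>. By the Cauchy-Schwarz
  inequality in time the integral above is at most \<open>(2 \<lambda>\<^sub>k)\<^bsup>-1/2\<^esup>\<close> times the norm of \<open>f\<close>;
  moreover \<open>\<bar>o\<^sub>k\<bar> \<le> C \<lambda>\<^sub>k\<^bsup>(\<nu> + 1/2)/2\<^esup>\<close> and \<open>\<lambda>\<^sub>k \<ge> c (k + 1)\<^sup>2\<close>. The control operator is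
  therefore bounded, uniformly in \<open>\<tau>\<close>, because \<open>\<Sum> \<lambda>\<^sub>k\<^bsup>-s + \<nu> - 1/2\<^esup>\<close> converges for \<open>s > \<nu>\<close>.
  The same summable majorant, with dominated convergence for series, turns the continuity in
  time of each single coefficient into strong continuity (\<open>C0_dual_of\<close>).

  The two bounds rest on the zeros \<open>j\<^sub>k\<close> of \<open>J\<^sub>\<nu>\<close> and on \<open>J\<^sub>\<nu>'\<close> at these zeros. The
  function \<open>w(x) = \<surd>x J\<^sub>\<nu>(x)\<close> satisfies
  \<open>w'' = ((\<nu>\<^sup>2 - 1/4)/x\<^sup>2 - 1) w\<close>, a perturbation of \<open>w'' = -w\<close> that is integrable at infinity,
  so that \<open>w'\<^sup>2 + w\<^sup>2\<close> stays, away from the origin, between two positive constants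
  (\<open>bessel_w_energy_bounds\<close>). At a zero
  this quantity is \<open>w'\<^sup>2\<close>; hence \<open>\<bar>J\<^sub>\<nu>'(j\<^sub>k)\<bar> \<ge> c j\<^sub>k\<^bsup>-1/2\<^esup>\<close>, and consecutive zeros keep a
  distance at least \<open>d > 0\<close>. Comparison with \<open>sin (x/2)\<close> shows that there are infinitely many
  zeros.

  Orthonormality of the \<open>\<Phi>\<^sub>k\<close> comes from explicit antiderivatives (Lommel). As an element of
  \<open>\<H>\<^sup>s\<close> is by definition the \<open>L\<^sup>2\<close>-sum of a series in the \<open>\<Phi>\<^sub>k\<close>, orthonormality identifies
  the coefficients of this series with its Fourier coefficients (\<open>Hs_iff\<close>).
\<close>

section \<open>The entire function behind the Bessel function\<close>

definition bessel_coeff :: "real \<Rightarrow> nat \<Rightarrow> real" where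
  "bessel_coeff \<nu> m = (-1) ^ m / fact m * rGamma (\<nu> + real m + 1)"

text \<open>
  \<open>J\<^sub>\<nu>(x) = (x/2)\<^sup>\<nu> G\<^sub>\<nu>(x\<^sup>2/4)\<close> with this entire function \<open>G\<^sub>\<nu>\<close>, which has
  no singularity at 0 and which can be differentiated term by term.
\<close>

definition bessel_entire :: "real \<Rightarrow> real \<Rightarrow> real" where
  "bessel_entire \<nu> t = (\<Sum>m. bessel_coeff \<nu> m * t ^ m)"

lemma bessel_coeff_raise_order:
  "bessel_coeff \<nu> m = (\<nu> + real m + 1) * bessel_coeff (\<nu> + 1) m"
  using rGamma_plus1[of "\<nu> + real m + 1"] by (simp add: bessel_coeff_def algebra_simps)

lemma diffs_bessel_coeff: "diffs (bessel_coeff \<nu>) m = - bessel_coeff (\<nu> + 1) m"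
proof -
  have "\<nu> + real (Suc m) + 1 = \<nu> + 1 + real m + 1" by simp
  then show ?thesis
    unfolding diffs_def bessel_coeff_def fact_Suc power_Suc
    by (simp add: field_simps del: of_nat_Suc) (simp add: algebra_simps)
qed

lemma bessel_coeff_Suc:
  "real (Suc m) * bessel_coeff \<nu> (Suc m) = - bessel_coeff (\<nu> + 1) m"
  using diffs_bessel_coeff[of \<nu> m] by (simp add: diffs_def)

text \<open>
  The ratio of consecutive coefficients is \<open>- 1 / ((m + 1) (\<nu> + m + 1))\<close>; comparison with the
  exponential series makes \<open>G\<^sub>\<nu>\<close> entire.
\<close>

lemma bessel_coeff_bound:
  assumes "\<nu> \<ge> 0" shows "\<bar>bessel_coeff \<nu> m\<bar> \<le> \<bar>bessel_coeff \<nu> 0\<bar> / fact m"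
proof (induction m)
  case (Suc m)
  let ?c = "\<bar>bessel_coeff (\<nu> + 1) m\<bar>"
  have "real (Suc m) * \<bar>bessel_coeff \<nu> (Suc m)\<bar> = ?c"
    using arg_cong[OF bessel_coeff_Suc[of m \<nu>], of abs] by (simp add: abs_mult)
  also have "?c \<le> (\<nu> + real m + 1) * ?c"
    using assms mult_right_mono[of 1 "\<nu> + real m + 1" ?c] by simp
  also have "\<dots> = \<bar>bessel_coeff \<nu> m\<bar>"
    using assms by (simp add: bessel_coeff_raise_order[of \<nu> m] abs_mult)
  finally have "\<bar>bessel_coeff \<nu> (Suc m)\<bar> \<le> \<bar>bessel_coeff \<nu> m\<bar> / real (Suc m)"
    by (simp add: field_simps)
  also have "\<dots> \<le> \<bar>bessel_coeff \<nu> 0\<bar> / fact m / real (Suc m)"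
    using Suc by (intro divide_right_mono) auto
  finally show ?case by (simp add: field_simps)
qed simp

lemma summable_bessel_entire:
  assumes "\<nu> \<ge> 0" shows "summable (\<lambda>m. bessel_coeff \<nu> m * t ^ m)"
proof (rule summable_comparison_test'[of "\<lambda>m. \<bar>bessel_coeff \<nu> 0\<bar> * (\<bar>t\<bar> ^ m /\<^sub>R fact m)" 0])
  show "summable (\<lambda>m. \<bar>bessel_coeff \<nu> 0\<bar> * (\<bar>t\<bar> ^ m /\<^sub>R fact m))"
    by (intro summable_mult summable_exp_generic)
  fix m
  show "norm (bessel_coeff \<nu> m * t ^ m) \<le> \<bar>bessel_coeff \<nu> 0\<bar> * (\<bar>t\<bar> ^ m /\<^sub>R fact m)"
    using mult_right_mono[OF bessel_coeff_bound[OF assms, of m], of "\<bar>t\<bar> ^ m"]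
    by (simp add: abs_mult power_abs field_simps)
qed

lemma DERIV_bessel_entire:
  assumes "\<nu> \<ge> 0"
  shows "(bessel_entire \<nu> has_field_derivative - bessel_entire (\<nu> + 1) t) (at t)"
proof -
  have "((\<lambda>t. \<Sum>m. bessel_coeff \<nu> m * t ^ m) has_field_derivative
      (\<Sum>m. diffs (bessel_coeff \<nu>) m * t ^ m)) (at t)"
    by (rule termdiffs_strong_converges_everywhere) (rule summable_bessel_entire[OF assms])
  also have "(\<Sum>m. diffs (bessel_coeff \<nu>) m * t ^ m) = - bessel_entire (\<nu> + 1) t"
    using summable_bessel_entire[of "\<nu> + 1" t] assms
    by (simp add: diffs_bessel_coeff suminf_minus bessel_entire_def)
  finally show ?thesis unfolding bessel_entire_def[abs_def] .
qed

lemma DERIV_bessel_entire_compose [derivative_intros]: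
  assumes "\<nu> \<ge> 0" and "(g has_field_derivative g') (at t within S)"
  shows "((\<lambda>t. bessel_entire \<nu> (g t)) has_field_derivative
           - bessel_entire (\<nu> + 1) (g t) * g') (at t within S)"
  using DERIV_chain2[OF DERIV_bessel_entire[OF assms(1)] assms(2)] .

lemma bessel_entire_0: "bessel_entire \<nu> 0 = rGamma (\<nu> + 1)"
  unfolding bessel_entire_def using powser_zero[of "bessel_coeff \<nu>"] by (simp add: bessel_coeff_def)

text \<open>
  Since \<open>G\<^sub>\<nu>' = - G\<^bsub>\<nu>+1\<^esub>\<close>, this is the differential equation \<open>t G'' + (\<nu> + 1) G' + G = 0\<close>, that is,
  the Bessel equation in the variable \<open>t = x\<^sup>2/4\<close>.
\<close>

lemma bessel_entire_recurrence:
  assumes "\<nu> \<ge> 0"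
  shows "t * bessel_entire (\<nu> + 2) t = (\<nu> + 1) * bessel_entire (\<nu> + 1) t - bessel_entire \<nu> t"
proof -
  note s0 = summable_bessel_entire[OF assms, of t]
  have s1: "summable (\<lambda>m. bessel_coeff (\<nu> + 1) m * t ^ m)"
    and s2: "summable (\<lambda>m. bessel_coeff (\<nu> + 2) m * t ^ m)"
    using assms by (auto intro!: summable_bessel_entire)
  have "(\<nu> + 1) * bessel_entire (\<nu> + 1) t - bessel_entire \<nu> t
      = (\<Sum>m. (\<nu> + 1) * (bessel_coeff (\<nu> + 1) m * t ^ m) - bessel_coeff \<nu> m * t ^ m)"
    unfolding bessel_entire_def
    by (subst suminf_diff[OF summable_mult[OF s1] s0, symmetric]) (simp add: suminf_mult s1)
  also have "\<dots> = (\<Sum>m. - (real m * bessel_coeff (\<nu> + 1) m * t ^ m))"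
    by (simp add: bessel_coeff_raise_order[of \<nu>] algebra_simps)
  also have "\<dots> = (\<Sum>m. t * (bessel_coeff (\<nu> + 2) m * t ^ m))"
  proof -
    have *: "- (real (Suc m) * bessel_coeff (\<nu> + 1) (Suc m) * t ^ Suc m)
        = t * (bessel_coeff (\<nu> + 2) m * t ^ m)" for m
      using bessel_coeff_Suc[of m "\<nu> + 1"] by (simp add: algebra_simps)
    have "summable (\<lambda>m. - (real m * bessel_coeff (\<nu> + 1) m * t ^ m))"
      unfolding summable_Suc_iff[symmetric, of "\<lambda>m. - (real m * bessel_coeff (\<nu> + 1) m * t ^ m)"] *
      using s2 by (rule summable_mult)
    from suminf_split_head[OF this] show ?thesis unfolding * by simp
  qed
  also have "\<dots> = t * bessel_entire (\<nu> + 2) t"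
    unfolding bessel_entire_def using s2 by (rule suminf_mult)
  finally show ?thesis by simp
qed

lemma bessel_J_eq_entire:
  assumes "\<nu> \<ge> 0" "x > 0"
  shows "bessel_J \<nu> x = (x / 2) powr \<nu> * bessel_entire \<nu> (x\<^sup>2 / 4)"
proof -
  have "(x / 2) powr (2 * real m + \<nu>) = (x / 2) powr \<nu> * (x\<^sup>2 / 4) ^ m" for m
  proof -
    have "(x / 2) powr (2 * real m) = (x / 2) ^ (2 * m)"
      using assms by (subst powr_realpow[symmetric]) auto
    also have "\<dots> = (x\<^sup>2 / 4) ^ m" by (simp add: power_mult power_divide)
    finally show ?thesis by (simp add: powr_add)
  qed
  then have "bessel_J \<nu> x = (\<Sum>m. (x / 2) powr \<nu> * (bessel_coeff \<nu> m * (x\<^sup>2 / 4) ^ m))"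
    unfolding bessel_J_def bessel_coeff_def by (intro suminf_cong) simp
  then show ?thesis
    unfolding bessel_entire_def using suminf_mult[OF summable_bessel_entire[OF assms(1)]] by simp
qed

lemma DERIV_bessel_J_zero:
  assumes "\<nu> \<ge> 0" "x > 0" "bessel_J \<nu> x = 0"
  shows "(bessel_J \<nu> has_field_derivative - ((x / 2) powr (\<nu> + 1) * bessel_entire (\<nu> + 1) (x\<^sup>2 / 4))) (at x)"
proof -
  have z: "bessel_entire \<nu> (x\<^sup>2 / 4) = 0"
    using assms bessel_J_eq_entire[of \<nu> x] by simp
  have "((\<lambda>x. (x / 2) powr \<nu> * bessel_entire \<nu> (x\<^sup>2 / 4)) has_field_derivative
      - ((x / 2) powr (\<nu> + 1) * bessel_entire (\<nu> + 1) (x\<^sup>2 / 4))) (at x)"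
    using assms z by (auto intro!: derivative_eq_intros simp: powr_add)
  then show ?thesis
    using assms eventually_nhds_in_open[of "{0<..}" x]
    by (subst DERIV_cong_ev[OF refl _ refl, where g = "\<lambda>x. (x / 2) powr \<nu> * bessel_entire \<nu> (x\<^sup>2 / 4)"])
      (auto elim!: eventually_mono simp: bessel_J_eq_entire)
qed

section \<open>Energy estimates for the Bessel equation\<close>

text \<open>
  This is \<open>2\<^sup>\<nu> \<surd>x J\<^sub>\<nu>(x)\<close>: the factor \<open>\<surd>x\<close> removes the first-order term of the Bessel equation.
\<close>

definition bessel_w :: "real \<Rightarrow> real \<Rightarrow> real" where
  "bessel_w \<nu> x = x powr (\<nu> + 1/2) * bessel_entire \<nu> (x\<^sup>2 / 4)"

text \<open>
  The derivative of \<open>bessel_w\<close> on \<open>x > 0\<close>, as a function in its own right so that it can be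
  differentiated again.
\<close>

definition bessel_w' :: "real \<Rightarrow> real \<Rightarrow> real" where
  "bessel_w' \<nu> x = (\<nu> + 1/2) * x powr (\<nu> - 1/2) * bessel_entire \<nu> (x\<^sup>2 / 4)
     - x powr (\<nu> + 3/2) / 2 * bessel_entire (\<nu> + 1) (x\<^sup>2 / 4)"

lemma DERIV_bessel_w:
  assumes "\<nu> \<ge> 0" "x > 0"
  shows "(bessel_w \<nu> has_field_derivative bessel_w' \<nu> x) (at x)"
proof -
  have "x powr (\<nu> + 3/2) = x powr (\<nu> + 1/2) * x" "x powr (\<nu> + 1/2) = x powr (\<nu> - 1/2) * x"
    using assms powr_add[of x "\<nu> + 1/2" 1] powr_add[of x "\<nu> - 1/2" 1] by (simp_all add: algebra_simps)
  then show ?thesis unfolding bessel_w_def[abs_def] bessel_w'_def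
    using assms by (auto intro!: derivative_eq_intros simp: field_simps)
qed

lemma DERIV_bessel_w':
  assumes "\<nu> \<ge> 0" "x > 0"
  shows "(bessel_w' \<nu> has_field_derivative ((\<nu>\<^sup>2 - 1/4) / x\<^sup>2 - 1) * bessel_w \<nu> x) (at x)"
proof -
  let ?p = "x powr (\<nu> - 3/2)" and ?t = "x\<^sup>2 / 4"
  have e1: "x powr (\<nu> - 1/2) = ?p * x" 
    using assms powr_add[of x "\<nu> - 3/2" 1] by (simp add: algebra_simps)
  have e2: "x powr (\<nu> + 1/2) = ?p * x^2" 
    using assms powr_add[of x "\<nu> - 3/2" "real 2"] unfolding powr_realpow[OF assms(2)] by (simp add: algebra_simps)
  have e3: "x powr (\<nu> + 3/2) = ?p * x^3" 
    using assms powr_add[of x "\<nu> - 3/2" "real 3"] unfolding powr_realpow[OF assms(2)] by (simp add: algebra_simps)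
  have e: "\<nu> + 1 + 1 = \<nu> + 2" "\<nu> - 1/2 - 1 = \<nu> - 3/2" "\<nu> + 3/2 - 1 = \<nu> + 1/2" by auto
  have G2: "bessel_entire (\<nu> + 2) ?t * x\<^sup>2 = 4 * ((\<nu> + 1) * bessel_entire (\<nu> + 1) ?t - bessel_entire \<nu> ?t)"
    using bessel_entire_recurrence[OF assms(1), of ?t] by (simp add: algebra_simps)
  have "(bessel_w' \<nu> has_field_derivative
      (\<nu> + 1/2) * ((\<nu> - 1/2) * ?p) * bessel_entire \<nu> ?t
      - (\<nu> + 1/2) * (?p * x) * (bessel_entire (\<nu> + 1) ?t * (x / 2))
      - ((\<nu> + 3/2) * (?p * x\<^sup>2) / 2 * bessel_entire (\<nu> + 1) ?t
          - ?p * x^3 / 2 * (bessel_entire (\<nu> + 2) ?t * (x / 2)))) (at x)"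
    unfolding bessel_w'_def[abs_def] using assms
    by (auto intro!: derivative_eq_intros simp: e e1 e2 e3)
      (simp add: field_simps power2_eq_square power3_eq_cube)
  also have "?p * x^3 / 2 * (bessel_entire (\<nu> + 2) ?t * (x / 2))
      = ?p * x\<^sup>2 / 4 * (bessel_entire (\<nu> + 2) ?t * x\<^sup>2)"
    by (simp add: power2_eq_square power3_eq_cube)
  also have "(\<nu> + 1/2) * ((\<nu> - 1/2) * ?p) * bessel_entire \<nu> ?t
      - (\<nu> + 1/2) * (?p * x) * (bessel_entire (\<nu> + 1) ?t * (x / 2))
      - ((\<nu> + 3/2) * (?p * x\<^sup>2) / 2 * bessel_entire (\<nu> + 1) ?t - ?p * x\<^sup>2 / 4 * (bessel_entire (\<nu> + 2) ?t * x\<^sup>2))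
    = ((\<nu>\<^sup>2 - 1/4) / x\<^sup>2 - 1) * bessel_w \<nu> x"
    unfolding G2 bessel_w_def e2 using assms by (simp add: field_simps power2_eq_square)
  finally show ?thesis .
qed

definition bessel_energy :: "real \<Rightarrow> real \<Rightarrow> real" where
  "bessel_energy \<nu> x = (bessel_w' \<nu> x)\<^sup>2 + (bessel_w \<nu> x)\<^sup>2"

lemma bessel_energy_nonneg: "bessel_energy \<nu> x \<ge> 0"
  by (simp add: bessel_energy_def)

lemma DERIV_bessel_energy:
  assumes "\<nu> \<ge> 0" "x > 0"
  shows "(bessel_energy \<nu> has_field_derivative
           2 * bessel_w \<nu> x * bessel_w' \<nu> x * ((\<nu>\<^sup>2 - 1/4) / x\<^sup>2)) (at x)"
  unfolding bessel_energy_def[abs_def]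
  by (rule derivative_eq_intros DERIV_bessel_w DERIV_bessel_w' assms refl)+
    (simp add: algebra_simps)

lemma bessel_energy_deriv_bound:
  "\<bar>2 * bessel_w \<nu> x * bessel_w' \<nu> x * ((\<nu>\<^sup>2 - 1/4) / x\<^sup>2)\<bar>
     \<le> bessel_energy \<nu> x * (\<bar>\<nu>\<^sup>2 - 1/4\<bar> / x\<^sup>2)"
proof -
  have "2 * \<bar>bessel_w \<nu> x\<bar> * \<bar>bessel_w' \<nu> x\<bar> \<le> bessel_energy \<nu> x"
    unfolding bessel_energy_def
    using sum_squares_bound[of "\<bar>bessel_w \<nu> x\<bar>" "\<bar>bessel_w' \<nu> x\<bar>"] by (simp add: ac_simps)
  from mult_right_mono[OF this, of "\<bar>\<nu>\<^sup>2 - 1/4\<bar> / x\<^sup>2"] show ?thesis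
    by (simp add: abs_mult)
qed

text \<open>
  The derivative of the energy is at most \<open>a/x\<^sup>2\<close> times the energy, by \<open>2 \<bar>w w'\<bar> \<le> w'\<^sup>2 + w\<^sup>2\<close>.
  As \<open>a/x\<^sup>2\<close> is the derivative of \<open>- a/x\<close>, the factors \<open>exp (\<plusminus> a/x)\<close> make the energy monotone
  in either direction, which is the Gronwall argument on a half-line.
\<close>

lemma bessel_energy_comparison:
  assumes "\<nu> \<ge> 0" "0 < x" "x \<le> y"
  defines "a \<equiv> \<bar>\<nu>\<^sup>2 - 1/4\<bar>"
  shows "bessel_energy \<nu> x * exp (- a / x) \<le> bessel_energy \<nu> y * exp (- a / y)"
    and "bessel_energy \<nu> y * exp (a / y) \<le> bessel_energy \<nu> x * exp (a / x)"
proof -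
  let ?E' = "\<lambda>t. 2 * bessel_w \<nu> t * bessel_w' \<nu> t * ((\<nu>\<^sup>2 - 1/4) / t\<^sup>2)"
  have bd: "\<bar>?E' t\<bar> \<le> bessel_energy \<nu> t * (a / t\<^sup>2)" for t
    using bessel_energy_deriv_bound unfolding a_def .
  have exp_div_deriv: "((\<lambda>x. exp (c / x)) has_field_derivative exp (c / t) * (- c / t\<^sup>2)) (at t)"
    if "t > 0" for c t :: real
    using that by (auto intro!: derivative_eq_intros simp: power2_eq_square)
  show "bessel_energy \<nu> x * exp (- a / x) \<le> bessel_energy \<nu> y * exp (- a / y)"
  proof (rule DERIV_nonneg_imp_nondecreasing[OF assms(3)])
    fix t assume t: "x \<le> t" "t \<le> y"
    then have t0: "t > 0" using assms(2) by simp
    have "((\<lambda>x. bessel_energy \<nu> x * exp (- a / x)) has_field_derivative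
        (?E' t + bessel_energy \<nu> t * (a / t\<^sup>2)) * exp (- a / t)) (at t)"
      by (rule DERIV_cong[OF DERIV_mult[OF DERIV_bessel_energy[OF assms(1) t0] exp_div_deriv[OF t0, of "-a"]]])
        (simp add: algebra_simps)
    moreover have "0 \<le> (?E' t + bessel_energy \<nu> t * (a / t\<^sup>2)) * exp (- a / t)"
      using bd[of t] by (intro mult_nonneg_nonneg) (auto simp del: times_divide_eq_right)
    ultimately show "\<exists>z. ((\<lambda>x. bessel_energy \<nu> x * exp (- a / x)) has_real_derivative z) (at t) \<and> 0 \<le> z"
      by blast
  qed
  show "bessel_energy \<nu> y * exp (a / y) \<le> bessel_energy \<nu> x * exp (a / x)"
  proof (rule DERIV_nonpos_imp_nonincreasing[OF assms(3)])
    fix t assume t: "x \<le> t" "t \<le> y"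
    then have t0: "t > 0" using assms(2) by simp
    have "((\<lambda>x. bessel_energy \<nu> x * exp (a / x)) has_field_derivative
        (?E' t - bessel_energy \<nu> t * (a / t\<^sup>2)) * exp (a / t)) (at t)"
      by (rule DERIV_cong[OF DERIV_mult[OF DERIV_bessel_energy[OF assms(1) t0] exp_div_deriv[OF t0, of "a"]]])
        (simp add: algebra_simps)
    moreover have "(?E' t - bessel_energy \<nu> t * (a / t\<^sup>2)) * exp (a / t) \<le> 0"
      using bd[of t] by (intro mult_nonpos_nonneg) (auto simp del: times_divide_eq_right)
    ultimately show "\<exists>z. ((\<lambda>x. bessel_energy \<nu> x * exp (a / x)) has_real_derivative z) (at t) \<and> z \<le> 0"
      by blast
  qed
qed

lemma isCont_bessel_entire: "\<nu> \<ge> 0 \<Longrightarrow> isCont (bessel_entire \<nu>) t"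
  using DERIV_bessel_entire DERIV_isCont by blast

lemma continuous_on_bessel_entire: "\<nu> \<ge> 0 \<Longrightarrow> continuous_on S (bessel_entire \<nu>)"
  by (simp add: continuous_at_imp_continuous_on isCont_bessel_entire)

text \<open>
  The comparison is started at a point \<open>x0\<close> so small that \<open>w > 0\<close> on \<open>(0, x0]\<close>. Then the
  energy at \<open>x0\<close> is positive, and every positive zero lies beyond \<open>x0\<close>, where the two-sided bound
  holds.
\<close>

lemma bessel_w_energy_bounds:
  assumes "\<nu> \<ge> 0"
  obtains x0 c C where "x0 > 0" "c > 0" "C > 0"
    "\<And>x. 0 < x \<Longrightarrow> x \<le> x0 \<Longrightarrow> bessel_w \<nu> x > 0"
    "\<And>x. x0 \<le> x \<Longrightarrow> c \<le> bessel_energy \<nu> x"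
    "\<And>x. x0 \<le> x \<Longrightarrow> bessel_energy \<nu> x \<le> C"
proof -
  have "bessel_entire \<nu> 0 > 0"
    using assms by (simp add: bessel_entire_0 rGamma_inverse_Gamma)
  moreover have "isCont (\<lambda>x. bessel_entire \<nu> (x\<^sup>2 / 4)) 0"
    by (rule isCont_o2[OF _ isCont_bessel_entire[OF assms]]) (auto intro!: continuous_intros)
  ultimately have "eventually (\<lambda>x. bessel_entire \<nu> (x\<^sup>2 / 4) > 0) (at 0)"
    using order_tendstoD(1)[of "\<lambda>x. bessel_entire \<nu> (x\<^sup>2 / 4)" "bessel_entire \<nu> 0" "at 0" 0]
    by (simp add: isCont_def)
  then obtain d where d: "d > 0" "\<And>x. x \<noteq> 0 \<Longrightarrow> dist x 0 < d \<Longrightarrow> bessel_entire \<nu> (x\<^sup>2 / 4) > 0"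
    unfolding eventually_at by auto
  define x0 where "x0 = d / 2"
  define a where "a = \<bar>\<nu>\<^sup>2 - 1/4\<bar>"
  have x0: "x0 > 0" using d by (simp add: x0_def)
  have pos: "bessel_w \<nu> x > 0" if "0 < x" "x \<le> x0" for x
    using that d(2)[of x] d(1) by (simp add: bessel_w_def x0_def dist_norm)
  have E0: "bessel_energy \<nu> x0 > 0"
    using pos[of x0] x0 by (simp add: bessel_energy_def add_nonneg_pos)
  show thesis
  proof (rule that[of x0 "bessel_energy \<nu> x0 * exp (- a / x0)" "bessel_energy \<nu> x0 * exp (a / x0)"])
    fix x assume x: "x0 \<le> x"
    then have "x > 0" "a \<ge> 0" using x0 by (auto simp: a_def)
    note cmp = bessel_energy_comparison[OF assms x0 x, folded a_def]
    have "bessel_energy \<nu> x * exp (- a / x) \<le> bessel_energy \<nu> x * 1"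
      using \<open>x > 0\<close> \<open>a \<ge> 0\<close> by (intro mult_left_mono bessel_energy_nonneg) auto
    with cmp(1) show "bessel_energy \<nu> x0 * exp (- a / x0) \<le> bessel_energy \<nu> x" by simp
    have "bessel_energy \<nu> x * 1 \<le> bessel_energy \<nu> x * exp (a / x)"
      using \<open>x > 0\<close> \<open>a \<ge> 0\<close> by (intro mult_left_mono bessel_energy_nonneg) auto
    with cmp(2) show "bessel_energy \<nu> x \<le> bessel_energy \<nu> x0 * exp (a / x0)" by simp
  qed (use x0 E0 pos in auto)
qed

text \<open>
  On a compact interval by continuity; beyond it the energy bounds \<open>w\<close>, and \<open>G\<^sub>\<nu>\<close> is \<open>w\<close> divided
  by a positive power of \<open>x\<close>.
\<close>

lemma bessel_entire_bounded:
  assumes "\<nu> \<ge> 0"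
  obtains B where "B > 0" "\<And>t. t \<ge> 0 \<Longrightarrow> \<bar>bessel_entire \<nu> t\<bar> \<le> B"
proof -
  obtain x0 c C where x0: "x0 > 0" "C > 0" and C: "\<And>x. x0 \<le> x \<Longrightarrow> bessel_energy \<nu> x \<le> C"
    using bessel_w_energy_bounds[OF assms] by metis
  have "bounded (bessel_entire \<nu> ` {0..x0\<^sup>2 / 4})"
    by (intro compact_imp_bounded compact_continuous_image continuous_on_bessel_entire assms) auto
  then obtain B where "\<forall>y \<in> bessel_entire \<nu> ` {0..x0\<^sup>2 / 4}. norm y \<le> B"
    unfolding bounded_iff by blast
  then have B: "\<And>t. t \<in> {0..x0\<^sup>2 / 4} \<Longrightarrow> \<bar>bessel_entire \<nu> t\<bar> \<le> B" by simp
  have large: "\<bar>bessel_entire \<nu> t\<bar> \<le> sqrt C / x0 powr (\<nu> + 1/2)" if t: "t \<ge> x0\<^sup>2 / 4" for t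
  proof -
    define x where "x = 2 * sqrt t"
    have t0: "t \<ge> 0" using t by (rule order_trans[rotated]) auto
    then have tx: "t = x\<^sup>2 / 4" by (simp add: x_def power_mult_distrib)
    have xx0: "x0 \<le> x" using t unfolding tx
      by (intro power2_le_imp_le[of x0 x]) (auto simp: x_def t0)
    have "(bessel_w \<nu> x)\<^sup>2 \<le> C"
      using C[OF xx0] zero_le_power2[of "bessel_w' \<nu> x"] unfolding bessel_energy_def by linarith
    then have "\<bar>bessel_w \<nu> x\<bar> \<le> sqrt C"
      using real_sqrt_le_mono by fastforce
    then have "x powr (\<nu> + 1/2) * \<bar>bessel_entire \<nu> t\<bar> \<le> sqrt C"
      by (simp add: bessel_w_def abs_mult tx)
    moreover have "x0 powr (\<nu> + 1/2) * \<bar>bessel_entire \<nu> t\<bar> \<le> x powr (\<nu> + 1/2) * \<bar>bessel_entire \<nu> t\<bar>"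
      using x0 xx0 assms by (intro mult_right_mono powr_mono2) auto
    ultimately show ?thesis using x0 by (simp add: field_simps)
  qed
  show thesis
  proof (rule that[of "max B (sqrt C / x0 powr (\<nu> + 1/2))"])
    show "0 < max B (sqrt C / x0 powr (\<nu> + 1/2))" using x0 by (auto simp: less_max_iff_disj)
    fix t :: real assume "t \<ge> 0"
    then show "\<bar>bessel_entire \<nu> t\<bar> \<le> max B (sqrt C / x0 powr (\<nu> + 1/2))"
      using B[of t] large[of t] by (cases "t \<le> x0\<^sup>2 / 4") (auto simp: le_max_iff_disj)
  qed
qed

text \<open>
  Sturm comparison with \<open>sin ((x - Y)/2)\<close> on one of its nodal intervals: a solution without sign
  change there would make the Wronskian decrease while its boundary values increase.
\<close>

lemma bessel_w_zero_beyond: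
  assumes "\<nu> \<ge> 0"
  shows "\<exists>x>X. bessel_w \<nu> x = 0"
proof (rule ccontr)
  assume "\<not> ?thesis"
  then have nz: "bessel_w \<nu> x \<noteq> 0" if "x > X" for x using that by auto
  define a where "a = \<bar>\<nu>\<^sup>2 - 1/4\<bar>"
  \<comment> \<open>beyond this point \<open>(\<nu>\<^sup>2 - 1/4)/x\<^sup>2 - 1 \<le> -1/4\<close>, so \<open>w\<close> oscillates faster than \<open>sin (x/2)\<close>\<close>
  define Y where "Y = max (X + 1) (2 + 2 * a)"
  have Y: "Y > X" "Y > 0" "Y \<ge> 2 + 2 * a" "a \<ge> 0"
    by (simp_all add: Y_def a_def less_max_iff_disj add_pos_nonneg)
  define \<sigma> where "\<sigma> = sgn (bessel_w \<nu> Y)"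
  have cont: "isCont (bessel_w \<nu>) x" if "x > 0" for x
    using DERIV_isCont[OF DERIV_bessel_w[OF assms that]] .
  have pos: "\<sigma> * bessel_w \<nu> x > 0" if "x \<ge> Y" for x
  proof (rule ccontr)
    assume "\<not> ?thesis"
    moreover have "\<sigma> * bessel_w \<nu> Y > 0"
      using nz[of Y] Y by (simp add: \<sigma>_def sgn_mult_self_eq flip: abs_sgn)
         (metis abs_sgn mult.commute zero_less_abs_iff)
    ultimately have "\<exists>z. Y \<le> z \<and> z \<le> x \<and> \<sigma> * bessel_w \<nu> z = 0"
      using that Y cont by (intro IVT2) (auto intro!: continuous_intros)
    moreover have "\<sigma> \<noteq> 0" using nz[of Y] Y by (simp add: \<sigma>_def sgn_eq_0_iff)
    ultimately show False using nz Y by auto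
  qed
  \<comment> \<open>the Wronskian of \<open>w\<close> and \<open>sin ((x - Y)/2)\<close>; the sine vanishes at \<open>Y\<close> and \<open>Y + 2 \<pi>\<close>\<close>
  let ?W = "\<lambda>x. bessel_w' \<nu> x * sin ((x - Y) / 2) - bessel_w \<nu> x * (cos ((x - Y) / 2) / 2)"
  have "\<sigma> * ?W (Y + 2 * pi) \<le> \<sigma> * ?W Y"
  proof (rule DERIV_nonpos_imp_nonincreasing[of Y "Y + 2 * pi" "\<lambda>x. \<sigma> * ?W x"])
    fix x assume x: "Y \<le> x" "x \<le> Y + 2 * pi"
    then have x0: "x > 0" using Y by simp
    let ?q = "(\<nu>\<^sup>2 - 1/4) / x\<^sup>2 - 3/4"
    have sd: "((\<lambda>x. sin ((x - Y) / 2)) has_field_derivative cos ((x - Y) / 2) / 2) (at x)"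
      and cd: "((\<lambda>x. cos ((x - Y) / 2) / 2) has_field_derivative - sin ((x - Y) / 2) / 4) (at x)"
      by (auto intro!: derivative_eq_intros)
    have "((\<lambda>x. \<sigma> * ?W x) has_field_derivative ?q * (\<sigma> * bessel_w \<nu> x) * sin ((x - Y) / 2)) (at x)"
      by (rule DERIV_cong[OF DERIV_cmult[OF DERIV_diff[OF DERIV_mult[OF DERIV_bessel_w'[OF assms x0] sd]
          DERIV_mult[OF DERIV_bessel_w[OF assms x0] cd]]]]) (simp add: algebra_simps)
    moreover have "?q \<le> 0"
    proof -
      have "\<nu>\<^sup>2 - 1/4 \<le> a" by (simp add: a_def)
      also have "a \<le> 3/4 * (2 + 2 * a) * 1" using Y by simp
      also have "\<dots> \<le> 3/4 * x * x" using x Y by (intro mult_mono) auto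
      finally show ?thesis using x0 by (simp add: field_simps power2_eq_square)
    qed
    moreover have "sin ((x - Y) / 2) \<ge> 0" using x by (intro sin_ge_zero) auto
    ultimately show "\<exists>z. ((\<lambda>x. \<sigma> * ?W x) has_real_derivative z) (at x) \<and> z \<le> 0"
      using pos[OF x(1)] by (intro exI conjI) (auto intro!: mult_nonpos_nonneg simp del: times_divide_eq_right)
  qed simp
  then have "\<sigma> * bessel_w \<nu> (Y + 2 * pi) \<le> - (\<sigma> * bessel_w \<nu> Y)"
    by (simp add: algebra_simps)
  with pos[of Y] pos[of "Y + 2 * pi"] pi_ge_zero show False by linarith
qed

section \<open>The positive zeros and the derivative there\<close>

lemma bessel_J_zero_iff:
  "\<nu> \<ge> 0 \<Longrightarrow> x > 0 \<Longrightarrow> bessel_J \<nu> x = 0 \<longleftrightarrow> bessel_w \<nu> x = 0"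
  by (simp add: bessel_J_eq_entire bessel_w_def)

text \<open>
  Between two zeros \<open>w'\<close> vanishes somewhere, while \<open>\<bar>w'\<bar>\<close> is at least \<open>\<surd>c\<close> at the first one and
  changes with speed at most \<open>D\<close>; this takes a length \<open>\<surd>c / D\<close>.
\<close>

lemma bessel_zeros_separated:
  assumes "\<nu> \<ge> 0"
  obtains d where "d > 0" "\<And>x. 0 < x \<Longrightarrow> bessel_J \<nu> x = 0 \<Longrightarrow> d \<le> x"
    "\<And>x y. 0 < x \<Longrightarrow> x < y \<Longrightarrow> bessel_J \<nu> x = 0 \<Longrightarrow> bessel_J \<nu> y = 0 \<Longrightarrow> x + d \<le> y"
proof -
  obtain x0 c C where x0: "x0 > 0" "c > 0" "C > 0"
    and pos: "\<And>x. 0 < x \<Longrightarrow> x \<le> x0 \<Longrightarrow> bessel_w \<nu> x > 0"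
    and c: "\<And>x. x0 \<le> x \<Longrightarrow> c \<le> bessel_energy \<nu> x"
    and C: "\<And>x. x0 \<le> x \<Longrightarrow> bessel_energy \<nu> x \<le> C"
    using bessel_w_energy_bounds[OF assms] by metis
  define D where "D = (\<bar>\<nu>\<^sup>2 - 1/4\<bar> / x0\<^sup>2 + 1) * sqrt C"
  have D: "D > 0" using x0 unfolding D_def by (intro mult_pos_pos add_nonneg_pos) auto
  have w'': "\<bar>((\<nu>\<^sup>2 - 1/4) / x\<^sup>2 - 1) * bessel_w \<nu> x\<bar> \<le> D" if x: "x0 \<le> x" for x
  proof -
    have "\<bar>(\<nu>\<^sup>2 - 1/4) / x\<^sup>2 - 1\<bar> \<le> \<bar>\<nu>\<^sup>2 - 1/4\<bar> / x\<^sup>2 + 1"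
      using abs_triangle_ineq4[of "(\<nu>\<^sup>2 - 1/4) / x\<^sup>2" 1] by simp
    also have "\<dots> \<le> \<bar>\<nu>\<^sup>2 - 1/4\<bar> / x0\<^sup>2 + 1"
      using x x0 by (intro add_right_mono divide_left_mono power_mono mult_pos_pos) auto
    finally have 1: "\<bar>(\<nu>\<^sup>2 - 1/4) / x\<^sup>2 - 1\<bar> \<le> \<dots>" .
    have "(bessel_w \<nu> x)\<^sup>2 \<le> C"
      using C[OF x] zero_le_power2[of "bessel_w' \<nu> x"] unfolding bessel_energy_def by linarith
    then have "\<bar>bessel_w \<nu> x\<bar> \<le> sqrt C" using real_sqrt_le_mono by fastforce
    with 1 show ?thesis unfolding D_def abs_mult by (intro mult_mono) auto
  qed
  have "x + sqrt c / D \<le> y" if xy: "0 < x" "x < y" "bessel_J \<nu> x = 0" "bessel_J \<nu> y = 0" for x y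
  proof -
    have wx: "bessel_w \<nu> x = 0" and wy: "bessel_w \<nu> y = 0"
      using xy assms by (auto simp: bessel_J_zero_iff)
    have x: "x0 \<le> x" using pos[of x] xy wx by fastforce
    obtain \<xi> where \<xi>: "x < \<xi>" "\<xi> < y" "bessel_w \<nu> y - bessel_w \<nu> x = (y - x) * bessel_w' \<nu> \<xi>"
      using MVT2[OF xy(2), of "bessel_w \<nu>" "bessel_w' \<nu>"] DERIV_bessel_w[OF assms] xy(1) by force
    then have w'\<xi>: "bessel_w' \<nu> \<xi> = 0" using wx wy xy by simp
    obtain \<eta> where \<eta>: "x < \<eta>" "\<eta> < \<xi>"
      "bessel_w' \<nu> \<xi> - bessel_w' \<nu> x = (\<xi> - x) * (((\<nu>\<^sup>2 - 1/4) / \<eta>\<^sup>2 - 1) * bessel_w \<nu> \<eta>)"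
      using MVT2[OF \<xi>(1), of "bessel_w' \<nu>" "\<lambda>x. ((\<nu>\<^sup>2 - 1/4) / x\<^sup>2 - 1) * bessel_w \<nu> x"]
        DERIV_bessel_w'[OF assms] xy(1) by force
    have "sqrt c \<le> \<bar>bessel_w' \<nu> x\<bar>"
      using c[OF x] wx real_sqrt_le_mono[of c "(bessel_w' \<nu> x)\<^sup>2"] by (simp add: bessel_energy_def)
    also have "\<dots> = \<bar>bessel_w' \<nu> \<xi> - bessel_w' \<nu> x\<bar>" using w'\<xi> by simp
    also have "\<dots> \<le> (\<xi> - x) * D"
      unfolding \<eta>(3) abs_mult using w''[of \<eta>] \<eta> \<xi> x
      by (simp add: abs_mult mult_left_mono)
    finally have "sqrt c / D \<le> \<xi> - x" using D by (simp add: field_simps)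
    with \<xi> show ?thesis by simp
  qed
  moreover have "x0 \<le> x" if "0 < x" "bessel_J \<nu> x = 0" for x
    using that pos[of x] assms by (fastforce simp: bessel_J_zero_iff)
  ultimately show thesis
    using x0 D by (intro that[of "min x0 (sqrt c / D)"]) (force simp: min_def)+
qed

text \<open>
  Applied in both directions, this shows that an increasing enumeration is determined by its range.
\<close>

lemma strict_mono_same_range_le:
  fixes f g :: "nat \<Rightarrow> 'a::linorder"
  assumes "strict_mono f" "strict_mono g" "range f = range g"
  shows "g n \<le> f n"
proof -
  have "\<forall>n. \<exists>m. f n = g m" using assms(3) by (metis rangeE rangeI)
  then obtain h where h: "\<And>n. f n = g (h n)" by metis
  then have "strict_mono h"
    using assms(1,2) by (auto simp: strict_mono_def) (metis strict_mono_less assms(2))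
  then have "n \<le> h n" by (rule strict_mono_imp_increasing)
  then show ?thesis unfolding h using assms(2) by (simp add: strict_mono_less_eq)
qed

text \<open>
  The definite description in \<open>bessel_zero\<close> denotes: the zeros form an infinite set with gaps
  bounded below. The gaps also give the linear growth.
\<close>

lemma bessel_zero_enumerates:
  assumes "\<nu> \<ge> 0"
  shows "strict_mono (bessel_zero \<nu>)" "range (bessel_zero \<nu>) = {x. 0 < x \<and> bessel_J \<nu> x = 0}"
    and "\<exists>d>0. \<forall>k. d * real (Suc k) \<le> bessel_zero \<nu> k"
proof -
  define Z where "Z = {x. 0 < x \<and> bessel_J \<nu> x = 0}"
  obtain d where d: "d > 0"
    and d_le: "\<And>x. 0 < x \<Longrightarrow> bessel_J \<nu> x = 0 \<Longrightarrow> d \<le> x"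
    and d_gap: "\<And>x y. 0 < x \<Longrightarrow> x < y \<Longrightarrow> bessel_J \<nu> x = 0 \<Longrightarrow> bessel_J \<nu> y = 0 \<Longrightarrow> x + d \<le> y"
    using bessel_zeros_separated[OF assms] by blast
  have Z_le: "d \<le> x" if "x \<in> Z" for x using that d_le by (simp add: Z_def)
  have Z_gap: "x + d \<le> y" if "x \<in> Z" "y \<in> Z" "x < y" for x y
    using that d_gap by (simp add: Z_def)
  \<comment> \<open>rounding down to multiples of the gap is injective and monotone on the zeros, so they can be counted inside the natural numbers\<close>
  define r where "r x = nat \<lfloor>x / d\<rfloor>" for x
  have r_less: "r x < r y" if "x \<in> Z" "y \<in> Z" "x < y" for x y
  proof -
    have "x / d + 1 \<le> y / d" using divide_right_mono[OF Z_gap[OF that], of d] d by (simp add: add_divide_distrib)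
    then have "\<lfloor>x / d\<rfloor> + 1 \<le> \<lfloor>y / d\<rfloor>" by linarith
    moreover have "0 \<le> \<lfloor>x / d\<rfloor>" using that d by (simp add: Z_def)
    ultimately show ?thesis unfolding r_def by (subst nat_less_eq_zless) linarith+
  qed
  have inj: "inj_on r Z"
    by (rule inj_onI) (metis r_less less_irrefl linorder_neqE)
  have "infinite Z"
  proof
    assume "finite Z"
    then obtain X where X: "\<And>x. x \<in> Z \<Longrightarrow> x \<le> X" using bdd_above_finite by (metis bdd_above.E)
    obtain x where "x > max X 0" "bessel_w \<nu> x = 0" using bessel_w_zero_beyond[OF assms] by blast
    then show False using X[of x] assms by (auto simp: Z_def bessel_J_zero_iff)
  qed
  then have inf: "infinite (r ` Z)" using inj by (simp add: finite_image_iff)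
  define j where "j k = inv_into Z r (enumerate (r ` Z) k)" for k
  have en: "enumerate (r ` Z) k \<in> r ` Z" for k using inf by (rule enumerate_in_set)
  have jZ: "j k \<in> Z" and rj: "r (j k) = enumerate (r ` Z) k" for k
    using en[of k] by (auto simp: j_def intro: inv_into_into f_inv_into_f)
  have mono: "strict_mono j"
  proof (rule strict_monoI)
    fix k l :: nat assume "k < l"
    then have "r (j k) < r (j l)" unfolding rj using inf by (rule enumerate_mono)
    then show "j k < j l" using r_less[OF jZ jZ, of l k] by (cases "j k" "j l" rule: linorder_cases) auto
  qed
  have range: "range j = Z"
  proof
    show "Z \<subseteq> range j"
    proof
      fix x assume x: "x \<in> Z"
      then obtain k where "enumerate (r ` Z) k = r x" using range_enumerate[OF inf] by (metis imageE imageI)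
      then have "j k = x" unfolding j_def using x inj by (simp add: inv_into_f_f)
      then show "x \<in> range j" by blast
    qed
  qed (use jZ in auto)
  have eq: "bessel_zero \<nu> = j"
    unfolding bessel_zero_def Z_def[symmetric]
  proof (rule the_equality)
    fix j' :: "nat \<Rightarrow> real" assume "strict_mono j' \<and> range j' = Z"
    with mono range show "j' = j"
      by (intro ext order_antisym strict_mono_same_range_le) auto
  qed (use mono range in blast)
  show "strict_mono (bessel_zero \<nu>)" "range (bessel_zero \<nu>) = {x. 0 < x \<and> bessel_J \<nu> x = 0}"
    using mono range by (auto simp: eq Z_def)
  \<comment> \<open>average of \<open>d k \<le> j\<^sub>k\<close> from the rounding and \<open>d \<le> j\<^sub>k\<close>, which takes care of \<open>k = 0\<close>\<close>
  have "d / 2 * real (Suc k) \<le> j k" for k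
  proof -
    have "k \<le> r (j k)" unfolding rj using inf by (rule le_enumerate)
    then have "real k \<le> j k / d" unfolding r_def using jZ[of k] d
      by (simp add: Z_def le_nat_iff le_floor_iff)
    then have "d * real k \<le> j k" using d by (simp add: field_simps)
    with Z_le[OF jZ[of k]] show ?thesis by (simp add: field_simps)
  qed
  with d show "\<exists>d>0. \<forall>k. d * real (Suc k) \<le> bessel_zero \<nu> k"
    unfolding eq by (intro exI[of _ "d / 2"]) auto
qed

lemma bessel_zero_pos: "\<nu> \<ge> 0 \<Longrightarrow> bessel_zero \<nu> k > 0"
  and bessel_J_bessel_zero: "\<nu> \<ge> 0 \<Longrightarrow> bessel_J \<nu> (bessel_zero \<nu> k) = 0"
  using bessel_zero_enumerates(2)[of \<nu>] by blast+

lemma bessel_entire_bessel_zero: "\<nu> \<ge> 0 \<Longrightarrow> bessel_entire \<nu> ((bessel_zero \<nu> k)\<^sup>2 / 4) = 0"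
  using bessel_J_bessel_zero[of \<nu> k] bessel_zero_pos[of \<nu> k] by (simp add: bessel_J_eq_entire)

lemma deriv_bessel_J_bessel_zero:
  assumes "\<nu> \<ge> 0"
  shows "deriv (bessel_J \<nu>) (bessel_zero \<nu> k)
    = - ((bessel_zero \<nu> k / 2) powr (\<nu> + 1) * bessel_entire (\<nu> + 1) ((bessel_zero \<nu> k)\<^sup>2 / 4))"
  using assms by (intro DERIV_imp_deriv DERIV_bessel_J_zero bessel_zero_pos bessel_J_bessel_zero)

text \<open>
  At a zero the energy is \<open>w'\<^sup>2\<close>, and \<open>\<bar>w'(j)\<bar> = 2\<^sup>\<nu> \<surd>j \<bar>J\<^sub>\<nu>'(j)\<bar>\<close>.
\<close>

lemma deriv_bessel_J_lower_bound:
  assumes "\<nu> \<ge> 0"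
  obtains c where "c > 0" "\<And>k. c \<le> \<bar>deriv (bessel_J \<nu>) (bessel_zero \<nu> k)\<bar> * bessel_zero \<nu> k powr (1/2)"
proof -
  obtain x0 c where x0: "x0 > 0" "c > 0"
    and pos: "\<And>x. 0 < x \<Longrightarrow> x \<le> x0 \<Longrightarrow> bessel_w \<nu> x > 0"
    and c: "\<And>x. x0 \<le> x \<Longrightarrow> c \<le> bessel_energy \<nu> x"
    using bessel_w_energy_bounds[OF assms] by metis
  have "sqrt c / 2 powr \<nu> \<le> \<bar>deriv (bessel_J \<nu>) j\<bar> * j powr (1/2)" if j: "j = bessel_zero \<nu> k" for j k
  proof -
    have j0: "j > 0" unfolding j by (rule bessel_zero_pos[OF assms])
    have G: "bessel_entire \<nu> (j\<^sup>2 / 4) = 0" unfolding j by (rule bessel_entire_bessel_zero[OF assms])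
    then have w: "bessel_w \<nu> j = 0" by (simp add: bessel_w_def)
    then have "x0 \<le> j" using pos[of j] j0 by fastforce
    from c[OF this] have "sqrt c \<le> \<bar>bessel_w' \<nu> j\<bar>"
      using w real_sqrt_le_mono[of c "(bessel_w' \<nu> j)\<^sup>2"] by (simp add: bessel_energy_def)
    also have "bessel_w' \<nu> j = - (j powr (\<nu> + 3/2) / 2 * bessel_entire (\<nu> + 1) (j\<^sup>2 / 4))"
      using G by (simp add: bessel_w'_def)
    also have "j powr (\<nu> + 3/2) / 2 = 2 powr \<nu> * ((j / 2) powr (\<nu> + 1) * j powr (1/2))"
      using j0 powr_add[of j "\<nu> + 1" "1/2"] by (simp add: powr_divide powr_add)
    finally show ?thesis
      using j0 unfolding j deriv_bessel_J_bessel_zero[OF assms] by (simp add: abs_mult field_simps)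
  qed
  with x0 that[of "sqrt c / 2 powr \<nu>"] show thesis by simp
qed

section \<open>Lommel integrals\<close>

text \<open>
  Substitution \<open>r = x\<^sup>m\<close>. With \<open>m = 2 \<kappa>\<close> it carries the weighted integrals of products of
  eigenfunctions to integrals of products \<open>r\<^sup>\<nu> G\<^sub>\<nu>(p r) G\<^sub>\<nu>(q r)\<close>.
\<close>

lemma has_integral_powr_substitution:
  fixes A a :: "real \<Rightarrow> real"
  assumes "m > 0" "continuous_on {0..1} A"
    and "\<And>r. 0 < r \<Longrightarrow> r < 1 \<Longrightarrow> (A has_field_derivative a r) (at r)"
  shows "((\<lambda>x. m * x powr (m - 1) * a (x powr m)) has_integral A 1 - A 0) {0..1}"
proof -
  have "((\<lambda>x. m * x powr (m - 1) * a (x powr m)) has_integral A (1 powr m) - A (0 powr m)) {0..1}"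
  proof (rule fundamental_theorem_of_calculus_interior[of 0 1 "\<lambda>x. A (x powr m)"])
    have "x powr m \<le> 1" if "0 \<le> x" "x \<le> 1" for x
      using powr_mono2[of m x 1] that assms(1) by simp
    then have "(\<lambda>x. x powr m) ` {0..1} \<subseteq> {0..1}" by auto
    then show "continuous_on {0..1} (\<lambda>x. A (x powr m))"
      using assms(1) by (intro continuous_on_compose2[OF assms(2)] continuous_on_powr') (auto intro!: continuous_intros)
    fix x :: real assume x: "x \<in> {0<..<1}"
    then have "x powr m < 1" using assms(1) powr_less_mono2[of m x 1] by simp
    then have "((\<lambda>x. A (x powr m)) has_field_derivative a (x powr m) * (m * x powr (m - 1))) (at x)"
      using x by (intro DERIV_chain2[OF assms(3)]) (auto intro!: derivative_eq_intros)
    then show "((\<lambda>x. A (x powr m)) has_vector_derivative m * x powr (m - 1) * a (x powr m)) (at x)"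
      by (simp add: has_real_derivative_iff_has_vector_derivative mult.commute)
  qed simp
  then show ?thesis by simp
qed

lemma continuous_on_bessel_entire_cmult:
  "\<nu> \<ge> 0 \<Longrightarrow> continuous_on S (\<lambda>r. bessel_entire \<nu> (c * r))"
  by (rule continuous_on_compose2[OF continuous_on_bessel_entire[of _ UNIV]]) (auto intro!: continuous_intros)

text \<open>
  The functions \<open>H\<^sub>p(r) = G\<^sub>\<nu>(p r)\<close> solve the Sturm-Liouville equation
  \<open>(r\<^bsup>\<nu>+1\<^esup> H\<^sub>p')' = - p r\<^sup>\<nu> H\<^sub>p\<close>, so two of them with the boundary value 0 at 1 and different \<open>p\<close>
  are orthogonal for the weight \<open>r\<^sup>\<nu>\<close>.
\<close>

lemma bessel_entire_orthogonal:
  assumes "\<nu> \<ge> 0" "m > 0" "p \<noteq> q" "bessel_entire \<nu> p = 0" "bessel_entire \<nu> q = 0"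
  shows "((\<lambda>x. m * x powr (m - 1) * ((x powr m) powr \<nu>
           * (bessel_entire \<nu> (p * x powr m) * bessel_entire \<nu> (q * x powr m)))) has_integral 0) {0..1}"
proof -
  \<comment> \<open>\<open>r\<^bsup>\<nu>+1\<^esup> (H\<^sub>p H\<^sub>q' - H\<^sub>q H\<^sub>p') / (p - q)\<close>\<close>
  let ?A = "\<lambda>r. (r powr (\<nu> + 1) * (p * bessel_entire (\<nu> + 1) (p * r) * bessel_entire \<nu> (q * r)
      - q * bessel_entire \<nu> (p * r) * bessel_entire (\<nu> + 1) (q * r))) / (p - q)"
  have "((\<lambda>x. m * x powr (m - 1) * ((x powr m) powr \<nu>
           * (bessel_entire \<nu> (p * x powr m) * bessel_entire \<nu> (q * x powr m)))) has_integral ?A 1 - ?A 0) {0..1}"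
  proof (rule has_integral_powr_substitution[OF assms(2), where A = ?A])
    show "continuous_on {0..1} ?A"
      using assms(1,3)
      by (intro continuous_intros continuous_on_powr' continuous_on_bessel_entire_cmult) auto
    fix r :: real assume r: "0 < r" "r < 1"
    have P: "bessel_entire (\<nu> + 2) (p * r) * (p * r) = (\<nu> + 1) * bessel_entire (\<nu> + 1) (p * r) - bessel_entire \<nu> (p * r)"
     and Q: "bessel_entire (\<nu> + 2) (q * r) * (q * r) = (\<nu> + 1) * bessel_entire (\<nu> + 1) (q * r) - bessel_entire \<nu> (q * r)"
      using bessel_entire_recurrence[OF assms(1)] by (simp_all add: ac_simps)
    have rr: "r powr (\<nu> + 1) = r powr \<nu> * r" using r by (simp add: powr_add)
    have e: "\<nu> + 1 + 1 = \<nu> + 2" "\<nu> + 1 - 1 = \<nu>" by auto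
    let ?D = "((\<nu> + 1) * r powr \<nu> * (p * bessel_entire (\<nu> + 1) (p * r) * bessel_entire \<nu> (q * r)
        - q * bessel_entire \<nu> (p * r) * bessel_entire (\<nu> + 1) (q * r))
      + r powr \<nu> * r * (
          p * (- bessel_entire (\<nu> + 2) (p * r) * p) * bessel_entire \<nu> (q * r)
          + p * bessel_entire (\<nu> + 1) (p * r) * (- bessel_entire (\<nu> + 1) (q * r) * q)
          - (q * (- bessel_entire (\<nu> + 1) (p * r) * p) * bessel_entire (\<nu> + 1) (q * r)
             + q * bessel_entire \<nu> (p * r) * (- bessel_entire (\<nu> + 2) (q * r) * q))))"
    have G: "((\<lambda>r. bessel_entire \<nu> (c * r)) has_field_derivative - bessel_entire (\<nu> + 1) (c * r) * c) (at r)"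
      and G1: "((\<lambda>r. bessel_entire (\<nu> + 1) (c * r)) has_field_derivative - bessel_entire (\<nu> + 2) (c * r) * c) (at r)" for c
      using DERIV_bessel_entire_compose[OF assms(1), of "\<lambda>r. c * r" c r UNIV]
        DERIV_bessel_entire_compose[of "\<nu> + 1" "\<lambda>r. c * r" c r UNIV] assms(1) DERIV_cmult_Id[of c r]
      by (simp_all add: e)
    have pw: "((\<lambda>r. r powr (\<nu> + 1)) has_field_derivative (\<nu> + 1) * r powr \<nu>) (at r)"
      using has_real_derivative_powr[OF r(1), of "\<nu> + 1"] by (simp add: e)
    have "p - q \<noteq> 0" using assms(3) by simp
    have "(?A has_field_derivative ?D / (p - q)) (at r)"
      by (rule DERIV_cong[OF DERIV_cdivide[OF DERIV_mult[OF pw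
            DERIV_diff[OF DERIV_mult[OF DERIV_cmult[OF G1[of p]] G[of q]]
              DERIV_mult[OF DERIV_cmult[OF G[of p]] G1[of q]]]]]])
        (unfold rr, simp add: algebra_simps)
    also have "?D = r powr \<nu> * ((\<nu> + 1) * (p * bessel_entire (\<nu> + 1) (p * r) * bessel_entire \<nu> (q * r)
        - q * bessel_entire \<nu> (p * r) * bessel_entire (\<nu> + 1) (q * r))
        - p * (bessel_entire (\<nu> + 2) (p * r) * (p * r)) * bessel_entire \<nu> (q * r)
        + q * (bessel_entire (\<nu> + 2) (q * r) * (q * r)) * bessel_entire \<nu> (p * r))"
      by (simp add: algebra_simps)
    also have "\<dots> = (p - q) * (r powr \<nu> * (bessel_entire \<nu> (p * r) * bessel_entire \<nu> (q * r)))"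
      unfolding P Q by (simp add: algebra_simps)
    finally show "(?A has_field_derivative r powr \<nu> * (bessel_entire \<nu> (p * r) * bessel_entire \<nu> (q * r))) (at r)"
      using assms(3) by simp
  qed
  then show ?thesis using assms by simp
qed

text \<open>
  Lommel's integral: the square has an explicit antiderivative as well.
\<close>

lemma bessel_entire_norm:
  assumes "\<nu> \<ge> 0" "m > 0" "p > 0" "bessel_entire \<nu> p = 0"
  shows "((\<lambda>x. m * x powr (m - 1) * ((x powr m) powr \<nu> * (bessel_entire \<nu> (p * x powr m))\<^sup>2))
           has_integral p * (bessel_entire (\<nu> + 1) p)\<^sup>2) {0..1}"
proof -
  \<comment> \<open>with \<open>H(r) = G\<^sub>\<nu>(p r)\<close> this is \<open>(r\<^bsup>\<nu>+2\<^esup> H'\<^sup>2 + p r\<^bsup>\<nu>+1\<^esup> H\<^sup>2 + \<nu> r\<^bsup>\<nu>+1\<^esup> H H') / p\<close>\<close>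
  let ?A = "\<lambda>r. p * r powr (\<nu> + 2) * (bessel_entire (\<nu> + 1) (p * r))\<^sup>2 + r powr (\<nu> + 1) * (bessel_entire \<nu> (p * r))\<^sup>2
      - \<nu> * r powr (\<nu> + 1) * bessel_entire \<nu> (p * r) * bessel_entire (\<nu> + 1) (p * r)"
  have "((\<lambda>x. m * x powr (m - 1) * ((x powr m) powr \<nu> * (bessel_entire \<nu> (p * x powr m))\<^sup>2))
           has_integral ?A 1 - ?A 0) {0..1}"
  proof (rule has_integral_powr_substitution[OF assms(2), where A = ?A])
    show "continuous_on {0..1} ?A"
      using assms(1)
      by (intro continuous_intros continuous_on_powr' continuous_on_bessel_entire_cmult) auto
    fix r :: real assume r: "0 < r" "r < 1"
    let ?G = "bessel_entire \<nu> (p * r)" and ?G1 = "bessel_entire (\<nu> + 1) (p * r)" and ?G2 = "bessel_entire (\<nu> + 2) (p * r)"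
    have P: "?G2 * (p * r) = (\<nu> + 1) * ?G1 - ?G"
      using bessel_entire_recurrence[OF assms(1)] by (simp add: ac_simps)
    have rr: "r powr (\<nu> + 1) = r powr \<nu> * r" "r powr (\<nu> + 2) = r powr \<nu> * r * r"
      using r by (simp_all add: powr_add power2_eq_square)
    have e: "\<nu> + 1 + 1 = \<nu> + 2" "\<nu> + 1 - 1 = \<nu>" "\<nu> + 2 - 1 = \<nu> + 1" by auto
    let ?D = "p * (((\<nu> + 2) * (r powr \<nu> * r)) * ?G1\<^sup>2 + r powr \<nu> * r * r * (2 * ?G1 * (- ?G2 * p)))
      + ((\<nu> + 1) * r powr \<nu> * ?G\<^sup>2 + r powr \<nu> * r * (2 * ?G * (- ?G1 * p)))
      - \<nu> * ((\<nu> + 1) * r powr \<nu> * (?G * ?G1) + r powr \<nu> * r * ((- ?G1 * p) * ?G1 + ?G * (- ?G2 * p)))"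
    have G: "((\<lambda>r. bessel_entire \<nu> (p * r)) has_field_derivative - ?G1 * p) (at r)"
      and G1: "((\<lambda>r. bessel_entire (\<nu> + 1) (p * r)) has_field_derivative - ?G2 * p) (at r)"
      using DERIV_bessel_entire_compose[OF assms(1), of "\<lambda>r. p * r" p r UNIV]
        DERIV_bessel_entire_compose[of "\<nu> + 1" "\<lambda>r. p * r" p r UNIV] assms(1) DERIV_cmult_Id[of p r]
      by (simp_all add: e)
    have pw: "((\<lambda>r. r powr (\<nu> + 1)) has_field_derivative (\<nu> + 1) * r powr \<nu>) (at r)"
      "((\<lambda>r. r powr (\<nu> + 2)) has_field_derivative (\<nu> + 2) * (r powr \<nu> * r)) (at r)"
      using has_real_derivative_powr[OF r(1), of "\<nu> + 1"] has_real_derivative_powr[OF r(1), of "\<nu> + 2"]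
      by (simp_all add: e rr)
    have "(?A has_field_derivative ?D) (at r)"
      by (rule DERIV_cong[OF DERIV_diff[OF DERIV_add[OF DERIV_mult[OF DERIV_cmult[OF pw(2)] DERIV_power[OF G1, of 2]]
            DERIV_mult[OF pw(1) DERIV_power[OF G, of 2]]] DERIV_mult[OF DERIV_mult[OF DERIV_cmult[OF pw(1)] G] G1]]])
        (unfold rr, simp add: algebra_simps power2_eq_square)
    also have "?D = r powr \<nu> * (r * p * (\<nu> + 2) * ?G1\<^sup>2 - 2 * r * p * ?G1 * (?G2 * (p * r))
      + (\<nu> + 1) * ?G\<^sup>2 - 2 * r * p * ?G * ?G1 - \<nu> * (\<nu> + 1) * ?G * ?G1 + \<nu> * r * p * ?G1\<^sup>2
      + \<nu> * ?G * (?G2 * (p * r)))"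
      by (simp add: algebra_simps power2_eq_square)
    also have "\<dots> = r powr \<nu> * ?G\<^sup>2"
      unfolding P by (simp add: algebra_simps power2_eq_square)
    finally show "(?A has_field_derivative r powr \<nu> * ?G\<^sup>2) (at r)" .
  qed
  then show ?thesis using assms by simp
qed

section \<open>Square-integrable functions and square-summable sequences\<close>

lemma L2_spaceD:
  assumes "f \<in> L2_space M"
  shows "f \<in> borel_measurable M" "integrable M (\<lambda>x. (f x)\<^sup>2)"
  using assms by (auto simp: L2_space_def)

lemma L2_space_integrable_mult:
  assumes "f \<in> L2_space M" "g \<in> L2_space M"
  shows "integrable M (\<lambda>x. f x * g x)"
proof (rule Bochner_Integration.integrable_bound)
  show "integrable M (\<lambda>x. (f x)\<^sup>2 + (g x)\<^sup>2)"
    using assms L2_spaceD by (intro Bochner_Integration.integrable_add) auto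
  show "(\<lambda>x. f x * g x) \<in> borel_measurable M"
    using assms L2_spaceD by (intro borel_measurable_times) auto
  have "\<bar>a * b\<bar> \<le> a\<^sup>2 + b\<^sup>2" for a b :: real
    using sum_squares_bound[of "\<bar>a\<bar>" "\<bar>b\<bar>"] abs_ge_zero[of "a * b"] unfolding abs_mult power2_abs by linarith
  then show "AE x in M. norm (f x * g x) \<le> norm ((f x)\<^sup>2 + (g x)\<^sup>2)" by auto
qed

lemma L2_space_lincomb:
  assumes "f \<in> L2_space M" "g \<in> L2_space M"
  shows "(\<lambda>x. a * f x + b * g x) \<in> L2_space M"
proof -
  have "integrable M (\<lambda>x. a\<^sup>2 * (f x)\<^sup>2 + (2 * a * b) * (f x * g x) + b\<^sup>2 * (g x)\<^sup>2)"
    using assms L2_spaceD L2_space_integrable_mult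
    by (intro Bochner_Integration.integrable_add integrable_mult_right) auto
  moreover have "(a * f x + b * g x)\<^sup>2 = a\<^sup>2 * (f x)\<^sup>2 + (2 * a * b) * (f x * g x) + b\<^sup>2 * (g x)\<^sup>2" for x
    by (simp add: power2_eq_square algebra_simps)
  ultimately show ?thesis using assms L2_spaceD unfolding L2_space_def by auto
qed

lemma L2_space_0: "(\<lambda>x. 0) \<in> L2_space M"
  by (simp add: L2_space_def)

lemma L2_space_diff:
  assumes "f \<in> L2_space M" "g \<in> L2_space M" shows "(\<lambda>x. f x - g x) \<in> L2_space M"
  using L2_space_lincomb[OF assms, of 1 "-1"] by simp

lemma L2_space_sum:
  assumes "\<And>i. i \<in> I \<Longrightarrow> f i \<in> L2_space M"
  shows "(\<lambda>x. \<Sum>i\<in>I. c i * f i x) \<in> L2_space M"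
  using assms
proof (induction I rule: infinite_finite_induct)
  case (insert i I)
  then show ?case using L2_space_lincomb[of "f i" M "\<lambda>x. \<Sum>i\<in>I. c i * f i x" "c i" 1] by simp
qed (simp_all add: L2_space_0)

lemma L2_inner_lincomb_left:
  assumes "f \<in> L2_space M" "g \<in> L2_space M" "h \<in> L2_space M"
  shows "L2_inner M (\<lambda>x. a * f x + b * g x) h = a * L2_inner M f h + b * L2_inner M g h"
proof -
  have "L2_inner M (\<lambda>x. a * f x + b * g x) h = (LINT x|M. a * (f x * h x) + b * (g x * h x))"
    by (simp add: L2_inner_def algebra_simps)
  then show ?thesis
    using L2_space_integrable_mult[OF assms(1,3)] L2_space_integrable_mult[OF assms(2,3)]
    by (simp add: L2_inner_def)
qed

lemma L2_inner_commute: "L2_inner M f g = L2_inner M g f"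
  by (simp add: L2_inner_def mult.commute)

lemma L2_inner_nonneg: "L2_inner M f f \<ge> 0"
  by (simp add: L2_inner_def)

lemma L2_inner_sum_left:
  assumes "\<And>i. i \<in> I \<Longrightarrow> f i \<in> L2_space M" "h \<in> L2_space M"
  shows "L2_inner M (\<lambda>x. \<Sum>i\<in>I. c i * f i x) h = (\<Sum>i\<in>I. c i * L2_inner M (f i) h)"
  using assms(1)
proof (induction I rule: infinite_finite_induct)
  case (insert i I)
  then show ?case
    using L2_inner_lincomb_left[of "f i" M "\<lambda>x. \<Sum>i\<in>I. c i * f i x" h "c i" 1] assms(2) L2_space_sum[of I f M c]
    by simp
qed (simp_all add: L2_inner_def)

text \<open>
  Elements are functions and not classes, so the form is only positive semidefinite; the
  inequality follows from the sign of \<open>\<langle>s f + t g, s f + t g\<rangle>\<close> alone.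
\<close>

lemma L2_Cauchy_Schwarz:
  assumes f: "f \<in> L2_space M" and g: "g \<in> L2_space M"
  shows "\<bar>L2_inner M f g\<bar> \<le> L2_space_norm M f * L2_space_norm M g"
proof -
  let ?a = "L2_inner M f f" and ?b = "L2_inner M f g" and ?c = "L2_inner M g g"
  have q: "0 \<le> s\<^sup>2 * ?a + 2 * s * t * ?b + t\<^sup>2 * ?c" for s t
  proof -
    let ?h = "\<lambda>x. s * f x + t * g x"
    have h: "?h \<in> L2_space M" by (rule L2_space_lincomb[OF f g])
    have "L2_inner M ?h ?h = s * L2_inner M ?h f + t * L2_inner M ?h g"
      unfolding L2_inner_lincomb_left[OF f g h] by (simp add: L2_inner_commute)
    also have "\<dots> = s\<^sup>2 * ?a + 2 * s * t * ?b + t\<^sup>2 * ?c"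
      unfolding L2_inner_lincomb_left[OF f g f] L2_inner_lincomb_left[OF f g g]
      by (simp add: L2_inner_commute[of M g f] power2_eq_square algebra_simps)
    finally show ?thesis using L2_inner_nonneg[of M ?h] by simp
  qed
  have "?b\<^sup>2 \<le> ?a * ?c"
  proof (cases "?c = 0")
    case True
    have "?b = 0"
    proof (rule ccontr)
      assume "?b \<noteq> 0"
      then show False using q[of 1 "- (?a + 1) / (2 * ?b)"] True by (simp add: field_simps)
    qed
    then show ?thesis using True by simp
  next
    case False
    then have "?c > 0" using L2_inner_nonneg[of M g] by simp
    moreover have "0 \<le> ?c * (?a * ?c - ?b\<^sup>2)"
      using q[of "?c" "- ?b"] by (simp add: power2_eq_square algebra_simps)
    ultimately show ?thesis by (simp add: zero_le_mult_iff)
  qed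
  then have "sqrt (?b\<^sup>2) \<le> sqrt (?a * ?c)" by (rule real_sqrt_le_mono)
  then show ?thesis by (simp add: L2_space_norm_def real_sqrt_mult)
qed

lemma L2_space_norm_nonneg: "L2_space_norm M f \<ge> 0"
  by (simp add: L2_space_norm_def L2_inner_nonneg)

lemma L2_space_abs:
  assumes "f \<in> L2_space M"
  shows "(\<lambda>x. \<bar>f x\<bar>) \<in> L2_space M" "L2_space_norm M (\<lambda>x. \<bar>f x\<bar>) = L2_space_norm M f"
  using assms by (auto simp: L2_space_def L2_space_norm_def L2_inner_def)

lemma L2_integral_abs_mult_le:
  assumes "f \<in> L2_space M" "g \<in> L2_space M"
  shows "(LINT x|M. \<bar>f x * g x\<bar>) \<le> L2_space_norm M f * L2_space_norm M g"
  using L2_Cauchy_Schwarz[OF L2_space_abs(1)[OF assms(1)] L2_space_abs(1)[OF assms(2)]]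
  by (simp add: L2_space_abs(2) assms L2_inner_def abs_mult)

lemma L2_space_dominated:
  assumes "h \<in> L2_space M" "f \<in> borel_measurable M" "\<And>x. x \<in> space M \<Longrightarrow> \<bar>f x\<bar> \<le> c * h x"
  shows "f \<in> L2_space M"
proof -
  have b: "(f x)\<^sup>2 \<le> c\<^sup>2 * (h x)\<^sup>2" if "x \<in> space M" for x
    using power_mono[OF assms(3)[OF that], of 2] by (simp add: power_mult_distrib)
  have "integrable M (\<lambda>x. (f x)\<^sup>2)"
  proof (rule Bochner_Integration.integrable_bound)
    show "integrable M (\<lambda>x. c\<^sup>2 * (h x)\<^sup>2)" using assms(1) L2_spaceD by auto
  qed (use b assms(2) in \<open>auto intro!: AE_I2\<close>)
  then show ?thesis using assms(2) by (simp add: L2_space_def)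
qed

lemma L2_space_norm_dominated:
  assumes "h \<in> L2_space M" "f \<in> borel_measurable M" "\<And>x. x \<in> space M \<Longrightarrow> \<bar>f x\<bar> \<le> c * h x" "c \<ge> 0"
  shows "L2_space_norm M f \<le> c * L2_space_norm M h"
proof -
  have f: "f \<in> L2_space M" by (rule L2_space_dominated[OF assms(1-3)])
  have "L2_inner M f f \<le> (LINT x|M. c\<^sup>2 * (h x)\<^sup>2)"
    unfolding L2_inner_def
  proof (rule integral_mono)
    show "integrable M (\<lambda>x. f x * f x)" using L2_space_integrable_mult[OF f f] .
    show "integrable M (\<lambda>x. c\<^sup>2 * (h x)\<^sup>2)" using assms(1) L2_spaceD by auto
    fix x assume "x \<in> space M"
    from power_mono[OF assms(3)[OF this], of 2] show "f x * f x \<le> c\<^sup>2 * (h x)\<^sup>2"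
      by (simp add: power2_eq_square ac_simps)
  qed
  also have "\<dots> = c\<^sup>2 * L2_inner M h h" by (simp add: L2_inner_def power2_eq_square)
  finally have "sqrt (L2_inner M f f) \<le> sqrt (c\<^sup>2 * L2_inner M h h)" by (rule real_sqrt_le_mono)
  then show ?thesis using assms(4) by (simp add: L2_space_norm_def real_sqrt_mult)
qed

lemma square_le_mult_imp_le:
  fixes x c :: real
  assumes "x * x \<le> c * x" "0 \<le> c" "0 \<le> x"
  shows "x \<le> c"
  using assms by (cases "x = 0") (auto simp: mult_le_cancel_right)

lemma summable_square_mult:
  fixes x y :: "nat \<Rightarrow> real"
  assumes "summable (\<lambda>k. (x k)\<^sup>2)" "summable (\<lambda>k. (y k)\<^sup>2)"
  shows "summable (\<lambda>k. \<bar>x k * y k\<bar>)"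
    and "(\<Sum>k. \<bar>x k * y k\<bar>) \<le> sqrt (\<Sum>k. (x k)\<^sup>2) * sqrt (\<Sum>k. (y k)\<^sup>2)"
proof -
  have fin: "(\<Sum>k<n. \<bar>x k * y k\<bar>) \<le> sqrt (\<Sum>k. (x k)\<^sup>2) * sqrt (\<Sum>k. (y k)\<^sup>2)" for n
  proof -
    have "(\<Sum>k<n. \<bar>x k * y k\<bar>)\<^sup>2 \<le> (\<Sum>k<n. (x k)\<^sup>2) * (\<Sum>k<n. (y k)\<^sup>2)"
      using Cauchy_Schwarz_ineq_sum[of "\<lambda>k. \<bar>x k\<bar>" "\<lambda>k. \<bar>y k\<bar>" "{..<n}"] by (simp add: abs_mult)
    also have "\<dots> \<le> (\<Sum>k. (x k)\<^sup>2) * (\<Sum>k. (y k)\<^sup>2)"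
      using assms by (intro mult_mono sum_le_suminf suminf_nonneg sum_nonneg) auto
    finally show ?thesis using real_le_rsqrt by (simp add: real_sqrt_mult[symmetric])
  qed
  then show "summable (\<lambda>k. \<bar>x k * y k\<bar>)"
    using bounded_imp_summable[of "\<lambda>k. \<bar>x k * y k\<bar>" "sqrt (\<Sum>k. (x k)\<^sup>2) * sqrt (\<Sum>k. (y k)\<^sup>2)"]
    by (simp only: lessThan_Suc_atMost[symmetric] abs_ge_zero)
  then show "(\<Sum>k. \<bar>x k * y k\<bar>) \<le> sqrt (\<Sum>k. (x k)\<^sup>2) * sqrt (\<Sum>k. (y k)\<^sup>2)"
    using fin by (rule suminf_le_const)
qed

text \<open>
  The Cauchy-Schwarz inequality for the duality between the weights \<open>w\<^bsup>-s\<^esup>\<close> and \<open>w\<^sup>s\<close>.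
\<close>

lemma summable_weighted_mult:
  fixes p a w :: "nat \<Rightarrow> real"
  assumes "\<And>k. w k > 0"
    and "summable (\<lambda>k. w k powr (- s) * \<bar>p k\<bar>\<^sup>2)" "summable (\<lambda>k. \<bar>a k\<bar>\<^sup>2 * w k powr s)"
  shows "summable (\<lambda>k. \<bar>p k * a k\<bar>)"
    and "(\<Sum>k. \<bar>p k * a k\<bar>) \<le> sqrt (\<Sum>k. w k powr (- s) * \<bar>p k\<bar>\<^sup>2) * sqrt (\<Sum>k. \<bar>a k\<bar>\<^sup>2 * w k powr s)"
proof -
  have sq: "(w k powr r)\<^sup>2 = w k powr (2 * r)" for k r
    by (simp add: power2_eq_square flip: powr_add)
  have x: "(w k powr (- s / 2) * p k)\<^sup>2 = w k powr (- s) * \<bar>p k\<bar>\<^sup>2"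
    and y: "(w k powr (s / 2) * a k)\<^sup>2 = \<bar>a k\<bar>\<^sup>2 * w k powr s" for k
    by (simp_all add: power_mult_distrib sq)
  have xy: "\<bar>(w k powr (- s / 2) * p k) * (w k powr (s / 2) * a k)\<bar> = \<bar>p k * a k\<bar>" for k
  proof -
    have 1: "w k powr (- s / 2) * w k powr (s / 2) = 1" using assms(1)[of k] by (simp flip: powr_add)
    have "(w k powr (- s / 2) * p k) * (w k powr (s / 2) * a k) = (w k powr (- s / 2) * w k powr (s / 2)) * (p k * a k)"
      by (simp only: mult_ac)
    also have "\<dots> = p k * a k" unfolding 1 by simp
    finally show ?thesis by (rule arg_cong)
  qed
  show "summable (\<lambda>k. \<bar>p k * a k\<bar>)"
    "(\<Sum>k. \<bar>p k * a k\<bar>) \<le> sqrt (\<Sum>k. w k powr (- s) * \<bar>p k\<bar>\<^sup>2) * sqrt (\<Sum>k. \<bar>a k\<bar>\<^sup>2 * w k powr s)"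
    using summable_square_mult[of "\<lambda>k. w k powr (- s / 2) * p k" "\<lambda>k. w k powr (s / 2) * a k"] assms(2,3)
    unfolding x y xy by auto
qed

text \<open>
  Tannery's theorem with a majorant that serves all terms near the limit point.
\<close>

lemma tendsto_suminf_dominated:
  fixes a :: "nat \<Rightarrow> 'b \<Rightarrow> real"
  assumes "\<And>k. (a k \<longlongrightarrow> b k) F" "eventually (\<lambda>x. \<forall>k. \<bar>a k x\<bar> \<le> D k) F" "summable D"
  shows "((\<lambda>x. \<Sum>k. a k x) \<longlongrightarrow> (\<Sum>k. b k)) F"
proof (cases "F = bot")
  case False
  have "eventually (\<lambda>(k, x). norm (a k x) \<le> D k) (at_top \<times>\<^sub>F F)"
    using eventually_prodI[OF eventually_True assms(2)] by (rule eventually_mono) (auto split: prod.splits)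
  from tannerys_theorem[OF assms(1) this assms(3) False] show ?thesis by simp
qed simp

lemma L2_space_norm_lincomb:
  assumes "f \<in> L2_space N" "g \<in> L2_space N"
  shows "L2_space_norm N (\<lambda>x. a * f x + b * g x) \<le> \<bar>a\<bar> * L2_space_norm N f + \<bar>b\<bar> * L2_space_norm N g"
proof -
  let ?h = "\<lambda>x. a * f x + b * g x"
  have h: "?h \<in> L2_space N" by (rule L2_space_lincomb[OF assms])
  have sq: "(L2_space_norm N u)\<^sup>2 = L2_inner N u u" for u
    by (simp add: L2_space_norm_def L2_inner_nonneg)
  have "(L2_space_norm N ?h)\<^sup>2 = L2_inner N ?h ?h" by (rule sq)
  also have "\<dots> = a * L2_inner N f ?h + b * L2_inner N g ?h"
    by (rule L2_inner_lincomb_left[OF assms h])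
  also have "\<dots> \<le> \<bar>a\<bar> * (L2_space_norm N f * L2_space_norm N ?h) + \<bar>b\<bar> * (L2_space_norm N g * L2_space_norm N ?h)"
  proof -
    have "c * L2_inner N u ?h \<le> \<bar>c\<bar> * (L2_space_norm N u * L2_space_norm N ?h)" if "u \<in> L2_space N" for c u
      using mult_left_mono[OF L2_Cauchy_Schwarz[OF that h], of "\<bar>c\<bar>"] abs_ge_self[of "c * L2_inner N u ?h"]
      by (simp add: abs_mult)
    from this[OF assms(1)] this[OF assms(2)] show ?thesis by (rule add_mono)
  qed
  finally have "L2_space_norm N ?h * L2_space_norm N ?h
      \<le> (\<bar>a\<bar> * L2_space_norm N f + \<bar>b\<bar> * L2_space_norm N g) * L2_space_norm N ?h"
    by (simp add: power2_eq_square algebra_simps)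
  moreover have "0 \<le> \<bar>a\<bar> * L2_space_norm N f + \<bar>b\<bar> * L2_space_norm N g"
    by (simp add: L2_space_norm_nonneg)
  ultimately show ?thesis
    using L2_space_norm_nonneg[of N ?h] by (rule square_le_mult_imp_le)
qed

section \<open>Convolution with an exponential kernel\<close>

text \<open>
  The solution at time \<open>\<tau>\<close> of \<open>y' = - l y + f\<close>, \<open>y(0) = 0\<close>: one mode of the controlled equation.
\<close>

definition exp_conv :: "real \<Rightarrow> real \<Rightarrow> (real \<Rightarrow> real) \<Rightarrow> real" where
  "exp_conv l \<tau> f = (LINT t:{0<..<\<tau>}|lebesgue. f t * exp (- l * (\<tau> - t)))"

text \<open>
  All integrals over \<open>(0, \<tau>)\<close> are moved to the fixed measure on \<open>(0, T)\<close>, where \<open>f\<close> is square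
  integrable.
\<close>

lemma lebesgue_on_prefix_integral:
  fixes h :: "real \<Rightarrow> real"
  assumes "\<tau> \<le> T"
  shows "integrable (lebesgue_on {0<..<T}) (\<lambda>t. indicator {0<..<\<tau>} t * h t) \<longleftrightarrow> set_integrable lebesgue {0<..<\<tau>} h"
    and "(LINT t|lebesgue_on {0<..<T}. indicator {0<..<\<tau>} t * h t) = (LINT t:{0<..<\<tau>}|lebesgue. h t)"
proof -
  have e: "indicator {0<..<T} t * (indicator {0<..<\<tau>} t * h t) = indicator {0<..<\<tau>} t * h t" for t
    using assms by (simp add: indicator_def)
  show "integrable (lebesgue_on {0<..<T}) (\<lambda>t. indicator {0<..<\<tau>} t * h t) \<longleftrightarrow> set_integrable lebesgue {0<..<\<tau>} h"
    and "(LINT t|lebesgue_on {0<..<T}. indicator {0<..<\<tau>} t * h t) = (LINT t:{0<..<\<tau>}|lebesgue. h t)"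
    unfolding set_integrable_def set_lebesgue_integral_def
    by (simp_all add: integrable_restrict_space integral_restrict_space e)
qed

lemma borel_measurable_lebesgue_on:
  "f \<in> borel_measurable borel \<Longrightarrow> f \<in> borel_measurable (lebesgue_on S)"
  by (intro measurable_restrict_space1 measurable_completion) simp

text \<open>
  The bound is \<open>\<integral>\<^sub>0\<^sup>\<tau> exp (- 2 l (\<tau> - t)) dt \<le> 1/(2 l)\<close>. The decay in \<open>l\<close>, uniform in \<open>\<tau>\<close>, is the
  smoothing of the equation and gains a full power of \<open>\<lambda>\<^sub>k\<close> in the square of the norm.
\<close>

lemma exp_kernel_L2:
  assumes "l > 0" "0 \<le> \<tau>" "\<tau> \<le> T"
  shows "(\<lambda>t. indicator {0<..<\<tau>} t * exp (- l * (\<tau> - t))) \<in> L2_space (lebesgue_on {0<..<T})" (is "?g \<in> L2_space ?N")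
    and "L2_space_norm (lebesgue_on {0<..<T}) (\<lambda>t. indicator {0<..<\<tau>} t * exp (- l * (\<tau> - t))) \<le> 1 / sqrt (2 * l)"
proof -
  let ?h = "\<lambda>t. exp (- (2 * l) * (\<tau> - t))"
  have g2: "(?g t)\<^sup>2 = indicator {0<..<\<tau>} t * ?h t" "?g t * ?g t = indicator {0<..<\<tau>} t * ?h t" for t
    by (auto simp: indicator_def power2_eq_square algebra_simps simp flip: exp_add)
  have meas: "?g \<in> borel_measurable ?N"
    by (rule borel_measurable_lebesgue_on) simp
  have "?h absolutely_integrable_on {0..\<tau>}"
    by (intro absolutely_integrable_continuous_real continuous_intros)
  then have si: "set_integrable lebesgue {0<..<\<tau>} ?h"
    by (rule set_integrable_subset) auto
  then show "?g \<in> L2_space ?N"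
    unfolding L2_space_def mem_Collect_eq g2(1) lebesgue_on_prefix_integral(1)[OF assms(3)]
    using meas by blast
  have FTC: "(?h has_integral (exp (- (2 * l) * (\<tau> - \<tau>)) / (2 * l) - exp (- (2 * l) * (\<tau> - 0)) / (2 * l))) {0..\<tau>}"
    using assms
    by (intro fundamental_theorem_of_calculus)
      (auto intro!: derivative_eq_intros simp flip: has_real_derivative_iff_has_vector_derivative)
  have "L2_inner ?N ?g ?g = (LINT t:{0<..<\<tau>}|lebesgue. ?h t)"
    unfolding L2_inner_def g2 by (rule lebesgue_on_prefix_integral(2)[OF assms(3)])
  also have "\<dots> = integral {0<..<\<tau>} ?h" by (rule set_lebesgue_integral_eq_integral(2)[OF si])
  also have "\<dots> = integral {0..\<tau>} ?h" by (simp only: integral_open_interval_real)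
  also have "\<dots> = (exp (- (2 * l) * (\<tau> - \<tau>)) / (2 * l) - exp (- (2 * l) * (\<tau> - 0)) / (2 * l))"
    using FTC by (rule integral_unique)
  also have "\<dots> \<le> 1 / (2 * l)" using assms by simp
  finally have "sqrt (L2_inner ?N ?g ?g) \<le> sqrt (1 / (2 * l))" by (rule real_sqrt_le_mono)
  then show "L2_space_norm ?N ?g \<le> 1 / sqrt (2 * l)"
    by (simp add: L2_space_norm_def real_sqrt_divide)
qed

lemma exp_conv_integrable:
  assumes "l > 0" "0 \<le> \<tau>" "\<tau> \<le> T" "f \<in> L2_space (lebesgue_on {0<..<T})"
  shows "set_integrable lebesgue {0<..<\<tau>} (\<lambda>t. f t * exp (- l * (\<tau> - t)))"
    and "(LINT t:{0<..<\<tau>}|lebesgue. \<bar>f t * exp (- l * (\<tau> - t))\<bar>) \<le> L2_space_norm (lebesgue_on {0<..<T}) f / sqrt (2 * l)"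
    and "\<bar>exp_conv l \<tau> f\<bar> \<le> L2_space_norm (lebesgue_on {0<..<T}) f / sqrt (2 * l)"
proof -
  let ?N = "lebesgue_on {0<..<T}" and ?g = "\<lambda>t. indicator {0<..<\<tau>} t * exp (- l * (\<tau> - t)) :: real"
  let ?F = "\<lambda>t. f t * exp (- l * (\<tau> - t))"
  note g = exp_kernel_L2[OF assms(1-3)]
  have e: "f t * ?g t = indicator {0<..<\<tau>} t * ?F t" for t by simp
  show si: "set_integrable lebesgue {0<..<\<tau>} ?F"
    using L2_space_integrable_mult[OF assms(4) g(1)] unfolding e lebesgue_on_prefix_integral(1)[OF assms(3)] .
  have "(LINT t:{0<..<\<tau>}|lebesgue. \<bar>?F t\<bar>) = (LINT t|?N. \<bar>f t * ?g t\<bar>)"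
    unfolding lebesgue_on_prefix_integral(2)[OF assms(3), symmetric] by (simp add: abs_mult mult_ac)
  also have "\<dots> \<le> L2_space_norm ?N f * L2_space_norm ?N ?g"
    by (rule L2_integral_abs_mult_le[OF assms(4) g(1)])
  also have "\<dots> \<le> L2_space_norm ?N f * (1 / sqrt (2 * l))"
    by (rule mult_left_mono[OF g(2) L2_space_norm_nonneg])
  finally show b: "(LINT t:{0<..<\<tau>}|lebesgue. \<bar>?F t\<bar>) \<le> L2_space_norm ?N f / sqrt (2 * l)" by simp
  have "\<bar>exp_conv l \<tau> f\<bar> \<le> (LINT t:{0<..<\<tau>}|lebesgue. \<bar>?F t\<bar>)"
    using set_integral_norm_bound[OF si] by (simp add: exp_conv_def)
  with b show "\<bar>exp_conv l \<tau> f\<bar> \<le> L2_space_norm ?N f / sqrt (2 * l)" by simp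
qed

lemma exp_conv_lincomb:
  assumes "l > 0" "0 \<le> \<tau>" "\<tau> \<le> T" "f \<in> L2_space (lebesgue_on {0<..<T})" "g \<in> L2_space (lebesgue_on {0<..<T})"
  shows "exp_conv l \<tau> (\<lambda>t. a * f t + b * g t) = a * exp_conv l \<tau> f + b * exp_conv l \<tau> g"
proof -
  note f = exp_conv_integrable(1)[OF assms(1-4)] and g = exp_conv_integrable(1)[OF assms(1-3,5)]
  have "exp_conv l \<tau> (\<lambda>t. a * f t + b * g t)
      = (LINT t:{0<..<\<tau>}|lebesgue. a * (f t * exp (- l * (\<tau> - t))) + b * (g t * exp (- l * (\<tau> - t))))"
    unfolding exp_conv_def by (simp add: algebra_simps)
  also have "\<dots> = a * exp_conv l \<tau> f + b * exp_conv l \<tau> g"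
    using f g unfolding exp_conv_def
    by (subst set_integral_add) (auto intro!: set_integrable_mult_right)
  finally show ?thesis .
qed

lemma continuous_on_exp_conv:
  assumes "0 \<le> T" "f \<in> L2_space (lebesgue_on {0<..<T})"
  shows "continuous_on {0..T} (\<lambda>\<tau>. exp_conv l \<tau> f)"
proof -
  let ?N = "lebesgue_on {0<..<T}" and ?F = "\<lambda>t. f t * exp (l * t)"
  have "(\<lambda>t. (exp (l * t))\<^sup>2) absolutely_integrable_on {0..T}"
    by (intro absolutely_integrable_continuous_real continuous_intros)
  then have "set_integrable lebesgue {0<..<T} (\<lambda>t. (exp (l * t))\<^sup>2)"
    by (rule set_integrable_subset) auto
  then have "(\<lambda>t. exp (l * t)) \<in> L2_space ?N"
    by (auto simp: L2_space_def integrable_restrict_space set_integrable_def intro!: borel_measurable_lebesgue_on)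
  from L2_space_integrable_mult[OF assms(2) this]
  have si: "set_integrable lebesgue {0<..<T} ?F"
    by (simp add: integrable_restrict_space set_integrable_def)
  then have "?F integrable_on {0<..<T}" by (rule set_lebesgue_integral_eq_integral)
  then have F: "?F integrable_on {0..T}" by (simp add: integrable_on_open_interval_real)
  \<comment> \<open>the factor depending on \<open>\<tau>\<close> is pulled out, leaving an indefinite integral\<close>
  have eq: "exp_conv l \<tau> f = exp (- l * \<tau>) * integral {0..\<tau>} ?F" if \<tau>: "\<tau> \<in> {0..T}" for \<tau>
  proof -
    have si\<tau>: "set_integrable lebesgue {0<..<\<tau>} ?F"
      using si by (rule set_integrable_subset) (use \<tau> in auto)
    have "f t * exp (- l * (\<tau> - t)) = exp (- l * \<tau>) * ?F t" for t
      by (simp add: algebra_simps flip: exp_add)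
    then have "exp_conv l \<tau> f = (LINT t:{0<..<\<tau>}|lebesgue. exp (- l * \<tau>) * ?F t)"
      by (simp only: exp_conv_def)
    also have "\<dots> = exp (- l * \<tau>) * (LINT t:{0<..<\<tau>}|lebesgue. ?F t)" by simp
    also have "(LINT t:{0<..<\<tau>}|lebesgue. ?F t) = integral {0<..<\<tau>} ?F"
      by (rule set_lebesgue_integral_eq_integral(2)[OF si\<tau>])
    also have "\<dots> = integral {0..\<tau>} ?F" by (simp only: integral_open_interval_real)
    finally show ?thesis .
  qed
  have "continuous_on {0..T} (\<lambda>\<tau>. exp (- l * \<tau>) * integral {0..\<tau>} ?F)"
    by (intro continuous_on_mult indefinite_integral_continuous_1[OF F] continuous_intros)
  then show ?thesis by (rule continuous_on_eq) (simp only: eq)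
qed

section \<open>Size, boundary value and orthonormality of the eigenfunctions\<close>

locale degenerate_problem =
  fixes \<alpha> \<beta> \<mu> :: real
  assumes alpha_nonneg: "0 \<le> \<alpha>" and alpha_less: "\<alpha> < 2"
    and alpha_beta: "\<alpha> + \<beta> > 1" and mu_less: "\<mu> < mu_crit (\<alpha> + \<beta>)"
begin

abbreviation "\<nu> \<equiv> nu \<alpha> \<beta> \<mu>"
abbreviation "\<kappa> \<equiv> kappa \<alpha>"
abbreviation "\<delta> \<equiv> \<alpha> + \<beta> + gam \<alpha> \<beta> \<mu>"
abbreviation "M \<equiv> weighted_measure \<beta>"
abbreviation "\<Phi> \<equiv> Phi \<alpha> \<beta> \<mu>"
abbreviation "ev \<equiv> lam \<alpha> \<beta> \<mu>"
abbreviation "cf \<equiv> coef \<alpha> \<beta> \<mu>"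

text \<open>
  The zero in the variable of \<open>G\<^sub>\<nu>\<close>: \<open>G\<^sub>\<nu>(j\<^sub>k\<^sup>2/4) = 0\<close>.
\<close>

definition zpar :: "nat \<Rightarrow> real" where "zpar k = (bessel_zero \<nu> k)\<^sup>2 / 4"

text \<open>
  The constant in front of \<open>x\<^bsup>-\<delta>\<^esup> G\<^sub>\<nu>(\<dots>)\<close> once the power in \<open>J\<^sub>\<nu>(x) = (x/2)\<^sup>\<nu> G\<^sub>\<nu>(x\<^sup>2/4)\<close> has
  been absorbed, see \<open>Phi_eq\<close>.
\<close>

definition amp :: "nat \<Rightarrow> real" where
  "amp k = sqrt (2 * \<kappa>) / \<bar>deriv (bessel_J \<nu>) (bessel_zero \<nu> k)\<bar> * (bessel_zero \<nu> k / 2) powr \<nu>"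

text \<open>
  The boundary value \<open>\<O>\<^sub>\<delta>(\<Phi>\<^sub>k)\<close>, see \<open>Phi_boundary_limit\<close>.
\<close>

definition bdry_coef :: "nat \<Rightarrow> real" where
  "bdry_coef k = amp k * rGamma (\<nu> + 1)"

text \<open>
  Boundary values and eigenfunctions grow at most like \<open>j\<^sub>k\<^bsup>\<nu> + 1/2\<^esup>\<close>, which is this power of \<open>\<lambda>\<^sub>k\<close>.
\<close>

definition growth :: real where "growth = (\<nu> + 1/2) / 2"

lemma kappa_pos: "\<kappa> > 0"
  using alpha_less by (simp add: kappa_def)

lemma nu_pos: "\<nu> > 0"
  using kappa_pos mu_less by (simp add: nu_def)

lemma delta_eq: "\<delta> = (\<alpha> + \<beta> - 1) / 2 - \<kappa> * \<nu>"
  using kappa_pos by (simp add: gam_def nu_def field_simps)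

lemma bz_pos: "bessel_zero \<nu> k > 0"
  using bessel_zero_pos nu_pos by simp

lemma zpar_pos: "zpar k > 0"
  using bz_pos[of k] by (simp add: zpar_def)

lemma ev_pos: "ev k > 0"
  using bz_pos[of k] kappa_pos by (simp add: lam_def)

text \<open>
  All eigenfunctions share the same singular factor \<open>x\<^bsup>-\<delta>\<^esup>\<close>; what remains is continuous at the
  origin. Both the boundary value and all convergence statements are read off from this.
\<close>

lemma Phi_eq:
  assumes "x > 0"
  shows "\<Phi> k x = amp k * (x powr (- \<delta>) * bessel_entire \<nu> (zpar k * x powr (2 * \<kappa>)))"
proof -
  let ?j = "bessel_zero \<nu> k"
  have "bessel_J \<nu> (?j * x powr \<kappa>) = (?j * x powr \<kappa> / 2) powr \<nu> * bessel_entire \<nu> ((?j * x powr \<kappa>)\<^sup>2 / 4)"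
    using assms bz_pos nu_pos by (intro bessel_J_eq_entire) auto
  also have "(?j * x powr \<kappa> / 2) powr \<nu> = (?j / 2) powr \<nu> * x powr (\<kappa> * \<nu>)"
    using bz_pos[of k] powr_mult[of "?j / 2" "x powr \<kappa>" \<nu>] by (simp add: powr_powr)
  also have "(?j * x powr \<kappa>)\<^sup>2 / 4 = zpar k * x powr (2 * \<kappa>)"
    using assms by (simp add: zpar_def power_mult_distrib powr_power)
  finally have J: "bessel_J \<nu> (?j * x powr \<kappa>)
      = (?j / 2) powr \<nu> * x powr (\<kappa> * \<nu>) * bessel_entire \<nu> (zpar k * x powr (2 * \<kappa>))" .
  have "- \<delta> = (1 - \<alpha> - \<beta>) / 2 + \<kappa> * \<nu>" unfolding delta_eq by (simp add: field_simps)
  then have "x powr (- \<delta>) = x powr ((1 - \<alpha> - \<beta>) / 2) * x powr (\<kappa> * \<nu>)"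
    by (simp only: powr_add)
  then show ?thesis unfolding Phi_def amp_def J by simp
qed

text \<open>
  Here the lower bound for \<open>J\<^sub>\<nu>'\<close> at its zeros is used.
\<close>

lemma amp_bound: obtains C where "C > 0" "\<And>k. \<bar>amp k\<bar> \<le> C * ev k powr growth"
proof -
  obtain c where c: "c > 0" "\<And>k. c \<le> \<bar>deriv (bessel_J \<nu>) (bessel_zero \<nu> k)\<bar> * bessel_zero \<nu> k powr (1/2)"
    using deriv_bessel_J_lower_bound[of \<nu>] nu_pos by (metis less_imp_le)
  let ?C = "sqrt (2 * \<kappa>) / (c * 2 powr \<nu> * \<kappa> powr (\<nu> + 1/2))"
  have "\<bar>amp k\<bar> \<le> ?C * ev k powr growth" for k
  proof -
    let ?j = "bessel_zero \<nu> k" and ?D = "\<bar>deriv (bessel_J \<nu>) (bessel_zero \<nu> k)\<bar>"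
    note j = bz_pos[of k]
    have D: "?D > 0" using c(2)[of k] c(1) j by (smt (verit) zero_less_mult_iff powr_gt_zero)
    have "ev k = (\<kappa> * ?j) powr 2"
      using kappa_pos j by (simp add: lam_def power_mult_distrib)
    moreover have "2 * growth = \<nu> + 1/2" by (simp add: growth_def)
    ultimately have "ev k powr growth = (\<kappa> * ?j) powr (\<nu> + 1/2)" by (simp only: powr_powr)
    also have "\<dots> = \<kappa> powr (\<nu> + 1/2) * (?j powr \<nu> * ?j powr (1/2))"
      using kappa_pos j by (simp add: powr_mult powr_add)
    finally have e: "ev k powr growth = \<kappa> powr (\<nu> + 1/2) * (?j powr \<nu> * ?j powr (1/2))" .
    have "\<bar>amp k\<bar> = sqrt (2 * \<kappa>) * (?j powr \<nu> / 2 powr \<nu>) * (1 / ?D)"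
      using kappa_pos j by (simp add: amp_def abs_mult powr_divide)
    also have "\<dots> \<le> sqrt (2 * \<kappa>) * (?j powr \<nu> / 2 powr \<nu>) * (?j powr (1/2) / c)"
      using c(2)[of k] c(1) D kappa_pos j by (intro mult_left_mono) (auto simp: field_simps)
    also have "\<dots> = ?C * ev k powr growth"
      unfolding e using kappa_pos c by (simp add: field_simps)
    finally show ?thesis .
  qed
  moreover have "?C > 0" using kappa_pos c by simp
  ultimately show thesis using that by blast
qed

lemma Phi_bound:
  obtains C where "C > 0" "\<And>k x. x > 0 \<Longrightarrow> \<bar>\<Phi> k x\<bar> \<le> C * ev k powr growth * x powr (- \<delta>)"
proof -
  obtain C where C: "C > 0" "\<And>k. \<bar>amp k\<bar> \<le> C * ev k powr growth" by (rule amp_bound) blast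
  obtain B where B: "B > 0" "\<And>t. t \<ge> 0 \<Longrightarrow> \<bar>bessel_entire \<nu> t\<bar> \<le> B"
    using bessel_entire_bounded[of \<nu>] nu_pos by (metis less_imp_le)
  have "\<bar>\<Phi> k x\<bar> \<le> C * B * ev k powr growth * x powr (- \<delta>)" if "x > 0" for k x
  proof -
    have "\<bar>\<Phi> k x\<bar> = \<bar>amp k\<bar> * \<bar>bessel_entire \<nu> (zpar k * x powr (2 * \<kappa>))\<bar> * x powr (- \<delta>)"
      unfolding Phi_eq[OF that] by (simp add: abs_mult)
    also have "\<dots> \<le> (C * ev k powr growth) * B * x powr (- \<delta>)"
      using C B zpar_pos[of k] by (intro mult_mono mult_nonneg_nonneg) auto
    finally show ?thesis by (simp add: ac_simps)
  qed
  then show thesis using that[of "C * B"] B C by simp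
qed

lemma Phi_boundary_limit: "((\<lambda>x. x powr \<delta> * \<Phi> k x) \<longlongrightarrow> bdry_coef k) (at_right 0)"
proof -
  have "((\<lambda>x. x powr (2 * \<kappa>)) \<longlongrightarrow> 0) (at_right 0)"
    using kappa_pos by real_asymp
  then have "((\<lambda>x. zpar k * x powr (2 * \<kappa>)) \<longlongrightarrow> 0) (at_right 0)"
    by (rule tendsto_mult_right_zero)
  then have "((\<lambda>x. bessel_entire \<nu> (zpar k * x powr (2 * \<kappa>))) \<longlongrightarrow> bessel_entire \<nu> 0) (at_right 0)"
    by (rule isCont_tendsto_compose[rotated]) (use isCont_bessel_entire nu_pos in simp)
  then have "((\<lambda>x. amp k * bessel_entire \<nu> (zpar k * x powr (2 * \<kappa>))) \<longlongrightarrow> bdry_coef k) (at_right 0)"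
    unfolding bdry_coef_def bessel_entire_0[symmetric] by (rule tendsto_mult_left)
  moreover have "amp k * bessel_entire \<nu> (zpar k * x powr (2 * \<kappa>)) = x powr \<delta> * \<Phi> k x" if "x > 0" for x
  proof -
    have 1: "x powr \<delta> * x powr (- \<delta>) = 1"
      using that by (simp only: powr_add[symmetric] add.right_inverse powr_zero_eq_one) simp
    have "x powr \<delta> * \<Phi> k x
        = (x powr \<delta> * x powr (- \<delta>)) * (amp k * bessel_entire \<nu> (zpar k * x powr (2 * \<kappa>)))"
      unfolding Phi_eq[OF that] by (simp only: mult_ac)
    then show ?thesis unfolding 1 by simp
  qed
  then have "eventually (\<lambda>x. amp k * bessel_entire \<nu> (zpar k * x powr (2 * \<kappa>)) = x powr \<delta> * \<Phi> k x) (at_right 0)"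
    unfolding eventually_at_right_field by (intro exI[of _ 1]) simp
  ultimately show ?thesis by (rule Lim_transform_eventually)
qed

lemma bdry_coef_bound: obtains C where "C > 0" "\<And>k. \<bar>bdry_coef k\<bar> \<le> C * ev k powr growth"
proof -
  obtain C where C: "C > 0" "\<And>k. \<bar>amp k\<bar> \<le> C * ev k powr growth" by (rule amp_bound) blast
  have g: "rGamma (\<nu> + 1) > 0" using nu_pos by (simp add: rGamma_inverse_Gamma)
  have "\<bar>bdry_coef k\<bar> \<le> (C * rGamma (\<nu> + 1)) * ev k powr growth" for k
    using mult_right_mono[OF C(2)[of k], of "rGamma (\<nu> + 1)"] g
    by (simp add: bdry_coef_def abs_mult ac_simps)
  then show thesis using that[of "C * rGamma (\<nu> + 1)"] C g by simp
qed

lemma ev_lower_bound: obtains c where "c > 0" "\<And>k. c * real (Suc k) powr 2 \<le> ev k"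
proof -
  obtain d where d: "d > 0" "\<And>k. d * real (Suc k) \<le> bessel_zero \<nu> k"
    using bessel_zero_enumerates(3)[of \<nu>] nu_pos by auto
  have "(\<kappa> * d)\<^sup>2 * real (Suc k) powr 2 \<le> ev k" for k
  proof -
    have "\<kappa> * (d * real (Suc k)) \<le> \<kappa> * bessel_zero \<nu> k"
      using d(2)[of k] kappa_pos by (intro mult_left_mono) auto
    then have "(\<kappa> * (d * real (Suc k)))\<^sup>2 \<le> (\<kappa> * bessel_zero \<nu> k)\<^sup>2"
      using d kappa_pos by (intro power_mono) auto
    then show ?thesis by (simp add: lam_def power_mult_distrib ac_simps del: of_nat_Suc)
  qed
  then show thesis using that[of "(\<kappa> * d)\<^sup>2"] d kappa_pos by simp
qed

lemma summable_ev_powr: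
  assumes "r < - 1/2" shows "summable (\<lambda>k. ev k powr r)"
proof -
  obtain c where c: "c > 0" "\<And>k. c * real (Suc k) powr 2 \<le> ev k" by (rule ev_lower_bound) blast
  have "summable (\<lambda>n. real n powr (2 * r))" using assms by (simp add: summable_real_powr_iff)
  then have s: "summable (\<lambda>k. c powr r * real (Suc k) powr (2 * r))"
    using summable_Suc_iff[of "\<lambda>n. real n powr (2 * r)"] by (intro summable_mult) blast
  show ?thesis
  proof (rule summable_comparison_test'[OF s, of 0])
    fix k
    have "ev k powr r \<le> (c * real (Suc k) powr 2) powr r"
      using c assms by (intro powr_mono2') (auto simp del: of_nat_Suc)
    also have "\<dots> = c powr r * real (Suc k) powr (2 * r)"
      using c by (subst powr_mult) (simp_all add: powr_powr del: powr_numeral of_nat_Suc)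
    finally show "norm (ev k powr r) \<le> c powr r * real (Suc k) powr (2 * r)" by simp
  qed
qed

lemma filterlim_ev: "filterlim ev at_top sequentially"
proof -
  obtain c where c: "c > 0" "\<And>k. c * real (Suc k) powr 2 \<le> ev k" by (rule ev_lower_bound) blast
  have "filterlim (\<lambda>k. c * real (Suc k) powr 2) at_top sequentially"
    using c(1) by real_asymp
  then show ?thesis by (rule filterlim_at_top_mono) (use c in auto)
qed

text \<open>
  At positive times the exponential beats every power, so the series of the semigroup converge
  absolutely whatever the powers produced by the estimates.
\<close>

lemma summable_exp_ev_powr:
  assumes "t > 0" shows "summable (\<lambda>k. exp (- ev k * t) * ev k powr r)"
proof -
  have "((\<lambda>y. exp (- y * t) * y powr (r + 1)) \<longlongrightarrow> 0) at_top"
    using assms by real_asymp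
  then have "((\<lambda>k. exp (- ev k * t) * ev k powr (r + 1)) \<longlongrightarrow> 0) sequentially"
    using filterlim_ev by (rule filterlim_compose)
  then have "eventually (\<lambda>k. exp (- ev k * t) * ev k powr (r + 1) < 1) sequentially"
    by (rule order_tendstoD) simp
  then have "eventually (\<lambda>k. norm (exp (- ev k * t) * ev k powr r) \<le> ev k powr (- 1)) sequentially"
  proof (rule eventually_mono)
    fix k assume *: "exp (- ev k * t) * ev k powr (r + 1) < 1"
    have "exp (- ev k * t) * ev k powr r = exp (- ev k * t) * ev k powr (r + 1) * ev k powr (- 1)"
      using ev_pos[of k] by (simp add: powr_add powr_minus)
    also have "\<dots> \<le> 1 * ev k powr (- 1)" using * by (intro mult_right_mono) auto
    finally show "norm (exp (- ev k * t) * ev k powr r) \<le> ev k powr (- 1)" by simp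
  qed
  then show ?thesis by (rule summable_comparison_test_ev) (rule summable_ev_powr, simp)
qed

text \<open>
  The common majorant of all eigenfunctions, up to constants.
\<close>

definition profile :: "real \<Rightarrow> real" where "profile x = x powr (- \<delta>)"

lemma space_M: "space M = {0<..<1}"
  by (simp add: weighted_measure_def)

lemma measurable_M: "f \<in> borel_measurable M \<longleftrightarrow> f \<in> borel_measurable (lebesgue_on {0<..<1})"
  by (simp add: weighted_measure_def)

lemma borel_measurable_M: "f \<in> borel_measurable borel \<Longrightarrow> f \<in> borel_measurable M"
  unfolding measurable_M by (intro measurable_restrict_space1 measurable_completion) simp

lemma integrable_M_iff:
  assumes "f \<in> borel_measurable M"
  shows "integrable M f \<longleftrightarrow> set_integrable lebesgue {0<..<1} (\<lambda>x. x powr \<beta> * f x)"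
proof -
  have "(\<lambda>x::real. x powr \<beta>) \<in> borel_measurable (lebesgue_on {0<..<1})"
    by (intro measurable_restrict_space1 measurable_completion) simp
  then have "integrable M f \<longleftrightarrow> integrable (lebesgue_on {0<..<1}) (\<lambda>x. x powr \<beta> * f x)"
    using assms unfolding measurable_M unfolding weighted_measure_def
    by (subst integrable_density) auto
  then show ?thesis by (simp add: integrable_restrict_space set_integrable_def)
qed

lemma integral_M_eq:
  assumes "f \<in> borel_measurable M"
  shows "integral\<^sup>L M f = (LINT x:{0<..<1}|lebesgue. x powr \<beta> * f x)"
proof -
  have "(\<lambda>x::real. x powr \<beta>) \<in> borel_measurable (lebesgue_on {0<..<1})"
    by (intro measurable_restrict_space1 measurable_completion) simp
  then have "integral\<^sup>L M f = (LINT x|lebesgue_on {0<..<1}. x powr \<beta> * f x)"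
    using assms unfolding measurable_M unfolding weighted_measure_def
    by (subst integral_density) auto
  then show ?thesis by (simp add: integral_restrict_space set_lebesgue_integral_def)
qed

lemma integral_M_eq_HK:
  assumes "integrable M f" "(g has_integral I) {0..1}" "\<And>x. 0 < x \<Longrightarrow> x < 1 \<Longrightarrow> x powr \<beta> * f x = g x"
  shows "integral\<^sup>L M f = I"
proof -
  have f: "f \<in> borel_measurable M" using assms(1) by simp
  have "set_integrable lebesgue {0<..<1} (\<lambda>x. x powr \<beta> * f x)"
    using assms(1) integrable_M_iff[OF f] by simp
  from set_lebesgue_integral_eq_integral(2)[OF this]
  have "integral\<^sup>L M f = integral {0<..<1} (\<lambda>x. x powr \<beta> * f x)" by (simp add: integral_M_eq[OF f])
  also have "\<dots> = integral {0<..<1} g"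
    by (rule integral_cong) (use assms(3) in auto)
  also have "\<dots> = integral {0..1} g"
    using integral_open_interval_real[of 0 1 g] by simp
  also have "\<dots> = I" using assms(2) by (rule integral_unique)
  finally show ?thesis .
qed

text \<open>
  The weighted square is \<open>x\<close> to the power \<open>1 - \<alpha> + 2 \<kappa> \<nu>\<close>, which exceeds \<open>-1\<close> as \<open>\<alpha> < 2\<close>.
\<close>

lemma profile_L2: "profile \<in> L2_space M"
proof -
  have m: "profile \<in> borel_measurable M" "(\<lambda>x. (profile x)\<^sup>2) \<in> borel_measurable M"
    by (auto intro!: borel_measurable_M simp: profile_def[abs_def])
  define a where "a = 1 - \<alpha> + 2 * \<kappa> * \<nu>"
  have e: "\<beta> + (- \<delta> + - \<delta>) = a" unfolding delta_eq a_def by (simp add: field_simps)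
  have "\<kappa> * \<nu> > 0" "2 - \<alpha> > 0" using alpha_less kappa_pos nu_pos by auto
  then have "a > -1" unfolding a_def by linarith
  then have "(\<lambda>x. x powr a) integrable_on {0..1}"
    using has_integral_powr_from_0[of a 1] by (auto simp: integrable_on_def)
  then have "(\<lambda>x. x powr a) absolutely_integrable_on {0..1}"
    by (intro nonnegative_absolutely_integrable_1) auto
  then have "set_integrable lebesgue {0<..<1} (\<lambda>x. x powr a)"
    by (rule set_integrable_subset) auto
  moreover have "x powr \<beta> * (profile x)\<^sup>2 = x powr a" for x
    unfolding e[symmetric] profile_def power2_eq_square powr_add by simp
  ultimately have "integrable M (\<lambda>x. (profile x)\<^sup>2)"
    unfolding integrable_M_iff[OF m(2)] by simp
  then show ?thesis using m(1) by (simp add: L2_space_def)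
qed

lemma Phi_measurable: "\<Phi> k \<in> borel_measurable M"
proof -
  have "bessel_entire \<nu> \<in> borel_measurable borel"
    using continuous_on_bessel_entire[of \<nu> UNIV] nu_pos by (intro borel_measurable_continuous_onI) simp
  then have "(\<lambda>x. amp k * (x powr (- \<delta>) * bessel_entire \<nu> (zpar k * x powr (2 * \<kappa>)))) \<in> borel_measurable borel"
    by measurable
  then have "(\<lambda>x. amp k * (x powr (- \<delta>) * bessel_entire \<nu> (zpar k * x powr (2 * \<kappa>)))) \<in> borel_measurable M"
    by (rule borel_measurable_M)
  then show ?thesis
    by (rule measurable_cong[THEN iffD1, rotated]) (simp add: space_M Phi_eq)
qed

lemma Phi_L2: "\<Phi> k \<in> L2_space M"
proof -
  obtain C where C: "C > 0" "\<And>k x. x > 0 \<Longrightarrow> \<bar>\<Phi> k x\<bar> \<le> C * ev k powr growth * x powr (- \<delta>)"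
    by (rule Phi_bound) blast
  show ?thesis
    by (rule L2_space_dominated[OF profile_L2 Phi_measurable, of _ "C * ev k powr growth"])
      (use C(2) in \<open>simp add: space_M profile_def\<close>)
qed

text \<open>
  Written so that the Lommel integrals apply with the substitution \<open>r = x\<^bsup>2 \<kappa>\<^esup>\<close>.
\<close>

lemma weighted_Phi_product:
  assumes "x > 0"
  shows "x powr \<beta> * (\<Phi> k x * \<Phi> l x)
    = amp k * amp l / (2 * \<kappa>) * (2 * \<kappa> * x powr (2 * \<kappa> - 1) * ((x powr (2 * \<kappa>)) powr \<nu>
       * (bessel_entire \<nu> (zpar k * x powr (2 * \<kappa>)) * bessel_entire \<nu> (zpar l * x powr (2 * \<kappa>)))))"
proof -
  have "\<beta> + (- \<delta> + - \<delta>) = 2 * \<kappa> - 1 + 2 * \<kappa> * \<nu>" 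
    unfolding delta_eq by (simp add: field_simps kappa_def)
  then have "x powr \<beta> * (x powr (- \<delta>) * x powr (- \<delta>)) = x powr (2 * \<kappa> - 1) * (x powr (2 * \<kappa>)) powr \<nu>"
    unfolding powr_powr powr_add[symmetric] by simp
  moreover have "x powr \<beta> * (\<Phi> k x * \<Phi> l x) = x powr \<beta> * (x powr (- \<delta>) * x powr (- \<delta>)) * (amp k * amp l
      * (bessel_entire \<nu> (zpar k * x powr (2 * \<kappa>)) * bessel_entire \<nu> (zpar l * x powr (2 * \<kappa>))))"
    unfolding Phi_eq[OF assms] by simp
  ultimately show ?thesis using kappa_pos by simp
qed

lemma bessel_entire_zpar: "bessel_entire \<nu> (zpar k) = 0"
  unfolding zpar_def using bessel_entire_bessel_zero[of \<nu> k] nu_pos by simp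

lemma Phi_orthonormal: "L2_inner M (\<Phi> k) (\<Phi> l) = (if k = l then 1 else 0)"
proof (cases "k = l")
  case False
  have "inj (bessel_zero \<nu>)"
    using bessel_zero_enumerates(1)[of \<nu>] nu_pos by (simp add: strict_mono_imp_inj_on)
  then have "bessel_zero \<nu> k \<noteq> bessel_zero \<nu> l" using False by (simp add: inj_eq)
  then have "zpar k \<noteq> zpar l" using bz_pos[of k] bz_pos[of l] by (simp add: zpar_def)
  from bessel_entire_orthogonal[OF _ _ this bessel_entire_zpar bessel_entire_zpar, of "2 * \<kappa>"]
  have "((\<lambda>x. 2 * \<kappa> * x powr (2 * \<kappa> - 1) * ((x powr (2 * \<kappa>)) powr \<nu>
       * (bessel_entire \<nu> (zpar k * x powr (2 * \<kappa>)) * bessel_entire \<nu> (zpar l * x powr (2 * \<kappa>))))) has_integral 0) {0..1}"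
    using nu_pos kappa_pos by simp
  from has_integral_mult_right[OF this, of "amp k * amp l / (2 * \<kappa>)"]
  have "L2_inner M (\<Phi> k) (\<Phi> l) = amp k * amp l / (2 * \<kappa>) * 0"
    unfolding L2_inner_def
    by (rule integral_M_eq_HK[OF L2_space_integrable_mult[OF Phi_L2 Phi_L2]]) (rule weighted_Phi_product)
  then show ?thesis using False by simp
next
  case True
  let ?j = "bessel_zero \<nu> k" and ?G1 = "bessel_entire (\<nu> + 1) (zpar k)"
  have "((\<lambda>x. 2 * \<kappa> * x powr (2 * \<kappa> - 1) * ((x powr (2 * \<kappa>)) powr \<nu>
       * (bessel_entire \<nu> (zpar k * x powr (2 * \<kappa>)) * bessel_entire \<nu> (zpar k * x powr (2 * \<kappa>)))))
       has_integral zpar k * ?G1\<^sup>2) {0..1}"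
    using bessel_entire_norm[OF _ _ zpar_pos bessel_entire_zpar, of "2 * \<kappa>"] nu_pos kappa_pos
    by (simp add: power2_eq_square)
  from has_integral_mult_right[OF this, of "amp k * amp k / (2 * \<kappa>)"]
  have "L2_inner M (\<Phi> k) (\<Phi> k) = amp k * amp k / (2 * \<kappa>) * (zpar k * ?G1\<^sup>2)"
    unfolding L2_inner_def
    by (rule integral_M_eq_HK[OF L2_space_integrable_mult[OF Phi_L2 Phi_L2]]) (rule weighted_Phi_product)
  also have "\<dots> = 1"
  proof -
    obtain c where c: "c > 0" "\<And>k. c \<le> \<bar>deriv (bessel_J \<nu>) (bessel_zero \<nu> k)\<bar> * bessel_zero \<nu> k powr (1/2)"
      using deriv_bessel_J_lower_bound[of \<nu>] nu_pos by (metis less_imp_le)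
    have D: "deriv (bessel_J \<nu>) ?j = - ((?j / 2) powr (\<nu> + 1) * ?G1)"
      using deriv_bessel_J_bessel_zero[of \<nu> k] nu_pos by (simp add: zpar_def)
    have "deriv (bessel_J \<nu>) ?j \<noteq> 0" using c(2)[of k] c(1) by auto
    then have G1: "?G1 \<noteq> 0" unfolding D by auto
    have a: "\<bar>deriv (bessel_J \<nu>) ?j\<bar> = (?j / 2) powr \<nu> * (?j / 2) * \<bar>?G1\<bar>"
      unfolding D using bz_pos[of k] by (simp add: abs_mult powr_add)
    have "amp k = sqrt (2 * \<kappa>) / (?j / 2 * \<bar>?G1\<bar>)"
      unfolding amp_def a using bz_pos[of k] by simp
    then have "amp k * amp k = 2 * \<kappa> / (zpar k * ?G1\<^sup>2)"
      using kappa_pos by (simp add: zpar_def power2_eq_square)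
    then show ?thesis using kappa_pos zpar_pos[of k] G1 by simp
  qed
  finally show ?thesis using True by simp
qed

section \<open>Spaces and dual spaces as weighted sequence spaces\<close>

abbreviation "HS \<equiv> Hs \<alpha> \<beta> \<mu>"
abbreviation "HSnorm \<equiv> Hs_norm \<alpha> \<beta> \<mu>"
abbreviation "HSdual \<equiv> Hs_dual \<alpha> \<beta> \<mu>"
abbreviation "HSdnorm \<equiv> Hs_dual_norm \<alpha> \<beta> \<mu>"

lemma coef_Phi: "cf (\<Phi> k) l = (if k = l then 1 else 0)"
  by (simp add: coef_def Phi_orthonormal)

lemma coef_lincomb:
  "z \<in> L2_space M \<Longrightarrow> w \<in> L2_space M \<Longrightarrow> cf (\<lambda>x. a * z x + b * w x) k = a * cf z k + b * cf w k"
  unfolding coef_def by (rule L2_inner_lincomb_left[OF _ _ Phi_L2])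

lemma coef_sum: "cf (\<lambda>x. \<Sum>k<n. a k * \<Phi> k x) l = (if l < n then a l else 0)"
proof -
  have "cf (\<lambda>x. \<Sum>k<n. a k * \<Phi> k x) l = (\<Sum>k<n. a k * (if k = l then 1 else 0))"
    unfolding coef_def by (simp add: L2_inner_sum_left Phi_L2 Phi_orthonormal)
  also have "\<dots> = (if l < n then a l else 0)"
    by (simp add: if_distrib[of "\<lambda>c. _ * c"] cong: if_cong)
  finally show ?thesis .
qed

text \<open>
  Continuity of the inner product: the coefficients of an \<open>L\<^sup>2\<close>-convergent expansion are unique.
\<close>

lemma coef_eq_of_expansion:
  assumes u: "u \<in> L2_space M"
    and lim: "(\<lambda>n. L2_space_norm M (\<lambda>x. u x - (\<Sum>k<n. a k * \<Phi> k x))) \<longlonglongrightarrow> 0"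
  shows "cf u k = a k"
proof -
  let ?S = "\<lambda>n x. \<Sum>k<n. a k * \<Phi> k x"
  have "norm (cf u k - a k) \<le> L2_space_norm M (\<lambda>x. u x - ?S n x)" if "k < n" for n
  proof -
    have S: "?S n \<in> L2_space M" by (rule L2_space_sum) (rule Phi_L2)
    have "cf (\<lambda>x. u x - ?S n x) k = cf u k - a k"
      using coef_lincomb[OF u S, of 1 "-1" k] that by (simp add: coef_sum)
    moreover have "\<bar>cf (\<lambda>x. u x - ?S n x) k\<bar> \<le> L2_space_norm M (\<lambda>x. u x - ?S n x) * L2_space_norm M (\<Phi> k)"
      unfolding coef_def by (rule L2_Cauchy_Schwarz[OF L2_space_diff[OF u S] Phi_L2])
    moreover have "L2_space_norm M (\<Phi> k) = 1" by (simp add: L2_space_norm_def Phi_orthonormal)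
    ultimately show ?thesis by simp
  qed
  then have "norm (cf u k - a k) \<le> 0"
    by (intro tendsto_lowerbound[OF lim] eventually_mono[OF eventually_gt_at_top[of k]]) auto
  then show ?thesis by simp
qed

text \<open>
  The unspecified coefficients in the definition of the space can only be the Fourier coefficients.
\<close>

lemma Hs_iff:
  "z \<in> HS s \<longleftrightarrow> z \<in> L2_space M \<and>
     (\<lambda>n. L2_space_norm M (\<lambda>x. z x - (\<Sum>k<n. cf z k * \<Phi> k x))) \<longlonglongrightarrow> 0 \<and>
     summable (\<lambda>k. \<bar>cf z k\<bar>\<^sup>2 * ev k powr s)" (is "_ \<longleftrightarrow> ?R")
proof
  assume "z \<in> HS s"
  then obtain a where a: "z \<in> L2_space M"
      "(\<lambda>n. L2_space_norm M (\<lambda>x. z x - (\<Sum>k<n. a k * \<Phi> k x))) \<longlonglongrightarrow> 0"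
      "summable (\<lambda>k. \<bar>a k\<bar>\<^sup>2 * ev k powr s)" by (auto simp: Hs_def)
  have "cf z = a" using coef_eq_of_expansion[OF a(1,2)] by auto
  with a show ?R by simp
qed (auto simp: Hs_def)

lemma Hs_L2: "z \<in> HS s \<Longrightarrow> z \<in> L2_space M"
  and Hs_summable: "z \<in> HS s \<Longrightarrow> summable (\<lambda>k. \<bar>cf z k\<bar>\<^sup>2 * ev k powr s)"
  by (auto simp: Hs_iff)

lemma Hs_lincomb:
  assumes z: "z \<in> HS s" and w: "w \<in> HS s"
  shows "(\<lambda>x. a * z x + b * w x) \<in> HS s" (is "?u \<in> _")
proof -
  note c = coef_lincomb[OF Hs_L2[OF z] Hs_L2[OF w]]
  let ?r = "\<lambda>z n x. z x - (\<Sum>k<n. cf z k * \<Phi> k x)"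
  have L2: "?r z n \<in> L2_space M" if "z \<in> HS s" for z n
    using that by (intro L2_space_diff L2_space_sum Phi_L2) (rule Hs_L2)
  have r: "?r ?u n x = a * ?r z n x + b * ?r w n x" for n x
    by (simp add: c algebra_simps sum.distrib sum_distrib_left)
  have "(\<lambda>n. L2_space_norm M (?r ?u n)) \<longlonglongrightarrow> 0"
  proof (rule Lim_null_comparison)
    show "eventually (\<lambda>n. norm (L2_space_norm M (?r ?u n)) \<le> \<bar>a\<bar> * L2_space_norm M (?r z n) + \<bar>b\<bar> * L2_space_norm M (?r w n)) sequentially"
      unfolding r using L2_space_norm_lincomb[OF L2[OF z] L2[OF w]]
      by (intro always_eventually allI) (simp add: L2_space_norm_nonneg)
    show "(\<lambda>n. \<bar>a\<bar> * L2_space_norm M (?r z n) + \<bar>b\<bar> * L2_space_norm M (?r w n)) \<longlonglongrightarrow> 0"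
      using z w unfolding Hs_iff by (auto intro!: tendsto_add_zero tendsto_mult_right_zero)
  qed
  moreover have "summable (\<lambda>k. \<bar>cf ?u k\<bar>\<^sup>2 * ev k powr s)"
  proof (rule summable_comparison_test')
    show "summable (\<lambda>k. 2 * a\<^sup>2 * (\<bar>cf z k\<bar>\<^sup>2 * ev k powr s) + 2 * b\<^sup>2 * (\<bar>cf w k\<bar>\<^sup>2 * ev k powr s))"
      using Hs_summable[OF z] Hs_summable[OF w] by (intro summable_add summable_mult) 
    fix k
    have "(a * cf z k + b * cf w k)\<^sup>2 \<le> 2 * (a * cf z k)\<^sup>2 + 2 * (b * cf w k)\<^sup>2"
      using sum_squares_bound[of "a * cf z k" "b * cf w k"] by (simp add: power2_sum)
    from mult_right_mono[OF this, of "ev k powr s"]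
    show "norm (\<bar>cf ?u k\<bar>\<^sup>2 * ev k powr s)
        \<le> 2 * a\<^sup>2 * (\<bar>cf z k\<bar>\<^sup>2 * ev k powr s) + 2 * b\<^sup>2 * (\<bar>cf w k\<bar>\<^sup>2 * ev k powr s)"
      by (simp add: c power_mult_distrib algebra_simps)
  qed
  moreover have "?u \<in> L2_space M" by (rule L2_space_lincomb[OF Hs_L2[OF z] Hs_L2[OF w]])
  ultimately show ?thesis unfolding Hs_iff by blast
qed

lemma Phi_Hs: "\<Phi> k \<in> HS s"
proof -
  have "(\<Sum>i<n. cf (\<Phi> k) i * \<Phi> i x) = \<Phi> k x" if "n > k" for n x
    using that by (simp add: coef_Phi if_distrib[of "\<lambda>c. c * _"] cong: if_cong)
  then have "eventually (\<lambda>n. 0 = L2_space_norm M (\<lambda>x. \<Phi> k x - (\<Sum>i<n. cf (\<Phi> k) i * \<Phi> i x))) sequentially"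
    by (intro eventually_mono[OF eventually_gt_at_top[of k]]) (simp add: L2_space_norm_def L2_inner_def)
  then have "(\<lambda>n. L2_space_norm M (\<lambda>x. \<Phi> k x - (\<Sum>i<n. cf (\<Phi> k) i * \<Phi> i x))) \<longlonglongrightarrow> 0"
    by (rule Lim_transform_eventually[OF tendsto_const])
  moreover have "summable (\<lambda>i. \<bar>cf (\<Phi> k) i\<bar>\<^sup>2 * ev i powr s)"
    by (rule summable_finite[of "{k}"]) (auto simp: coef_Phi)
  ultimately show ?thesis by (simp add: Hs_iff Phi_L2)
qed

lemma Hs_dualD:
  assumes "\<phi> \<in> HSdual s"
  shows "\<And>z w a b. z \<in> HS s \<Longrightarrow> w \<in> HS s \<Longrightarrow> \<phi> (\<lambda>x. a * z x + b * w x) = a * \<phi> z + b * \<phi> w"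
    and "\<And>z. z \<notin> HS s \<Longrightarrow> \<phi> z = 0"
    and "\<exists>K\<ge>0. \<forall>z\<in>HS s. \<bar>\<phi> z\<bar> \<le> K * HSnorm s z"
proof -
  obtain K where K: "\<forall>z\<in>HS s. \<bar>\<phi> z\<bar> \<le> K * HSnorm s z" using assms by (auto simp: Hs_dual_def)
  have "K * HSnorm s z \<le> max K 0 * HSnorm s z" if "z \<in> HS s" for z
    by (intro mult_right_mono) (use Hs_summable[OF that] in \<open>auto simp: Hs_norm_def intro!: suminf_nonneg\<close>)
  with K show "\<exists>K\<ge>0. \<forall>z\<in>HS s. \<bar>\<phi> z\<bar> \<le> K * HSnorm s z"
    by (intro exI[of _ "max K 0"]) (auto intro: order_trans)
qed (use assms in \<open>auto simp: Hs_dual_def\<close>)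

lemma Hs_partial_sum:
  "(\<lambda>x. \<Sum>k<n. a k * \<Phi> k x) \<in> HS s"
  and Hs_dual_partial_sum: "\<phi> \<in> HSdual s \<Longrightarrow> \<phi> (\<lambda>x. \<Sum>k<n. a k * \<Phi> k x) = (\<Sum>k<n. a k * \<phi> (\<Phi> k))"
proof -
  show H: "(\<lambda>x. \<Sum>k<n. a k * \<Phi> k x) \<in> HS s" for n
  proof (induction n)
    case 0 then show ?case using Hs_lincomb[OF Phi_Hs[of 0] Phi_Hs[of 0], of 0 0] by simp
  next
    case (Suc n) then show ?case using Hs_lincomb[OF Suc Phi_Hs[of n], of 1 "a n"] by simp
  qed
  assume \<phi>: "\<phi> \<in> HSdual s"
  show "\<phi> (\<lambda>x. \<Sum>k<n. a k * \<Phi> k x) = (\<Sum>k<n. a k * \<phi> (\<Phi> k))"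
  proof (induction n)
    case 0 then show ?case using Hs_dualD(1)[OF \<phi> Phi_Hs[of 0] Phi_Hs[of 0], of 0 0] by simp
  next
    case (Suc n) then show ?case using Hs_dualD(1)[OF \<phi> H[of n] Phi_Hs[of n], of 1 "a n"] by simp
  qed
qed

text \<open>
  The partial sums of the expansion of \<open>z\<close> converge in the norm of \<open>\<H>\<^sup>s\<close>, for which \<open>\<phi>\<close> is
  continuous. In particular \<open>\<phi>\<close> does not see the values of \<open>z\<close> outside the unit interval or on
  null sets.
\<close>

lemma Hs_dual_expansion:
  assumes \<phi>: "\<phi> \<in> HSdual s" and z: "z \<in> HS s"
  shows "(\<lambda>k. \<phi> (\<Phi> k) * cf z k) sums \<phi> z"
proof -
  obtain K where K: "K \<ge> 0" "\<And>z. z \<in> HS s \<Longrightarrow> \<bar>\<phi> z\<bar> \<le> K * HSnorm s z"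
    using Hs_dualD(3)[OF \<phi>] by blast
  let ?b = "\<lambda>k. \<bar>cf z k\<bar>\<^sup>2 * ev k powr s"
  let ?S = "\<lambda>n x. \<Sum>k<n. cf z k * \<Phi> k x"
  have b: "summable ?b" by (rule Hs_summable[OF z])
  have est: "\<bar>\<phi> z - (\<Sum>k<n. \<phi> (\<Phi> k) * cf z k)\<bar> \<le> K * sqrt (suminf ?b - sum ?b {..<n})" for n
  proof -
    let ?r = "\<lambda>x. 1 * z x + (- 1) * ?S n x"
    have r: "?r \<in> HS s" by (rule Hs_lincomb[OF z Hs_partial_sum])
    have "cf ?r k = (if k < n then 0 else cf z k)" for k
      unfolding coef_lincomb[OF Hs_L2[OF z] Hs_L2[OF Hs_partial_sum]] coef_sum by simp
    then have "HSnorm s ?r = sqrt (\<Sum>k. ?b k - (if k \<in> {..<n} then ?b k else 0))"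
      unfolding Hs_norm_def by (intro arg_cong[where f = sqrt] suminf_cong) auto
    also have "(\<Sum>k. ?b k - (if k \<in> {..<n} then ?b k else 0)) = suminf ?b - sum ?b {..<n}"
      by (intro sums_unique[symmetric] sums_diff summable_sums[OF b] sums_If_finite_set) simp
    finally have "HSnorm s ?r = sqrt (suminf ?b - sum ?b {..<n})" .
    moreover have "\<phi> ?r = \<phi> z - (\<Sum>k<n. \<phi> (\<Phi> k) * cf z k)"
      unfolding Hs_dualD(1)[OF \<phi> z Hs_partial_sum] Hs_dual_partial_sum[OF \<phi>] by (simp add: mult.commute)
    ultimately show ?thesis using K(2)[OF r] by simp
  qed
  have "(\<lambda>n. K * sqrt (suminf ?b - sum ?b {..<n})) \<longlonglongrightarrow> K * sqrt (suminf ?b - suminf ?b)"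
    by (intro tendsto_intros summable_LIMSEQ[OF b])
  then have "(\<lambda>n. K * sqrt (suminf ?b - sum ?b {..<n})) \<longlonglongrightarrow> 0" by simp
  then have "(\<lambda>n. (\<Sum>k<n. \<phi> (\<Phi> k) * cf z k) - \<phi> z) \<longlonglongrightarrow> 0"
    by (rule Lim_null_comparison[rotated]) (use est in \<open>simp add: abs_minus_commute\<close>)
  then show ?thesis unfolding sums_def by (simp add: LIM_zero_iff)
qed

text \<open>
  Bounded functionals have coefficients in the dual weighted \<open>\<ell>\<^sup>2\<close> space: the functional is tested
  on the truncations of its own Riesz representer.
\<close>

lemma Hs_dual_summable:
  assumes \<phi>: "\<phi> \<in> HSdual s"
  shows "summable (\<lambda>k. ev k powr (- s) * \<bar>\<phi> (\<Phi> k)\<bar>\<^sup>2)"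
proof -
  obtain K where K: "K \<ge> 0" "\<And>z. z \<in> HS s \<Longrightarrow> \<bar>\<phi> z\<bar> \<le> K * HSnorm s z"
    using Hs_dualD(3)[OF \<phi>] by blast
  let ?b = "\<lambda>k. ev k powr (- s) * \<bar>\<phi> (\<Phi> k)\<bar>\<^sup>2"
  have "sum ?b {..<n} \<le> K\<^sup>2" for n
  proof -
    \<comment> \<open>both \<open>\<phi> z\<close> and the squared norm of \<open>z\<close> are the partial sum, which is therefore at most \<open>K\<^sup>2\<close>\<close>
    let ?z = "\<lambda>x. \<Sum>k<n. (ev k powr (- s) * \<phi> (\<Phi> k)) * \<Phi> k x"
    have "\<phi> ?z = sum ?b {..<n}"
      unfolding Hs_dual_partial_sum[OF \<phi>] by (simp add: power2_eq_square mult.assoc)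
    moreover have "HSnorm s ?z = sqrt (sum ?b {..<n})"
    proof -
      have *: "(ev k powr (- s))\<^sup>2 * ev k powr s = ev k powr (- s)" for k
      proof -
        have 1: "ev k powr (- s) * ev k powr s = 1"
          using ev_pos[of k] by (simp only: powr_add[symmetric] left_minus) simp
        show ?thesis unfolding power2_eq_square mult.assoc 1 by simp
      qed
      have "(ev k powr (- s) * \<phi> (\<Phi> k))\<^sup>2 * ev k powr s = ?b k" for k
      proof -
        have "(ev k powr (- s) * \<phi> (\<Phi> k))\<^sup>2 * ev k powr s = ((ev k powr (- s))\<^sup>2 * ev k powr s) * (\<phi> (\<Phi> k))\<^sup>2"
          by (simp only: power_mult_distrib mult_ac)
        then show ?thesis unfolding * by simp
      qed
      then have "\<bar>cf ?z k\<bar>\<^sup>2 * ev k powr s = (if k \<in> {..<n} then ?b k else 0)" for k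
        unfolding coef_sum power2_abs by simp
      then have "(\<Sum>k. \<bar>cf ?z k\<bar>\<^sup>2 * ev k powr s) = (\<Sum>k. if k \<in> {..<n} then ?b k else 0)"
        by (intro suminf_cong)
      also have "\<dots> = sum ?b {..<n}"
        by (rule sums_unique[OF sums_If_finite_set[OF finite_lessThan], symmetric])
      finally have "(\<Sum>k. \<bar>cf ?z k\<bar>\<^sup>2 * ev k powr s) = sum ?b {..<n}" .
      then show ?thesis by (simp add: Hs_norm_def)
    qed
    ultimately have *: "\<bar>sum ?b {..<n}\<bar> \<le> K * sqrt (sum ?b {..<n})"
      using K(2)[OF Hs_partial_sum[where n = n and a = "\<lambda>k. ev k powr (- s) * \<phi> (\<Phi> k)"]] by (simp only:)
    have nn: "sum ?b {..<n} \<ge> 0" by (intro sum_nonneg) auto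
    then have "sqrt (sum ?b {..<n}) * sqrt (sum ?b {..<n}) \<le> K * sqrt (sum ?b {..<n})" using * by simp
    then have "sqrt (sum ?b {..<n}) \<le> K" by (rule square_le_mult_imp_le) (use K(1) nn in auto)
    then have "(sqrt (sum ?b {..<n}))\<^sup>2 \<le> K\<^sup>2" using nn by (intro power_mono) auto
    then show ?thesis using nn by simp
  qed
  then have "sum ?b {..n} \<le> K\<^sup>2" for n
    unfolding lessThan_Suc_atMost[symmetric] .
  then show ?thesis by (rule bounded_imp_summable[rotated]) simp
qed

text \<open>
  The functional with prescribed coefficients. Its value outside \<open>\<H>\<^sup>s\<close> is 0, the normalisation of
  the dual space.
\<close>

definition dual_of :: "real \<Rightarrow> (nat \<Rightarrow> real) \<Rightarrow> (real \<Rightarrow> real) \<Rightarrow> real" where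
  "dual_of s q z = (if z \<in> HS s then \<Sum>k. q k * cf z k else 0)"

definition dual_seq :: "real \<Rightarrow> (nat \<Rightarrow> real) set" where
  "dual_seq s = {q. summable (\<lambda>k. ev k powr (- s) * \<bar>q k\<bar>\<^sup>2)}"

lemma dual_of_Phi: "dual_of s q (\<Phi> k) = q k"
proof -
  have "(\<Sum>i. q i * cf (\<Phi> k) i) = (\<Sum>i. if i = k then q i else 0)"
    by (intro suminf_cong) (auto simp: coef_Phi)
  also have "\<dots> = q k" by (rule sums_unique[OF sums_single, symmetric])
  finally show ?thesis by (simp add: dual_of_def Phi_Hs)
qed

lemma dual_of_summable:
  assumes "q \<in> dual_seq s" "z \<in> HS s"
  shows "summable (\<lambda>k. q k * cf z k)" "\<bar>\<Sum>k. q k * cf z k\<bar> \<le> HSdnorm s (dual_of s q) * HSnorm s z"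
proof -
  note w = summable_weighted_mult[of ev, OF ev_pos, of s q "cf z", OF _ Hs_summable[OF assms(2)]]
  show "summable (\<lambda>k. q k * cf z k)"
    using w(1) assms(1) unfolding dual_seq_def by (auto intro: summable_rabs_cancel)
  have "\<bar>\<Sum>k. q k * cf z k\<bar> \<le> (\<Sum>k. \<bar>q k * cf z k\<bar>)"
    using w(1) assms(1) unfolding dual_seq_def by (intro summable_rabs) auto
  also have "\<dots> \<le> HSdnorm s (dual_of s q) * HSnorm s z"
    using w(2) assms(1) unfolding dual_seq_def by (simp add: Hs_dual_norm_def Hs_norm_def dual_of_Phi)
  finally show "\<bar>\<Sum>k. q k * cf z k\<bar> \<le> HSdnorm s (dual_of s q) * HSnorm s z" .
qed

lemma dual_of_in_dual:
  assumes "q \<in> dual_seq s" shows "dual_of s q \<in> HSdual s"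
proof -
  have "dual_of s q (\<lambda>x. a * z x + b * w x) = a * dual_of s q z + b * dual_of s q w"
    if "z \<in> HS s" "w \<in> HS s" for z w a b
  proof -
    have "(\<Sum>k. q k * cf (\<lambda>x. a * z x + b * w x) k) = (\<Sum>k. a * (q k * cf z k) + b * (q k * cf w k))"
      unfolding coef_lincomb[OF Hs_L2[OF that(1)] Hs_L2[OF that(2)]] by (simp add: algebra_simps)
    also have "\<dots> = a * (\<Sum>k. q k * cf z k) + b * (\<Sum>k. q k * cf w k)"
      by (intro sums_unique[symmetric] sums_add sums_mult summable_sums dual_of_summable[OF assms] that)
    finally show ?thesis by (simp add: dual_of_def that Hs_lincomb)
  qed
  moreover have "\<forall>z\<in>HS s. \<bar>dual_of s q z\<bar> \<le> HSdnorm s (dual_of s q) * HSnorm s z"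
    using dual_of_summable(2)[OF assms] by (simp add: dual_of_def)
  ultimately show ?thesis unfolding Hs_dual_def by (auto simp: dual_of_def)
qed

text \<open>
  Together with \<open>dual_of_in_dual\<close> and \<open>dual_of_Phi\<close>, this identifies the dual of \<open>\<H>\<^sup>s\<close> with the
  sequence space.
\<close>

lemma dual_of_coefs:
  assumes "\<phi> \<in> HSdual s"
  shows "\<phi> = dual_of s (\<lambda>k. \<phi> (\<Phi> k))" "(\<lambda>k. \<phi> (\<Phi> k)) \<in> dual_seq s"
  using Hs_dual_expansion[OF assms, THEN sums_unique] Hs_dualD(2)[OF assms] Hs_dual_summable[OF assms]
  by (auto simp: dual_of_def dual_seq_def)

lemma dual_of_lincomb:
  assumes "q \<in> dual_seq s" "r \<in> dual_seq s"
  shows "dual_of s (\<lambda>k. a * q k + b * r k) z = a * dual_of s q z + b * dual_of s r z"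
proof (cases "z \<in> HS s")
  case True
  have "(\<lambda>k. a * (q k * cf z k) + b * (r k * cf z k)) sums (a * (\<Sum>k. q k * cf z k) + b * (\<Sum>k. r k * cf z k))"
    by (intro sums_add sums_mult summable_sums dual_of_summable[OF assms(1)] dual_of_summable[OF assms(2)] True)
  from sums_unique[OF this] show ?thesis by (simp add: dual_of_def True algebra_simps)
qed (simp add: dual_of_def)

lemma Hs_dual_norm_dual_of: "HSdnorm s (dual_of s q) = sqrt (\<Sum>k. ev k powr (- s) * \<bar>q k\<bar>\<^sup>2)"
  by (simp add: Hs_dual_norm_def dual_of_Phi)

lemma dual_seq_dominated:
  assumes "D \<in> dual_seq s" "\<And>k. \<bar>q k\<bar> \<le> D k" shows "q \<in> dual_seq s"
proof -
  have "\<bar>q k\<bar>\<^sup>2 \<le> \<bar>D k\<bar>\<^sup>2" for k using assms(2)[of k] by (intro power_mono) auto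
  then have "norm (ev k powr (- s) * \<bar>q k\<bar>\<^sup>2) \<le> ev k powr (- s) * \<bar>D k\<bar>\<^sup>2" for k
    by (simp add: mult_left_mono)
  moreover have "summable (\<lambda>k. ev k powr (- s) * \<bar>D k\<bar>\<^sup>2)" using assms(1) by (simp add: dual_seq_def)
  ultimately have "summable (\<lambda>k. ev k powr (- s) * \<bar>q k\<bar>\<^sup>2)" by (rule summable_comparison_test'[rotated, where N = 0])
  then show ?thesis by (simp add: dual_seq_def)
qed

text \<open>
  Continuity of each coefficient and a common majorant in the sequence space give continuity in
  norm, by dominated convergence of the series for the squared norm.
\<close>

lemma C0_dual_of:
  assumes D: "D \<in> dual_seq s"
    and b: "\<And>t k. t \<in> {0..T} \<Longrightarrow> \<bar>P t k\<bar> \<le> D k"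
    and c: "\<And>k. continuous_on {0..T} (\<lambda>t. P t k)"
    and u: "\<And>t. t \<in> {0..T} \<Longrightarrow> u t = dual_of s (P t)"
  shows "u \<in> C0_dual \<alpha> \<beta> \<mu> s T"
  unfolding C0_dual_def
proof (intro CollectI ballI conjI)
  fix t assume t: "t \<in> {0..T}"
  have P: "P r \<in> dual_seq s" if "r \<in> {0..T}" for r
    using dual_seq_dominated[OF D b[OF that]] .
  then show "u t \<in> HSdual s" using u[OF t] dual_of_in_dual t by simp
  have ev: "eventually (\<lambda>r. r \<in> {0..T}) (at t within {0..T})"
    by (simp add: eventually_at_filter)
  have "((\<lambda>r. \<Sum>k. ev k powr (- s) * \<bar>P r k - P t k\<bar>\<^sup>2) \<longlongrightarrow> (\<Sum>k. ev k powr (- s) * \<bar>P t k - P t k\<bar>\<^sup>2)) (at t within {0..T})"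
  proof (rule tendsto_suminf_dominated)
    show "((\<lambda>r. ev k powr (- s) * \<bar>P r k - P t k\<bar>\<^sup>2) \<longlongrightarrow> ev k powr (- s) * \<bar>P t k - P t k\<bar>\<^sup>2) (at t within {0..T})" for k
    proof (intro tendsto_intros)
      show "((\<lambda>r. P r k) \<longlongrightarrow> P t k) (at t within {0..T})"
        using c[of k] t by (simp add: continuous_on_def)
    qed
    show "summable (\<lambda>k. 4 * (ev k powr (- s) * \<bar>D k\<bar>\<^sup>2))"
      using D by (intro summable_mult) (simp add: dual_seq_def)
    show "eventually (\<lambda>r. \<forall>k. \<bar>ev k powr (- s) * \<bar>P r k - P t k\<bar>\<^sup>2\<bar> \<le> 4 * (ev k powr (- s) * \<bar>D k\<bar>\<^sup>2)) (at t within {0..T})"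
    proof (rule eventually_mono[OF ev], intro allI)
      fix r k assume r: "r \<in> {0..T}"
      have "\<bar>P r k - P t k\<bar> \<le> 2 * D k" using b[OF r, of k] b[OF t, of k] by linarith
      then have "\<bar>P r k - P t k\<bar>\<^sup>2 \<le> (2 * D k)\<^sup>2" by (intro power_mono) auto
      from mult_left_mono[OF this, of "ev k powr (- s)"]
      show "\<bar>ev k powr (- s) * \<bar>P r k - P t k\<bar>\<^sup>2\<bar> \<le> 4 * (ev k powr (- s) * \<bar>D k\<bar>\<^sup>2)"
        by (simp add: power_mult_distrib)
    qed
  qed
  then have "((\<lambda>r. sqrt (\<Sum>k. ev k powr (- s) * \<bar>P r k - P t k\<bar>\<^sup>2)) \<longlongrightarrow> sqrt 0) (at t within {0..T})"
    by (intro tendsto_real_sqrt) simp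
  then have lim: "((\<lambda>r. sqrt (\<Sum>k. ev k powr (- s) * \<bar>P r k - P t k\<bar>\<^sup>2)) \<longlongrightarrow> 0) (at t within {0..T})" by simp
  show "((\<lambda>r. HSdnorm s (\<lambda>z. u r z - u t z)) \<longlongrightarrow> 0) (at t within {0..T})"
    by (rule Lim_transform_eventually[OF lim], rule eventually_mono[OF ev])
       (simp add: u u[OF t] Hs_dual_norm_def dual_of_Phi)
qed

text \<open>
  A single coefficient is bounded by a multiple of the dual norm. This determines a weak solution
  at time 0, where the transposition formula is not imposed.
\<close>

lemma C0_dual_coef_continuous:
  assumes "u \<in> C0_dual \<alpha> \<beta> \<mu> s T"
  shows "continuous_on {0..T} (\<lambda>t. u t (\<Phi> k))"
  unfolding continuous_on_def
proof
  fix t assume t: "t \<in> {0..T}"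
  have H: "u r \<in> HSdual s" if "r \<in> {0..T}" for r using assms that by (simp add: C0_dual_def)
  have lim: "((\<lambda>r. HSdnorm s (\<lambda>z. u r z - u t z)) \<longlongrightarrow> 0) (at t within {0..T})"
    using assms t by (simp add: C0_dual_def)
  have ev: "eventually (\<lambda>r. r \<in> {0..T}) (at t within {0..T})"
    by (simp add: eventually_at_filter)
  have "\<bar>u r (\<Phi> k) - u t (\<Phi> k)\<bar> \<le> ev k powr (s / 2) * HSdnorm s (\<lambda>z. u r z - u t z)" if r: "r \<in> {0..T}" for r
  proof -
    let ?d = "\<lambda>k. u r (\<Phi> k) - u t (\<Phi> k)"
    have "summable (\<lambda>k. 2 * (ev k powr (- s) * \<bar>u r (\<Phi> k)\<bar>\<^sup>2) + 2 * (ev k powr (- s) * \<bar>u t (\<Phi> k)\<bar>\<^sup>2))"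
      using Hs_dual_summable[OF H[OF r]] Hs_dual_summable[OF H[OF t]] by (intro summable_add summable_mult)
    then have sm: "summable (\<lambda>k. ev k powr (- s) * \<bar>?d k\<bar>\<^sup>2)"
    proof (rule summable_comparison_test'[where N = 0])
      fix k
      have "(?d k)\<^sup>2 \<le> 2 * (u r (\<Phi> k))\<^sup>2 + 2 * (u t (\<Phi> k))\<^sup>2"
        using zero_le_power2[of "u r (\<Phi> k) + u t (\<Phi> k)"] by (simp add: power2_sum power2_diff)
      from mult_left_mono[OF this, of "ev k powr (- s)"]
      show "norm (ev k powr (- s) * \<bar>?d k\<bar>\<^sup>2) \<le> 2 * (ev k powr (- s) * \<bar>u r (\<Phi> k)\<bar>\<^sup>2) + 2 * (ev k powr (- s) * \<bar>u t (\<Phi> k)\<bar>\<^sup>2)"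
        by (simp add: algebra_simps)
    qed
    have "ev k powr (- s) * \<bar>?d k\<bar>\<^sup>2 \<le> (\<Sum>k. ev k powr (- s) * \<bar>?d k\<bar>\<^sup>2)"
      using sum_le_suminf[OF sm, of "{k}"] by simp
    then have "sqrt (ev k powr (- s) * \<bar>?d k\<bar>\<^sup>2) \<le> HSdnorm s (\<lambda>z. u r z - u t z)"
      unfolding Hs_dual_norm_def by (rule real_sqrt_le_mono)
    moreover have "sqrt (ev k powr (- s) * \<bar>?d k\<bar>\<^sup>2) = ev k powr (- s / 2) * \<bar>?d k\<bar>"
      unfolding real_sqrt_mult using ev_pos[of k] by (subst powr_half_sqrt_powr) auto
    ultimately have "ev k powr (s / 2) * (ev k powr (- s / 2) * \<bar>?d k\<bar>) \<le> ev k powr (s / 2) * HSdnorm s (\<lambda>z. u r z - u t z)"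
      by (intro mult_left_mono) auto
    moreover have "ev k powr (s / 2) * (ev k powr (- s / 2) * \<bar>?d k\<bar>) = ev k powr (s / 2 + - s / 2) * \<bar>?d k\<bar>"
      by (simp only: powr_add mult.assoc)
    moreover have "ev k powr (s / 2 + - s / 2) = 1" using ev_pos[of k] by simp
    ultimately show ?thesis by (simp only: mult_1)
  qed
  then have "((\<lambda>r. u r (\<Phi> k) - u t (\<Phi> k)) \<longlongrightarrow> 0) (at t within {0..T})"
    by (intro Lim_null_comparison[OF eventually_mono[OF ev] tendsto_mult_right_zero[OF lim, of "ev k powr (s / 2)"]]) simp
  then show "((\<lambda>t. u t (\<Phi> k)) \<longlongrightarrow> u t (\<Phi> k)) (at t within {0..T})"
    by (simp add: LIM_zero_iff)
qed

section \<open>The semigroup and its boundary value\<close>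

abbreviation "SG \<equiv> semigroup_fun \<alpha> \<beta> \<mu>"

lemma Hs_coef_bound:
  assumes "z \<in> HS s"
  obtains C where "C \<ge> 0" "\<And>k. \<bar>cf z k\<bar> \<le> C * ev k powr (- s / 2)"
proof -
  let ?b = "\<lambda>k. \<bar>cf z k\<bar>\<^sup>2 * ev k powr s"
  note sm = Hs_summable[OF assms]
  have "\<bar>cf z k\<bar> \<le> sqrt (suminf ?b) * ev k powr (- s / 2)" for k
  proof -
    have "sqrt (?b k) \<le> sqrt (suminf ?b)"
      using sum_le_suminf[OF sm, of "{k}"] by (intro real_sqrt_le_mono) simp
    moreover have "sqrt (?b k) = \<bar>cf z k\<bar> * ev k powr (s / 2)"
      unfolding real_sqrt_mult using ev_pos[of k] by (subst powr_half_sqrt_powr) auto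
    ultimately have "\<bar>cf z k\<bar> * ev k powr (s / 2) \<le> sqrt (suminf ?b)" by (simp only:)
    then have "\<bar>cf z k\<bar> * ev k powr (s / 2) * ev k powr (- s / 2) \<le> sqrt (suminf ?b) * ev k powr (- s / 2)"
      by (rule mult_right_mono) simp
    moreover have "ev k powr (s / 2 + - s / 2) = 1" using ev_pos[of k] by simp
    ultimately show ?thesis by (simp only: powr_add mult.assoc mult_1_right)
  qed
  moreover have "sqrt (suminf ?b) \<ge> 0" using sm by (intro real_sqrt_ge_zero suminf_nonneg) auto
  ultimately show thesis using that by blast
qed

lemma summable_semigroup:
  assumes "z \<in> HS s" "t > 0"
  shows "summable (\<lambda>k. \<bar>exp (- ev k * t) * cf z k\<bar> * ev k powr r)"
proof -
  obtain C where C: "C \<ge> 0" "\<And>k. \<bar>cf z k\<bar> \<le> C * ev k powr (- s / 2)"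
    by (rule Hs_coef_bound[OF assms(1)]) blast
  show ?thesis
  proof (rule summable_comparison_test'[where N = 0])
    show "summable (\<lambda>k. C * (exp (- ev k * t) * ev k powr (- s / 2 + r)))"
      by (intro summable_mult summable_exp_ev_powr assms(2))
    fix k
    have "\<bar>exp (- ev k * t) * cf z k\<bar> * ev k powr r = exp (- ev k * t) * (\<bar>cf z k\<bar> * ev k powr r)"
      by (simp add: abs_mult)
    also have "\<dots> \<le> exp (- ev k * t) * (C * ev k powr (- s / 2) * ev k powr r)"
      using C(2)[of k] by (intro mult_left_mono mult_right_mono) auto
    also have "\<dots> = C * (exp (- ev k * t) * ev k powr (- s / 2 + r))"
      by (simp only: powr_add mult_ac)
    finally show "norm (\<bar>exp (- ev k * t) * cf z k\<bar> * ev k powr r) \<le> \<dots>" by simp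
  qed
qed

text \<open>
  The pointwise sum has to be identified with the \<open>L\<^sup>2\<close>-sum. The remainders of the series are at
  most \<open>profile\<close> times the tail of a convergent numerical series, so both kinds of
  convergence hold with the same limit.
\<close>

lemma semigroup_in_Hs:
  assumes z: "z \<in> HS s" and t: "t > 0"
  shows "SG t z \<in> HS s" "cf (SG t z) k = exp (- ev k * t) * cf z k"
proof -
  let ?b = "\<lambda>k. exp (- ev k * t) * cf z k"
  obtain C where C: "C > 0" "\<And>k x. x > 0 \<Longrightarrow> \<bar>\<Phi> k x\<bar> \<le> C * ev k powr growth * x powr (- \<delta>)"
    by (rule Phi_bound) blast
  define D where "D k = C * (\<bar>?b k\<bar> * ev k powr growth)" for k
  have D: "summable D" unfolding D_def by (intro summable_mult summable_semigroup[OF z t])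
  have bd: "\<bar>?b k * \<Phi> k x\<bar> \<le> D k * profile x" if "x > 0" for k x
  proof -
    have "\<bar>?b k * \<Phi> k x\<bar> = \<bar>?b k\<bar> * \<bar>\<Phi> k x\<bar>" by (rule abs_mult)
    also have "\<dots> \<le> \<bar>?b k\<bar> * (C * ev k powr growth * x powr (- \<delta>))"
      by (intro mult_left_mono C(2) that) auto
    also have "\<dots> = D k * profile x" unfolding D_def profile_def by (simp only: mult_ac)
    finally show ?thesis .
  qed
  have smx: "summable (\<lambda>k. \<bar>?b k * \<Phi> k x\<bar>)" if "x > 0" for x
    by (rule summable_comparison_test'[OF summable_mult2[OF D, of "profile x"], of 0]) (use bd that in simp)
  let ?u = "SG t z"
  have u: "?u x = (\<Sum>k. ?b k * \<Phi> k x)" for x using t by (simp add: semigroup_fun_def)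
  have meas: "?u \<in> borel_measurable M"
  proof -
    have "(\<lambda>x. \<Sum>k. ?b k * \<Phi> k x) \<in> borel_measurable M"
      by (rule borel_measurable_suminf) (intro borel_measurable_times borel_measurable_const Phi_measurable)
    then show ?thesis unfolding u[abs_def, symmetric] by simp
  qed
  have tail: "\<bar>?u x - (\<Sum>k<n. ?b k * \<Phi> k x)\<bar> \<le> (suminf D - sum D {..<n}) * profile x" if x: "x > 0" for x n
  proof -
    let ?f = "\<lambda>k. ?b k * \<Phi> k x"
    have sf: "summable ?f" using smx[OF x] by (rule summable_rabs_cancel)
    have tail_f: "?u x - (\<Sum>k<n. ?f k) = (\<Sum>k. ?f (k + n))"
      unfolding u by (rule suminf_minus_initial_segment[OF sf, symmetric])
    have sm: "summable (\<lambda>k. \<bar>?f (k + n)\<bar>)"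
      by (rule summable_ignore_initial_segment[OF smx[OF x]])
    have sD: "summable (\<lambda>k. D (k + n))" by (rule summable_ignore_initial_segment[OF D])
    have "\<bar>?u x - (\<Sum>k<n. ?f k)\<bar> \<le> (\<Sum>k. \<bar>?f (k + n)\<bar>)"
      unfolding tail_f by (rule summable_rabs[OF sm])
    also have "\<dots> \<le> (\<Sum>k. D (k + n) * profile x)"
    proof (rule suminf_le)
      show "\<bar>?f (k + n)\<bar> \<le> D (k + n) * profile x" for k by (rule bd[OF x])
    qed (rule sm, rule summable_mult2[OF sD])
    also have "\<dots> = (suminf D - sum D {..<n}) * profile x"
      unfolding suminf_mult2[OF sD, symmetric]
      by (rule arg_cong[OF suminf_minus_initial_segment[OF D], of "\<lambda>y. y * profile x"])
    finally show ?thesis .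
  qed
  have uL2: "?u \<in> L2_space M"
    by (rule L2_space_dominated[OF profile_L2 meas, of "suminf D"]) (use tail[of _ 0] in \<open>simp add: space_M\<close>)
  have lim: "(\<lambda>n. L2_space_norm M (\<lambda>x. ?u x - (\<Sum>k<n. ?b k * \<Phi> k x))) \<longlonglongrightarrow> 0"
  proof (rule Lim_null_comparison)
    have "(\<lambda>n. (suminf D - sum D {..<n}) * L2_space_norm M profile) \<longlonglongrightarrow> (suminf D - suminf D) * L2_space_norm M profile"
      by (intro tendsto_intros summable_LIMSEQ[OF D])
    then show "(\<lambda>n. (suminf D - sum D {..<n}) * L2_space_norm M profile) \<longlonglongrightarrow> 0" by simp
    have "L2_space_norm M (\<lambda>x. ?u x - (\<Sum>k<n. ?b k * \<Phi> k x)) \<le> (suminf D - sum D {..<n}) * L2_space_norm M profile" for n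
    proof (rule L2_space_norm_dominated[OF profile_L2])
      show "(\<lambda>x. ?u x - (\<Sum>k<n. ?b k * \<Phi> k x)) \<in> borel_measurable M"
        by (intro borel_measurable_diff borel_measurable_sum borel_measurable_times borel_measurable_const meas Phi_measurable)
      have "D k \<ge> 0" for k using C(1) by (simp add: D_def)
      then show "0 \<le> suminf D - sum D {..<n}" using sum_le_suminf[OF D, of "{..<n}"] by simp
    qed (use tail in \<open>simp add: space_M\<close>)
    then show "eventually (\<lambda>n. norm (L2_space_norm M (\<lambda>x. ?u x - (\<Sum>k<n. ?b k * \<Phi> k x))) \<le> (suminf D - sum D {..<n}) * L2_space_norm M profile) sequentially"
      by (intro always_eventually allI) (simp add: L2_space_norm_nonneg)
  qed
  show c: "cf ?u k = ?b k" for k by (rule coef_eq_of_expansion[OF uL2 lim])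
  have "summable (\<lambda>k. \<bar>?b k\<bar>\<^sup>2 * ev k powr s)"
  proof (rule summable_comparison_test'[OF Hs_summable[OF z], of 0])
    fix k
    have "exp (- ev k * t) \<le> 1" using ev_pos[of k] t by simp
    then have "\<bar>?b k\<bar> \<le> \<bar>cf z k\<bar>" unfolding abs_mult by (simp add: mult_left_le_one_le)
    then have "\<bar>?b k\<bar>\<^sup>2 \<le> \<bar>cf z k\<bar>\<^sup>2" by (intro power_mono) auto
    then show "norm (\<bar>?b k\<bar>\<^sup>2 * ev k powr s) \<le> \<bar>cf z k\<bar>\<^sup>2 * ev k powr s"
      by (simp add: mult_right_mono)
  qed
  with uL2 lim show "?u \<in> HS s" unfolding Hs_iff c by blast
qed

text \<open>
  After multiplication by \<open>x\<^sup>\<delta>\<close> the terms are bounded uniformly in \<open>x\<close> by a summable sequence, so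
  the limit may be taken term by term.
\<close>

lemma semigroup_boundary_limit:
  assumes z: "z \<in> HS s" and t: "t > 0"
  shows "((\<lambda>x. x powr \<delta> * SG t z x) \<longlongrightarrow> (\<Sum>k. exp (- ev k * t) * cf z k * bdry_coef k)) (at_right 0)"
proof -
  let ?b = "\<lambda>k. exp (- ev k * t) * cf z k"
  obtain C where C: "C > 0" "\<And>k x. x > 0 \<Longrightarrow> \<bar>\<Phi> k x\<bar> \<le> C * ev k powr growth * x powr (- \<delta>)"
    by (rule Phi_bound) blast
  define D where "D k = C * (\<bar>?b k\<bar> * ev k powr growth)" for k
  have D: "summable D" unfolding D_def by (intro summable_mult summable_semigroup[OF z t])
  have bd: "\<bar>?b k * (x powr \<delta> * \<Phi> k x)\<bar> \<le> D k" if "x > 0" for k x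
  proof -
    have 1: "x powr \<delta> * x powr (- \<delta>) = 1"
      using that by (simp only: powr_add[symmetric] add.right_inverse powr_zero_eq_one) simp
    have "\<bar>?b k * (x powr \<delta> * \<Phi> k x)\<bar> = \<bar>?b k\<bar> * x powr \<delta> * \<bar>\<Phi> k x\<bar>" by (simp add: abs_mult)
    also have "\<dots> \<le> \<bar>?b k\<bar> * x powr \<delta> * (C * ev k powr growth * x powr (- \<delta>))"
      by (intro mult_left_mono C(2) that) auto
    also have "\<dots> = D k * (x powr \<delta> * x powr (- \<delta>))" unfolding D_def by (simp only: mult_ac)
    finally show ?thesis unfolding 1 by simp
  qed
  have pos: "eventually (\<lambda>x::real. x > 0) (at_right 0)" by (simp add: eventually_at_right_less)
  have "((\<lambda>x. \<Sum>k. ?b k * (x powr \<delta> * \<Phi> k x)) \<longlongrightarrow> (\<Sum>k. ?b k * bdry_coef k)) (at_right 0)"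
    by (rule tendsto_suminf_dominated[OF tendsto_mult_left[OF Phi_boundary_limit] eventually_mono[OF pos] D]) (use bd in blast)
  moreover have "(\<Sum>k. ?b k * (x powr \<delta> * \<Phi> k x)) = x powr \<delta> * SG t z x" if x: "x > 0" for x
  proof -
    have "summable (\<lambda>k. x powr \<delta> * (?b k * \<Phi> k x))"
      by (rule summable_comparison_test'[OF D, of 0]) (use bd[OF x] in \<open>simp add: ac_simps\<close>)
    then have "summable (\<lambda>k. ?b k * \<Phi> k x)" using x by simp
    then have "x powr \<delta> * (\<Sum>k. ?b k * \<Phi> k x) = (\<Sum>k. x powr \<delta> * (?b k * \<Phi> k x))"
      by (rule suminf_mult[symmetric])
    also have "\<dots> = (\<Sum>k. ?b k * (x powr \<delta> * \<Phi> k x))" by (simp only: mult_ac)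
    finally show ?thesis using t by (simp add: semigroup_fun_def)
  qed
  ultimately show ?thesis
    by (rule Lim_transform_eventually[OF _ eventually_mono[OF pos]])
qed

lemma bdry_semigroup_eq:
  assumes "z \<in> HS s" "t > 0"
  shows "bdry_exists \<delta> (SG t z)"
    and "bdry_semigroup \<alpha> \<beta> \<mu> t z = (\<Sum>k. exp (- ev k * t) * cf z k * bdry_coef k)"
  using semigroup_boundary_limit[OF assms] tendsto_Lim[OF trivial_limit_at_right_real semigroup_boundary_limit[OF assms]]
  by (auto simp: bdry_exists_def bdry_semigroup_def bdry_def)

lemma dual_semigroup:
  assumes "\<phi> \<in> HSdual s" "z \<in> HS s" "t \<ge> 0"
  shows "SG t z \<in> HS s" "\<phi> (SG t z) = (\<Sum>k. exp (- ev k * t) * \<phi> (\<Phi> k) * cf z k)"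
proof -
  have *: "SG t z \<in> HS s \<and> (\<forall>k. cf (SG t z) k = exp (- ev k * t) * cf z k)"
    using semigroup_in_Hs[OF assms(2)] assms(2,3) by (cases "t = 0") (auto simp: semigroup_fun_def)
  then show H: "SG t z \<in> HS s" by blast
  show "\<phi> (SG t z) = (\<Sum>k. exp (- ev k * t) * \<phi> (\<Phi> k) * cf z k)"
    using sums_unique[OF Hs_dual_expansion[OF assms(1) H]] * by (simp add: ac_simps)
qed

section \<open>The control operator\<close>

text \<open>
  The bound for the \<open>k\<close>-th coefficient of the control operator at a unit control, see
  \<open>control_coef_bound\<close>.
\<close>

definition gain :: "nat \<Rightarrow> real" where "gain k = \<bar>bdry_coef k\<bar> / sqrt (2 * ev k)"

text \<open>
  The terms are at most of order \<open>\<lambda>\<^sub>k\<^bsup>-s + \<nu> - 1/2\<^esup>\<close>, and \<open>\<Sum> \<lambda>\<^sub>k\<^sup>r\<close> converges for \<open>r < -1/2\<close>. This is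
  where \<open>s > \<nu>\<close> is used.
\<close>

lemma gain_in_dual_seq:
  assumes "s > \<nu>"
  shows "gain \<in> dual_seq s"
proof -
  obtain C where C: "C > 0" "\<And>k. \<bar>bdry_coef k\<bar> \<le> C * ev k powr growth" by (rule bdry_coef_bound) blast
  have "summable (\<lambda>k. C\<^sup>2 / 2 * ev k powr (- s + \<nu> - 1/2))"
    using assms by (intro summable_mult summable_ev_powr) simp
  moreover have "norm (ev k powr (- s) * \<bar>gain k\<bar>\<^sup>2) \<le> C\<^sup>2 / 2 * ev k powr (- s + \<nu> - 1/2)" for k
  proof -
    have "(gain k)\<^sup>2 = \<bar>bdry_coef k\<bar>\<^sup>2 / (2 * ev k)"
      using ev_pos[of k] by (simp add: gain_def power_divide)
    also have "\<dots> \<le> (C * ev k powr growth)\<^sup>2 / (2 * ev k)"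
      using C(2)[of k] ev_pos[of k] by (intro divide_right_mono power_mono) auto
    also have "\<dots> = C\<^sup>2 / 2 * (ev k powr growth * ev k powr growth / ev k)"
      by (simp add: power2_eq_square)
    also have "ev k powr growth * ev k powr growth / ev k = ev k powr (growth + growth - 1)"
      using ev_pos[of k] by (simp only: powr_add powr_diff) simp
    also have "growth + growth - 1 = \<nu> - 1/2" by (simp add: growth_def)
    finally have "ev k powr (- s) * (gain k)\<^sup>2 \<le> ev k powr (- s) * (C\<^sup>2 / 2 * ev k powr (\<nu> - 1/2))"
      by (rule mult_left_mono) simp
    also have "\<dots> = C\<^sup>2 / 2 * ev k powr (- s + (\<nu> - 1/2))" by (simp only: powr_add mult_ac)
    finally show ?thesis by (simp add: add_diff_eq)
  qed
  ultimately have "summable (\<lambda>k. ev k powr (- s) * \<bar>gain k\<bar>\<^sup>2)"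
    by (rule summable_comparison_test'[where N = 0])
  then show ?thesis by (simp add: dual_seq_def)
qed

definition control_coef :: "real \<Rightarrow> (real \<Rightarrow> real) \<Rightarrow> nat \<Rightarrow> real" where
  "control_coef \<tau> f k = bdry_coef k * exp_conv (ev k) \<tau> f"

lemma control_coef_bound:
  assumes "0 \<le> \<tau>" "\<tau> \<le> T" "f \<in> L2_space (lebesgue_on {0<..<T})"
  shows "\<bar>control_coef \<tau> f k\<bar> \<le> L2_space_norm (lebesgue_on {0<..<T}) f * gain k"
proof -
  have "\<bar>control_coef \<tau> f k\<bar> = \<bar>bdry_coef k\<bar> * \<bar>exp_conv (ev k) \<tau> f\<bar>"
    unfolding control_coef_def by (rule abs_mult)
  also have "\<dots> \<le> \<bar>bdry_coef k\<bar> * (L2_space_norm (lebesgue_on {0<..<T}) f / sqrt (2 * ev k))"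
    by (intro mult_left_mono exp_conv_integrable(3) ev_pos assms) simp
  finally show ?thesis by (simp add: gain_def mult.commute)
qed

lemma dual_seq_scale: "q \<in> dual_seq s \<Longrightarrow> (\<lambda>k. c * q k) \<in> dual_seq s"
  unfolding dual_seq_def
  using summable_mult[of "\<lambda>k. ev k powr (- s) * \<bar>q k\<bar>\<^sup>2" "c\<^sup>2"]
  by (simp add: power_mult_distrib mult.left_commute)

lemma control_coef_dual_seq:
  assumes "s > \<nu>" "0 \<le> \<tau>" "\<tau> \<le> T" "f \<in> L2_space (lebesgue_on {0<..<T})"
  shows "control_coef \<tau> f \<in> dual_seq s"
  by (rule dual_seq_dominated[OF dual_seq_scale[OF gain_in_dual_seq[OF assms(1)]] control_coef_bound[OF assms(2-4)]])

text \<open>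
  Sum and integral over time may be exchanged although the series for the boundary value is not
  uniform up to \<open>t = \<tau>\<close>: the \<open>L\<^sup>1\<close> norms of its terms are at most
  \<open>\<parallel>f\<parallel> gain\<^sub>k \<bar>z\<^sub>k\<bar>\<close>, a summable sequence by the pairing of the weighted sequence spaces.
\<close>

lemma boundary_observation:
  assumes s: "s > \<nu>" and \<tau>: "0 \<le> \<tau>" "\<tau> \<le> T" and f: "f \<in> L2_space (lebesgue_on {0<..<T})" and z: "z \<in> HS s"
  shows "set_integrable lebesgue {0<..<\<tau>} (\<lambda>t. f t * bdry_semigroup \<alpha> \<beta> \<mu> (\<tau> - t) z)"
    and "(LINT t:{0<..<\<tau>}|lebesgue. f t * bdry_semigroup \<alpha> \<beta> \<mu> (\<tau> - t) z) = (\<Sum>k. control_coef \<tau> f k * cf z k)"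
proof -
  let ?N = "lebesgue_on {0<..<T}"
  define G where "G k t = indicator {0<..<\<tau>} t * (bdry_coef k * cf z k * (f t * exp (- ev k * (\<tau> - t))))" for k t
  have int: "integrable ?N (G k)" for k
    unfolding G_def lebesgue_on_prefix_integral(1)[OF \<tau>(2)]
    by (intro set_integrable_mult_right exp_conv_integrable(1)[OF ev_pos \<tau> f])
  have G_int: "integral\<^sup>L ?N (G k) = control_coef \<tau> f k * cf z k" for k
    unfolding G_def lebesgue_on_prefix_integral(2)[OF \<tau>(2)]
    by (simp add: control_coef_def exp_conv_def)
  have G_abs: "(LINT t|?N. norm (G k t)) \<le> L2_space_norm ?N f * \<bar>gain k * cf z k\<bar>" for k
  proof -
    have "(LINT t|?N. norm (G k t)) = (LINT t|?N. indicator {0<..<\<tau>} t * (\<bar>bdry_coef k * cf z k\<bar> * \<bar>f t * exp (- ev k * (\<tau> - t))\<bar>))"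
      by (intro Bochner_Integration.integral_cong refl) (simp add: G_def abs_mult)
    also have "\<dots> = \<bar>bdry_coef k * cf z k\<bar> * (LINT t:{0<..<\<tau>}|lebesgue. \<bar>f t * exp (- ev k * (\<tau> - t))\<bar>)"
      unfolding lebesgue_on_prefix_integral(2)[OF \<tau>(2)] by simp
    also have "\<dots> \<le> \<bar>bdry_coef k * cf z k\<bar> * (L2_space_norm ?N f / sqrt (2 * ev k))"
      by (intro mult_left_mono exp_conv_integrable(2)[OF ev_pos \<tau> f]) simp
    also have "\<dots> = L2_space_norm ?N f * \<bar>gain k * cf z k\<bar>"
      using ev_pos[of k] by (simp add: gain_def abs_mult)
    finally show ?thesis .
  qed
  have "summable (\<lambda>k. \<bar>gain k * cf z k\<bar>)"
    using summable_weighted_mult(1)[of ev, OF ev_pos _ Hs_summable[OF z]] gain_in_dual_seq[OF s]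
    by (simp add: dual_seq_def)
  then have "summable (\<lambda>k. L2_space_norm ?N f * \<bar>gain k * cf z k\<bar>)" by (rule summable_mult)
  moreover have "norm (LINT t|?N. norm (G k t)) \<le> L2_space_norm ?N f * \<bar>gain k * cf z k\<bar>" for k
    using G_abs[of k] by (simp only: real_norm_def abs_of_nonneg[OF Bochner_Integration.integral_nonneg] norm_ge_zero)
  ultimately have sm: "summable (\<lambda>k. LINT t|?N. norm (G k t))"
    by (rule summable_comparison_test'[where N = 0])
  obtain C where C: "C > 0" "\<And>k. \<bar>bdry_coef k\<bar> \<le> C * ev k powr growth" by (rule bdry_coef_bound) blast
  have G_summable: "summable (\<lambda>k. norm (G k t))" for t
  proof (cases "t \<in> {0<..<\<tau>}")
    case True
    then have "\<tau> - t > 0" by simp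
    from summable_mult[OF summable_semigroup[OF z this, of growth], of "\<bar>f t\<bar> * C"]
    show ?thesis
    proof (rule summable_comparison_test'[where N = 0])
      fix k
      have "norm (norm (G k t)) = (\<bar>f t\<bar> * \<bar>exp (- ev k * (\<tau> - t)) * cf z k\<bar>) * \<bar>bdry_coef k\<bar>"
        using True by (simp add: G_def abs_mult)
      also have "\<dots> \<le> (\<bar>f t\<bar> * \<bar>exp (- ev k * (\<tau> - t)) * cf z k\<bar>) * (C * ev k powr growth)"
        by (intro mult_left_mono C(2)) simp
      also have "\<dots> = \<bar>f t\<bar> * C * (\<bar>exp (- ev k * (\<tau> - t)) * cf z k\<bar> * ev k powr growth)"
        by (simp only: mult_ac)
      finally show "norm (norm (G k t)) \<le> \<dots>" .
    qed
  qed (simp add: G_def)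
  have sum_G: "(\<Sum>k. G k t) = indicator {0<..<\<tau>} t * (f t * bdry_semigroup \<alpha> \<beta> \<mu> (\<tau> - t) z)" for t
  proof (cases "t \<in> {0<..<\<tau>}")
    case True
    then have t: "\<tau> - t > 0" by simp
    have "summable (\<lambda>k. exp (- ev k * (\<tau> - t)) * cf z k * bdry_coef k)"
    proof (rule summable_comparison_test'[OF summable_mult[OF summable_semigroup[OF z t, of growth], of C], of 0])
      fix k
      have "norm (exp (- ev k * (\<tau> - t)) * cf z k * bdry_coef k) = \<bar>exp (- ev k * (\<tau> - t)) * cf z k\<bar> * \<bar>bdry_coef k\<bar>"
        by (simp add: abs_mult)
      also have "\<dots> \<le> \<bar>exp (- ev k * (\<tau> - t)) * cf z k\<bar> * (C * ev k powr growth)"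
        by (intro mult_left_mono C(2)) simp
      finally show "norm (exp (- ev k * (\<tau> - t)) * cf z k * bdry_coef k) \<le> C * (\<bar>exp (- ev k * (\<tau> - t)) * cf z k\<bar> * ev k powr growth)"
        by (simp only: mult_ac)
    qed
    then have "(\<Sum>k. f t * (exp (- ev k * (\<tau> - t)) * cf z k * bdry_coef k)) = f t * bdry_semigroup \<alpha> \<beta> \<mu> (\<tau> - t) z"
      unfolding bdry_semigroup_eq(2)[OF z t] by (rule suminf_mult)
    moreover have "G k t = f t * (exp (- ev k * (\<tau> - t)) * cf z k * bdry_coef k)" for k
      using True by (simp add: G_def)
    ultimately show ?thesis using True by simp
  qed (simp add: G_def)
  have "AE t in ?N. summable (\<lambda>k. norm (G k t))" by (intro AE_I2 G_summable)
  then have "integrable ?N (\<lambda>t. \<Sum>k. G k t)" "(LINT t|?N. (\<Sum>k. G k t)) = (\<Sum>k. integral\<^sup>L ?N (G k))"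
    by (rule integrable_suminf[OF int _ sm], rule integral_suminf[OF int _ sm])
  then show "set_integrable lebesgue {0<..<\<tau>} (\<lambda>t. f t * bdry_semigroup \<alpha> \<beta> \<mu> (\<tau> - t) z)"
    "(LINT t:{0<..<\<tau>}|lebesgue. f t * bdry_semigroup \<alpha> \<beta> \<mu> (\<tau> - t) z) = (\<Sum>k. control_coef \<tau> f k * cf z k)"
    unfolding sum_G G_int lebesgue_on_prefix_integral[OF \<tau>(2)] .
qed

lemma control_op_eq:
  assumes "s > \<nu>" "0 \<le> \<tau>" "\<tau> \<le> T" "f \<in> L2_space (lebesgue_on {0<..<T})"
  shows "control_op \<alpha> \<beta> \<mu> s \<tau> f = dual_of s (control_coef \<tau> f)"
  using boundary_observation(2)[OF assms] by (auto simp: control_op_def dual_of_def)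

text \<open>
  The factor \<open>\<surd>2\<close> comes from \<open>(a + b)\<^sup>2 \<le> 2 a\<^sup>2 + 2 b\<^sup>2\<close> and is harmless for the estimates. The
  hypothesis is on absolute values so that factors of modulus at most 1 are covered.
\<close>

lemma dual_norm_quasi_triangle:
  assumes "q \<in> dual_seq s" "r \<in> dual_seq s" "\<And>k. \<bar>h k\<bar> \<le> \<bar>q k\<bar> + \<bar>r k\<bar>"
  shows "h \<in> dual_seq s"
    and "HSdnorm s (dual_of s h) \<le> sqrt 2 * (HSdnorm s (dual_of s q) + HSdnorm s (dual_of s r))"
proof -
  let ?S = "\<lambda>q k. ev k powr (- s) * \<bar>q k\<bar>\<^sup>2"
  have sq: "summable (?S q)" and sr: "summable (?S r)" using assms by (simp_all add: dual_seq_def)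
  have S: "summable (\<lambda>k. 2 * ?S q k + 2 * ?S r k)"
    by (intro summable_add summable_mult sq sr)
  have b: "?S h k \<le> 2 * ?S q k + 2 * ?S r k" for k
  proof -
    have "\<bar>h k\<bar>\<^sup>2 \<le> (\<bar>q k\<bar> + \<bar>r k\<bar>)\<^sup>2" using assms(3) by (intro power_mono) auto
    also have "\<dots> \<le> 2 * \<bar>q k\<bar>\<^sup>2 + 2 * \<bar>r k\<bar>\<^sup>2"
      using sum_squares_bound[of "\<bar>q k\<bar>" "\<bar>r k\<bar>"] by (simp add: power2_sum)
    finally have "?S h k \<le> ev k powr (- s) * (2 * \<bar>q k\<bar>\<^sup>2 + 2 * \<bar>r k\<bar>\<^sup>2)"
      by (rule mult_left_mono) simp
    then show ?thesis by (simp add: algebra_simps)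
  qed
  have sp: "summable (?S h)"
    by (rule summable_comparison_test'[OF S, of 0]) (use b in simp)
  then show "h \<in> dual_seq s" by (simp add: dual_seq_def)
  have nn: "0 \<le> suminf (?S q)" "0 \<le> suminf (?S r)" using sq sr by (auto intro!: suminf_nonneg)
  have "suminf (?S h) \<le> (\<Sum>k. 2 * ?S q k + 2 * ?S r k)" by (rule suminf_le[OF b sp S])
  also have "\<dots> = 2 * suminf (?S q) + 2 * suminf (?S r)"
    by (intro sums_unique[symmetric] sums_add sums_mult summable_sums sq sr)
  finally have "suminf (?S h) \<le> 2 * (suminf (?S q) + suminf (?S r))" by simp
  then have "sqrt (suminf (?S h)) \<le> sqrt 2 * sqrt (suminf (?S q) + suminf (?S r))"
    unfolding real_sqrt_mult[symmetric] by (rule real_sqrt_le_mono)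
  also have "\<dots> \<le> sqrt 2 * (sqrt (suminf (?S q)) + sqrt (suminf (?S r)))"
    using sqrt_add_le_add_sqrt[OF nn] by (intro mult_left_mono) auto
  finally show "HSdnorm s (dual_of s h) \<le> sqrt 2 * (HSdnorm s (dual_of s q) + HSdnorm s (dual_of s r))"
    unfolding Hs_dual_norm_dual_of .
qed

text \<open>
  A bound for the norms of all control operators, independent of the time horizon.
\<close>

definition gain_norm :: "real \<Rightarrow> real" where "gain_norm s = HSdnorm s (dual_of s gain)"

lemma control_norm:
  assumes "s > \<nu>" "0 \<le> \<tau>" "\<tau> \<le> T" "f \<in> L2_space (lebesgue_on {0<..<T})"
  shows "HSdnorm s (dual_of s (control_coef \<tau> f)) \<le> gain_norm s * L2_space_norm (lebesgue_on {0<..<T}) f"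
proof -
  let ?n = "L2_space_norm (lebesgue_on {0<..<T}) f"
  let ?S = "\<lambda>q k. ev k powr (- s) * \<bar>q k\<bar>\<^sup>2"
  have sc: "summable (?S (control_coef \<tau> f))"
    using control_coef_dual_seq[OF assms] by (simp add: dual_seq_def)
  have sg: "summable (?S gain)" using gain_in_dual_seq[OF assms(1)] by (simp add: dual_seq_def)
  have "?S (control_coef \<tau> f) k \<le> ?n\<^sup>2 * ?S gain k" for k
  proof -
    have "\<bar>control_coef \<tau> f k\<bar>\<^sup>2 \<le> (?n * gain k)\<^sup>2"
      using control_coef_bound[OF assms(2-4)] by (intro power_mono) auto
    from mult_left_mono[OF this, of "ev k powr (- s)"] show ?thesis
      by (simp add: power_mult_distrib mult.left_commute)
  qed
  then have "suminf (?S (control_coef \<tau> f)) \<le> (\<Sum>k. ?n\<^sup>2 * ?S gain k)"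
    by (rule suminf_le[OF _ sc summable_mult[OF sg]])
  also have "\<dots> = ?n\<^sup>2 * suminf (?S gain)" by (rule suminf_mult[OF sg])
  finally have "sqrt (suminf (?S (control_coef \<tau> f))) \<le> sqrt (?n\<^sup>2 * suminf (?S gain))"
    by (rule real_sqrt_le_mono)
  also have "\<dots> = gain_norm s * ?n"
    unfolding gain_norm_def Hs_dual_norm_dual_of real_sqrt_mult
    by (simp add: L2_space_norm_nonneg mult.commute)
  finally show ?thesis unfolding Hs_dual_norm_dual_of .
qed

lemma continuous_on_control_coef:
  assumes "0 \<le> T" "f \<in> L2_space (lebesgue_on {0<..<T})"
  shows "continuous_on {0..T} (\<lambda>\<tau>. control_coef \<tau> f k)"
  unfolding control_coef_def by (intro continuous_on_mult_left continuous_on_exp_conv assms)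

lemma control_coef_lincomb:
  assumes "0 \<le> \<tau>" "\<tau> \<le> T" "f \<in> L2_space (lebesgue_on {0<..<T})" "g \<in> L2_space (lebesgue_on {0<..<T})"
  shows "control_coef \<tau> (\<lambda>t. a * f t + b * g t) = (\<lambda>k. a * control_coef \<tau> f k + b * control_coef \<tau> g k)"
  by (rule ext) (simp add: control_coef_def exp_conv_lincomb[OF ev_pos assms] algebra_simps)

section \<open>The solution in terms of its coefficients\<close>

definition solution_coef :: "((real \<Rightarrow> real) \<Rightarrow> real) \<Rightarrow> (real \<Rightarrow> real) \<Rightarrow> real \<Rightarrow> nat \<Rightarrow> real" where
  "solution_coef u0 f \<tau> k = exp (- ev k * \<tau>) * u0 (\<Phi> k) - control_coef \<tau> f k"

lemma free_coef_bound: "t \<ge> 0 \<Longrightarrow> \<bar>exp (- ev k * t) * c\<bar> \<le> \<bar>c\<bar>"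
  using ev_pos[of k] by (simp add: abs_mult mult_left_le_one_le)

lemma free_coef_dual_seq:
  assumes "u0 \<in> HSdual s" "t \<ge> 0"
  shows "(\<lambda>k. exp (- ev k * t) * u0 (\<Phi> k)) \<in> dual_seq s"
proof (rule dual_norm_quasi_triangle(1)[OF dual_of_coefs(2)[OF assms(1)] dual_of_coefs(2)[OF assms(1)]])
  show "\<bar>exp (- ev k * t) * u0 (\<Phi> k)\<bar> \<le> \<bar>u0 (\<Phi> k)\<bar> + \<bar>u0 (\<Phi> k)\<bar>" for k
    using free_coef_bound[OF assms(2), of k "u0 (\<Phi> k)"] by linarith
qed

lemma semigroup_dual_eq: "semigroup_dual \<alpha> \<beta> \<mu> s t u0 = dual_of s (\<lambda>k. exp (- ev k * t) * u0 (\<Phi> k))"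
  by (rule ext) (simp add: semigroup_dual_def dual_of_def)

lemma solution_eq:
  assumes "s > \<nu>" "0 \<le> \<tau>" "\<tau> \<le> T" "f \<in> L2_space (lebesgue_on {0<..<T})" "u0 \<in> HSdual s"
  shows "dual_of s (solution_coef u0 f \<tau>) = (\<lambda>z. semigroup_dual \<alpha> \<beta> \<mu> s \<tau> u0 z - control_op \<alpha> \<beta> \<mu> s \<tau> f z)"
    and "solution_coef u0 f \<tau> \<in> dual_seq s"
proof -
  note a = free_coef_dual_seq[OF assms(5,2)] and c = control_coef_dual_seq[OF assms(1-4)]
  show "dual_of s (solution_coef u0 f \<tau>) = (\<lambda>z. semigroup_dual \<alpha> \<beta> \<mu> s \<tau> u0 z - control_op \<alpha> \<beta> \<mu> s \<tau> f z)"
    using dual_of_lincomb[OF a c, of 1 "-1"]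
    unfolding solution_coef_def[abs_def] semigroup_dual_eq control_op_eq[OF assms(1-4)] by auto
  show "solution_coef u0 f \<tau> \<in> dual_seq s"
    by (rule dual_norm_quasi_triangle(1)[OF a c]) (simp add: solution_coef_def abs_triangle_ineq4)
qed

text \<open>
  The transposition formula prescribes the value at every element of \<open>\<H>\<^sup>s\<close>, so there is nothing
  to solve: the content is that the prescribed values form a bounded functional.
\<close>

lemma transposition_iff:
  assumes "s > \<nu>" "0 \<le> \<tau>" "\<tau> \<le> T" "f \<in> L2_space (lebesgue_on {0<..<T})" "u0 \<in> HSdual s"
  shows "v \<in> HSdual s \<and> transposition \<alpha> \<beta> \<mu> s u0 f \<tau> v \<longleftrightarrow> v = dual_of s (solution_coef u0 f \<tau>)"
proof -
  have rhs: "- (LINT t:{0<..<\<tau>}|lebesgue. f t * bdry_semigroup \<alpha> \<beta> \<mu> (\<tau> - t) z) + u0 (SG \<tau> z)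
      = dual_of s (solution_coef u0 f \<tau>) z" if z: "z \<in> HS s" for z
    unfolding solution_eq(1)[OF assms]
    using dual_semigroup(2)[OF assms(5) z assms(2)] z
    by (simp add: semigroup_dual_def control_op_def)
  show ?thesis
  proof
    assume v: "v \<in> HSdual s \<and> transposition \<alpha> \<beta> \<mu> s u0 f \<tau> v"
    show "v = dual_of s (solution_coef u0 f \<tau>)"
    proof
      fix z show "v z = dual_of s (solution_coef u0 f \<tau>) z"
      proof (cases "z \<in> HS s")
        case True
        then show ?thesis using v rhs[OF True] by (simp add: transposition_def)
      next
        case False
        then show ?thesis using v Hs_dualD(2)[of v s z] by (simp add: dual_of_def)
      qed
    qed
  next
    assume "v = dual_of s (solution_coef u0 f \<tau>)"
    then show "v \<in> HSdual s \<and> transposition \<alpha> \<beta> \<mu> s u0 f \<tau> v"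
      using dual_of_in_dual[OF solution_eq(2)[OF assms]] rhs by (simp add: transposition_def)
  qed
qed

lemma continuous_on_solution_coef:
  assumes "0 \<le> T" "f \<in> L2_space (lebesgue_on {0<..<T})"
  shows "continuous_on {0..T} (\<lambda>\<tau>. solution_coef u0 f \<tau> k)"
  unfolding solution_coef_def
  by (intro continuous_on_diff continuous_on_control_coef assms) (intro continuous_intros)

lemma solution_in_C0:
  assumes "s > \<nu>" "0 \<le> T" "f \<in> L2_space (lebesgue_on {0<..<T})" "u0 \<in> HSdual s"
  shows "(\<lambda>\<tau>. dual_of s (solution_coef u0 f \<tau>)) \<in> C0_dual \<alpha> \<beta> \<mu> s T"
proof -
  let ?n = "L2_space_norm (lebesgue_on {0<..<T}) f"
  show ?thesis
  proof (rule C0_dual_of[where D = "\<lambda>k. \<bar>u0 (\<Phi> k)\<bar> + ?n * gain k" and P = "solution_coef u0 f"])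
    have "0 \<le> gain k" for k using ev_pos[of k] by (simp add: gain_def)
    then show "(\<lambda>k. \<bar>u0 (\<Phi> k)\<bar> + ?n * gain k) \<in> dual_seq s"
      by (intro dual_norm_quasi_triangle(1)[OF dual_of_coefs(2)[OF assms(4)] dual_seq_scale[OF gain_in_dual_seq[OF assms(1)], of ?n]])
        (simp add: L2_space_norm_nonneg)
    fix t k assume t: "t \<in> {0..T}"
    show "\<bar>solution_coef u0 f t k\<bar> \<le> \<bar>u0 (\<Phi> k)\<bar> + ?n * gain k"
      using free_coef_bound[of t k "u0 (\<Phi> k)"] control_coef_bound[of t T f k] t assms(3)
      unfolding solution_coef_def by auto
  qed (auto intro: continuous_on_solution_coef assms)
qed

lemma weak_solution_eq:
  assumes "s > \<nu>" "0 < T" "f \<in> L2_space (lebesgue_on {0<..<T})" "u0 \<in> HSdual s"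
    and v: "weak_solution \<alpha> \<beta> \<mu> s T u0 f v" and t: "t \<in> {0..T}"
  shows "v t = dual_of s (solution_coef u0 f t)"
proof -
  have vC: "v \<in> C0_dual \<alpha> \<beta> \<mu> s T" and vt: "\<And>\<tau>. \<tau> \<in> {0<..T} \<Longrightarrow> transposition \<alpha> \<beta> \<mu> s u0 f \<tau> (v \<tau>)"
    using v by (auto simp: weak_solution_def)
  have vdual: "v \<tau> \<in> HSdual s" if "\<tau> \<in> {0..T}" for \<tau> using vC that by (simp add: C0_dual_def)
  have pos: "v \<tau> = dual_of s (solution_coef u0 f \<tau>)" if "\<tau> \<in> {0<..T}" for \<tau>
    using transposition_iff[OF assms(1) _ _ assms(3,4), of \<tau> "v \<tau>"] vdual[of \<tau>] vt[OF that] that by auto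
  show ?thesis
  proof (cases "t = 0")
    case True
    have "v 0 (\<Phi> k) = solution_coef u0 f 0 k" for k
    proof (rule tendsto_unique[OF trivial_limit_at_right_real])
      show "((\<lambda>\<tau>. v \<tau> (\<Phi> k)) \<longlongrightarrow> v 0 (\<Phi> k)) (at_right 0)"
        using continuous_on_Icc_at_rightD[OF C0_dual_coef_continuous[OF vC] assms(2)] .
      have "((\<lambda>\<tau>. solution_coef u0 f \<tau> k) \<longlongrightarrow> solution_coef u0 f 0 k) (at_right 0)"
        using continuous_on_Icc_at_rightD[OF continuous_on_solution_coef[OF less_imp_le[OF assms(2)] assms(3)] assms(2)] .
      moreover have "eventually (\<lambda>\<tau>. solution_coef u0 f \<tau> k = v \<tau> (\<Phi> k)) (at_right 0)"
        unfolding eventually_at_right_field using assms(2)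
        by (intro exI[of _ T]) (simp add: pos dual_of_Phi)
      ultimately show "((\<lambda>\<tau>. v \<tau> (\<Phi> k)) \<longlongrightarrow> solution_coef u0 f 0 k) (at_right 0)"
        by (rule Lim_transform_eventually)
    qed
    then have "(\<lambda>k. v 0 (\<Phi> k)) = solution_coef u0 f 0" by auto
    then show ?thesis using dual_of_coefs(1)[OF vdual[of 0]] assms(2) True by simp
  qed (use pos t in auto)
qed

lemma solution_norm:
  assumes "s > \<nu>" "0 \<le> \<tau>" "\<tau> \<le> T" "f \<in> L2_space (lebesgue_on {0<..<T})" "u0 \<in> HSdual s"
  shows "HSdnorm s (dual_of s (solution_coef u0 f \<tau>))
    \<le> sqrt 2 * max 1 (gain_norm s) * (HSdnorm s u0 + L2_space_norm (lebesgue_on {0<..<T}) f)"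
proof -
  let ?n = "L2_space_norm (lebesgue_on {0<..<T}) f"
  have "HSdnorm s (dual_of s (solution_coef u0 f \<tau>))
      \<le> sqrt 2 * (HSdnorm s (dual_of s (\<lambda>k. u0 (\<Phi> k))) + HSdnorm s (dual_of s (control_coef \<tau> f)))"
  proof (rule dual_norm_quasi_triangle(2)[OF dual_of_coefs(2)[OF assms(5)] control_coef_dual_seq[OF assms(1-4)]])
    show "\<bar>solution_coef u0 f \<tau> k\<bar> \<le> \<bar>u0 (\<Phi> k)\<bar> + \<bar>control_coef \<tau> f k\<bar>" for k
      using free_coef_bound[OF assms(2), of k "u0 (\<Phi> k)"] unfolding solution_coef_def by linarith
  qed
  also have "dual_of s (\<lambda>k. u0 (\<Phi> k)) = u0" by (rule dual_of_coefs(1)[OF assms(5), symmetric])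
  also have "sqrt 2 * (HSdnorm s u0 + HSdnorm s (dual_of s (control_coef \<tau> f)))
      \<le> sqrt 2 * (max 1 (gain_norm s) * HSdnorm s u0 + max 1 (gain_norm s) * ?n)"
  proof (intro mult_left_mono add_mono)
    have "0 \<le> HSdnorm s u0"
      unfolding Hs_dual_norm_def using Hs_dual_summable[OF assms(5)] by (auto intro!: real_sqrt_ge_zero suminf_nonneg)
    from mult_right_mono[OF _ this, of 1 "max 1 (gain_norm s)"]
    show "HSdnorm s u0 \<le> max 1 (gain_norm s) * HSdnorm s u0" by simp
    show "HSdnorm s (dual_of s (control_coef \<tau> f)) \<le> max 1 (gain_norm s) * ?n"
      by (rule order_trans[OF control_norm[OF assms(1-4)]]) (intro mult_right_mono L2_space_norm_nonneg, simp)
  qed simp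
  finally show ?thesis by (simp only: distrib_left mult.assoc)
qed

text \<open>
  The essential supremum of a function that is not measurable is \<open>\<infinity>\<close>, so measurability of the norm
  is part of the claim. It holds because the squared norm is a series in the continuous coefficients.
\<close>

lemma weak_solution_esssup:
  assumes "s > \<nu>" "0 < T" "f \<in> L2_space (lebesgue_on {0<..<T})" "u0 \<in> HSdual s"
    and u: "weak_solution \<alpha> \<beta> \<mu> s T u0 f u"
  shows "esssup (lebesgue_on {0..T}) (\<lambda>t. ereal (HSdnorm s (u t)))
    \<le> ereal (sqrt 2 * max 1 (gain_norm s) * (HSdnorm s u0 + L2_space_norm (lebesgue_on {0<..<T}) f))"
proof (rule esssup_I)
  note ut = weak_solution_eq[OF assms(1-4) u]
  have [measurable]: "(\<lambda>t. solution_coef u0 f t k) \<in> borel_measurable (lebesgue_on {0..T})" for k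
    using continuous_on_solution_coef[OF less_imp_le[OF assms(2)] assms(3)]
    by (rule continuous_imp_measurable_on_sets_lebesgue) simp
  have "(\<lambda>t. ereal (sqrt (\<Sum>k. ev k powr (- s) * \<bar>solution_coef u0 f t k\<bar>\<^sup>2))) \<in> borel_measurable (lebesgue_on {0..T})"
    by measurable
  then show "(\<lambda>t. ereal (HSdnorm s (u t))) \<in> borel_measurable (lebesgue_on {0..T})"
    by (rule measurable_cong[THEN iffD1, rotated]) (simp add: ut Hs_dual_norm_dual_of)
  show "AE t in lebesgue_on {0..T}. ereal (HSdnorm s (u t))
      \<le> ereal (sqrt 2 * max 1 (gain_norm s) * (HSdnorm s u0 + L2_space_norm (lebesgue_on {0<..<T}) f))"
  proof (rule AE_I2)
    fix t assume "t \<in> space (lebesgue_on {0..T})"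
    then have t: "t \<in> {0..T}" by simp
    show "ereal (HSdnorm s (u t)) \<le> ereal (sqrt 2 * max 1 (gain_norm s) * (HSdnorm s u0 + L2_space_norm (lebesgue_on {0<..<T}) f))"
      unfolding ut[OF t] ereal_less_eq using t by (intro solution_norm assms) auto
  qed
qed

end

section \<open>The transposition solution\<close>

theorem proposition13:
  fixes T \<alpha> \<beta> \<mu> s :: real
  assumes "0 < T"
    and "0 \<le> \<alpha>" and "\<alpha> < 2"
    and "\<alpha> + \<beta> > 1"
    and "\<mu> < mu_crit (\<alpha> + \<beta>)"
    and "s > nu \<alpha> \<beta> \<mu>"
  shows
    \<comment> \<open>the terms of the transposition formula are meaningful\<close>
    "(\<forall>z\<in>Hs \<alpha> \<beta> \<mu> s.
        (\<forall>t\<ge>0. semigroup_fun \<alpha> \<beta> \<mu> t z \<in> Hs \<alpha> \<beta> \<mu> s)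
      \<and> (\<forall>t>0. bdry_exists (\<alpha> + \<beta> + gam \<alpha> \<beta> \<mu>) (semigroup_fun \<alpha> \<beta> \<mu> t z))
      \<and> (\<forall>f\<in>L2_space (lebesgue_on {0<..<T}). \<forall>\<tau>\<in>{0..T}.
           set_integrable lebesgue {0<..<\<tau>} (\<lambda>t. f t * bdry_semigroup \<alpha> \<beta> \<mu> (\<tau> - t) z)))
    \<comment> \<open>it defines a unique element of the dual space, given by the semigroup and the control operator\<close>
   \<and> (\<forall>u0\<in>Hs_dual \<alpha> \<beta> \<mu> s. \<forall>f\<in>L2_space (lebesgue_on {0<..<T}).
        (\<forall>\<tau>\<in>{0..T}. \<exists>!v. v \<in> Hs_dual \<alpha> \<beta> \<mu> s \<and> transposition \<alpha> \<beta> \<mu> s u0 f \<tau> v)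
      \<and> (\<forall>\<tau>\<in>{0<..T}. \<forall>v\<in>Hs_dual \<alpha> \<beta> \<mu> s. transposition \<alpha> \<beta> \<mu> s u0 f \<tau> v \<longrightarrow>
           v = (\<lambda>z. semigroup_dual \<alpha> \<beta> \<mu> s \<tau> u0 z - control_op \<alpha> \<beta> \<mu> s \<tau> f z)))
    \<comment> \<open>the control operators are bounded linear operators\<close>
   \<and> (\<forall>\<tau>\<in>{0..T}.
        (\<forall>f\<in>L2_space (lebesgue_on {0<..<T}). control_op \<alpha> \<beta> \<mu> s \<tau> f \<in> Hs_dual \<alpha> \<beta> \<mu> s)
      \<and> (\<forall>f\<in>L2_space (lebesgue_on {0<..<T}). \<forall>g\<in>L2_space (lebesgue_on {0<..<T}). \<forall>a b.
           control_op \<alpha> \<beta> \<mu> s \<tau> (\<lambda>t. a * f t + b * g t)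
             = (\<lambda>z. a * control_op \<alpha> \<beta> \<mu> s \<tau> f z + b * control_op \<alpha> \<beta> \<mu> s \<tau> g z))
      \<and> (\<exists>K. \<forall>f\<in>L2_space (lebesgue_on {0<..<T}).
           Hs_dual_norm \<alpha> \<beta> \<mu> s (control_op \<alpha> \<beta> \<mu> s \<tau> f) \<le> K * L2_space_norm (lebesgue_on {0<..<T}) f))
    \<comment> \<open>and form a strongly continuous family\<close>
   \<and> (\<forall>f\<in>L2_space (lebesgue_on {0<..<T}). (\<lambda>\<tau>. control_op \<alpha> \<beta> \<mu> s \<tau> f) \<in> C0_dual \<alpha> \<beta> \<mu> s T)
    \<comment> \<open>existence and uniqueness on \<open>[0, T]\<close> of the weak solution\<close>
   \<and> (\<forall>u0\<in>Hs_dual \<alpha> \<beta> \<mu> s. \<forall>f\<in>L2_space (lebesgue_on {0<..<T}).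
        \<exists>u. weak_solution \<alpha> \<beta> \<mu> s T u0 f u
          \<and> (\<forall>v. weak_solution \<alpha> \<beta> \<mu> s T u0 f v \<longrightarrow> (\<forall>t\<in>{0..T}. v t = u t)))
    \<comment> \<open>the a priori estimate\<close>
   \<and> (\<exists>C>0. \<forall>u0\<in>Hs_dual \<alpha> \<beta> \<mu> s. \<forall>f\<in>L2_space (lebesgue_on {0<..<T}). \<forall>u.
        weak_solution \<alpha> \<beta> \<mu> s T u0 f u \<longrightarrow>
          esssup (lebesgue_on {0..T}) (\<lambda>t. ereal (Hs_dual_norm \<alpha> \<beta> \<mu> s (u t)))
            \<le> ereal (C * (Hs_dual_norm \<alpha> \<beta> \<mu> s u0 + L2_space_norm (lebesgue_on {0<..<T}) f)))"
proof -
  interpret degenerate_problem \<alpha> \<beta> \<mu>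
    using assms by unfold_locales
  let ?N = "lebesgue_on {0<..<T}"
  note s = assms(6)
  have T: "0 \<le> T" using assms(1) by simp
  show ?thesis
  proof (intro conjI ballI allI impI)
    fix z assume z: "z \<in> HS s"
    show "SG t z \<in> HS s" if "t \<ge> 0" for t
      using semigroup_in_Hs(1)[OF z, of t] z that by (cases "t = 0") (auto simp: semigroup_fun_def)
    show "bdry_exists \<delta> (SG t z)" if "t > 0" for t
      by (rule bdry_semigroup_eq(1)[OF z that])
    show "set_integrable lebesgue {0<..<\<tau>} (\<lambda>t. f t * bdry_semigroup \<alpha> \<beta> \<mu> (\<tau> - t) z)"
      if "f \<in> L2_space ?N" "\<tau> \<in> {0..T}" for f \<tau>
      using boundary_observation(1)[OF s _ _ that(1) z] that(2) by simp
  next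
    fix u0 f \<tau> assume u0: "u0 \<in> HSdual s" and f: "f \<in> L2_space ?N" and \<tau>: "\<tau> \<in> {0..T}"
    then show "\<exists>!v. v \<in> HSdual s \<and> transposition \<alpha> \<beta> \<mu> s u0 f \<tau> v"
      using transposition_iff[OF s _ _ f u0, of \<tau>] by simp
  next
    fix u0 f \<tau> v
    assume u0: "u0 \<in> HSdual s" and f: "f \<in> L2_space ?N" and \<tau>: "\<tau> \<in> {0<..T}"
      and v: "v \<in> HSdual s" "transposition \<alpha> \<beta> \<mu> s u0 f \<tau> v"
    have \<tau>': "0 \<le> \<tau>" "\<tau> \<le> T" using \<tau> by auto
    show "v = (\<lambda>z. semigroup_dual \<alpha> \<beta> \<mu> s \<tau> u0 z - control_op \<alpha> \<beta> \<mu> s \<tau> f z)"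
      using transposition_iff[OF s \<tau>' f u0, of v] v unfolding solution_eq(1)[OF s \<tau>' f u0] by blast
  next
    fix \<tau> f assume "\<tau> \<in> {0..T}" and f: "f \<in> L2_space ?N"
    then have \<tau>: "0 \<le> \<tau>" "\<tau> \<le> T" by auto
    show "control_op \<alpha> \<beta> \<mu> s \<tau> f \<in> HSdual s"
      unfolding control_op_eq[OF s \<tau> f] by (rule dual_of_in_dual[OF control_coef_dual_seq[OF s \<tau> f]])
  next
    fix \<tau> f g a b assume "\<tau> \<in> {0..T}" and f: "f \<in> L2_space ?N" and g: "g \<in> L2_space ?N"
    then have \<tau>: "0 \<le> \<tau>" "\<tau> \<le> T" by auto
    show "control_op \<alpha> \<beta> \<mu> s \<tau> (\<lambda>t. a * f t + b * g t)
        = (\<lambda>z. a * control_op \<alpha> \<beta> \<mu> s \<tau> f z + b * control_op \<alpha> \<beta> \<mu> s \<tau> g z)"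
      unfolding control_op_eq[OF s \<tau> f] control_op_eq[OF s \<tau> g] control_op_eq[OF s \<tau> L2_space_lincomb[OF f g]]
        control_coef_lincomb[OF \<tau> f g]
      by (rule ext) (rule dual_of_lincomb[OF control_coef_dual_seq[OF s \<tau> f] control_coef_dual_seq[OF s \<tau> g]])
  next
    fix \<tau> assume "\<tau> \<in> {0..T}"
    then have \<tau>: "0 \<le> \<tau>" "\<tau> \<le> T" by auto
    show "\<exists>K. \<forall>f\<in>L2_space ?N. HSdnorm s (control_op \<alpha> \<beta> \<mu> s \<tau> f) \<le> K * L2_space_norm ?N f"
      using control_norm[OF s \<tau>] control_op_eq[OF s \<tau>] by (intro exI[of _ "gain_norm s"]) simp
  next
    fix f assume f: "f \<in> L2_space ?N"
    show "(\<lambda>\<tau>. control_op \<alpha> \<beta> \<mu> s \<tau> f) \<in> C0_dual \<alpha> \<beta> \<mu> s T"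
    proof (rule C0_dual_of[OF dual_seq_scale[OF gain_in_dual_seq[OF s], of "L2_space_norm ?N f"]])
      fix \<tau> assume \<tau>: "\<tau> \<in> {0..T}"
      show "control_op \<alpha> \<beta> \<mu> s \<tau> f = dual_of s (control_coef \<tau> f)"
        using control_op_eq[OF s _ _ f] \<tau> by simp
      show "\<bar>control_coef \<tau> f k\<bar> \<le> L2_space_norm ?N f * gain k" for k
        using control_coef_bound[OF _ _ f] \<tau> by simp
    qed (rule continuous_on_control_coef[OF T f])
  next
    fix u0 f assume u0: "u0 \<in> HSdual s" and f: "f \<in> L2_space ?N"
    let ?u = "\<lambda>\<tau>. dual_of s (solution_coef u0 f \<tau>)"
    have "transposition \<alpha> \<beta> \<mu> s u0 f \<tau> (?u \<tau>)" if "\<tau> \<in> {0<..T}" for \<tau>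
      using transposition_iff[OF s _ _ f u0, of \<tau> "?u \<tau>"] that by simp
    then have "weak_solution \<alpha> \<beta> \<mu> s T u0 f ?u"
      unfolding weak_solution_def using solution_in_C0[OF s T f u0] by blast
    then show "\<exists>u. weak_solution \<alpha> \<beta> \<mu> s T u0 f u
        \<and> (\<forall>v. weak_solution \<alpha> \<beta> \<mu> s T u0 f v \<longrightarrow> (\<forall>t\<in>{0..T}. v t = u t))"
      using weak_solution_eq[OF s assms(1) f u0] by blast
  next
    show "\<exists>C>0. \<forall>u0\<in>HSdual s. \<forall>f\<in>L2_space ?N. \<forall>u. weak_solution \<alpha> \<beta> \<mu> s T u0 f u \<longrightarrow>
        esssup (lebesgue_on {0..T}) (\<lambda>t. ereal (HSdnorm s (u t)))
          \<le> ereal (C * (HSdnorm s u0 + L2_space_norm ?N f))"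
      using weak_solution_esssup[OF s assms(1)]
      by (intro exI[of _ "sqrt 2 * max 1 (gain_norm s)"] conjI) (auto simp: less_max_iff_disj)
  qed
qed

end
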